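(* For any $\nu\in(0,1)$ and for all $\varphi\in H^1(\mathbb{R}^3,\mathbb{C}^2)$, $$\int_{\mathbb{R}^3}\left(\frac{|\boldsymbol{\sigma}\cdot\boldsymbol{\nabla}\varphi|^2}{1+\sqrt{1-\nu^2}+\frac{\nu}{|x|}}+\Big(1-\sqrt{1-\nu^2}\Big)|\varphi|^2\right)dx\ \geq\ \nu\int_{\mathbb{R}^3}\frac{|\varphi|^2}{|x|}\,dx .$$
   Context: $\boldsymbol{\sigma}=(\sigma_1,\sigma_2,\sigma_3)$ are the Pauli matrices $\sigma_1=\begin{pmatrix}0&1\\1&0\end{pmatrix}$, $\sigma_2=\begin{pmatrix}0&-i\\i&0\end{pmatrix}$, $\sigma_3=\begin{pmatrix}1&0\\0&-1\end{pmatrix}$, and $\boldsymbol{\sigma}\cdot\boldsymbol{\nabla}=\sum_{k=1}^3\sigma_k\partial_k$ acts on $\mathbb{C}^2$-valued functions. $|\cdot|$ denotes the Hermitian norm on $\mathbb{C}^2$. *)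

theory Defs
  imports "HOL-Analysis.Analysis"
begin

text \<open>\<open>Ck k f\<close>: \<open>f\<close> is \<open>k\<close> times continuously differentiable on the whole space,
  in terms of iterated directional derivatives.\<close>

primrec Ck :: "nat \<Rightarrow> ('a::euclidean_space \<Rightarrow> 'b::real_normed_vector) \<Rightarrow> bool" where
  "Ck 0 f \<longleftrightarrow> continuous_on UNIV f"
| "Ck (Suc k) f \<longleftrightarrow>
     (\<forall>x. f differentiable (at x)) \<and> (\<forall>v. Ck k (\<lambda>x. frechet_derivative f (at x) v))"

definition test_functions :: "('a::euclidean_space \<Rightarrow> real) set" where
  "test_functions = {\<eta>. (\<forall>k. Ck k \<eta>) \<and> compact (closure {x. \<eta> x \<noteq> 0})}"

definition L2_space :: "('a::euclidean_space \<Rightarrow> 'b::euclidean_space) set" where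
  "L2_space = {f. f \<in> borel_measurable lebesgue \<and> integrable lebesgue (\<lambda>x. (norm (f x))\<^sup>2)}"

text \<open>\<open>g\<close> is an \<open>L\<^sup>2\<close> function that is a distributional partial derivative of \<open>f\<close> in the
  direction of the \<open>k\<close>-th coordinate. For \<open>f\<close> in \<open>L\<^sup>2\<close> both integrands below are integrable.
  Testing against real-valued \<open>\<eta>\<close> is enough, also when \<open>f\<close> is complex-valued.\<close>

definition has_weak_partial ::
    "'n::finite \<Rightarrow> (real^'n \<Rightarrow> 'b::euclidean_space) \<Rightarrow> (real^'n \<Rightarrow> 'b) \<Rightarrow> bool" where
  "has_weak_partial k f g \<longleftrightarrow> g \<in> L2_space \<and>
     (\<forall>\<eta>\<in>test_functions.
        (\<integral>x. frechet_derivative \<eta> (at x) (axis k 1) *\<^sub>R f x \<partial>lebesgue) =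
        - (\<integral>x. \<eta> x *\<^sub>R g x \<partial>lebesgue))"

definition H1_space :: "(real^'n::finite \<Rightarrow> 'b::euclidean_space) set" where
  "H1_space = {f \<in> L2_space. \<forall>k. \<exists>g. has_weak_partial k f g}"

text \<open>A representative of the weak partial derivative, which is unique up to null sets.\<close>

definition weak_partial ::
    "'n::finite \<Rightarrow> (real^'n \<Rightarrow> 'b::euclidean_space) \<Rightarrow> real^'n \<Rightarrow> 'b" where
  "weak_partial k f = (SOME g. has_weak_partial k f g)"

definition pauli :: "3 \<Rightarrow> complex^2^2" where
  "pauli k =
     (if k = 1 then vector [vector [0, 1], vector [1, 0]]
      else if k = 2 then vector [vector [0, - \<i>], vector [\<i>, 0]]
      else vector [vector [1, 0], vector [0, - 1]])"

definition sigma_grad :: "(real^3 \<Rightarrow> complex^2) \<Rightarrow> real^3 \<Rightarrow> complex^2" where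
  "sigma_grad \<phi> x = (\<Sum>k\<in>UNIV. pauli k *v weak_partial k \<phi> x)"

end

theory Submission
  imports Defs
begin

text \<open>
  Put \<open>s = sqrt (1 - \<nu>\<^sup>2)\<close>, \<open>a = 1 + s\<close>, \<open>b = 1 - s\<close> and
  \<open>\<rho>(r) = r / (a r + \<nu>)\<close>, the reciprocal of \<open>a + \<nu>/r\<close>. No spherical harmonics are needed.
  Split \<open>\<sigma>\<cdot>\<nabla>\<phi>\<close> into its radial and tangential parts. The Jacobian of the vector
  field \<open>h(x) = \<rho>(|x|) x\<close> pairs with the two-forms
  \<open>\<langle>\<sigma>\<^sub>j d\<phi>, \<sigma>\<^sub>k d\<phi>\<rangle>\<close> to a null Lagrangian, and pointwise
  \<open>\<rho> |\<sigma>\<cdot>\<nabla>\<phi>|\<^sup>2\<close> exceeds \<open>\<rho> |\<partial>\<^sub>r\<phi>|\<^sup>2\<close> plus this null Lagrangian,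
  because \<open>|\<sigma>\<cdot>t|\<^sup>2 \<le> 2 |t|\<^sup>2\<close> for tangential \<open>t\<close> and \<open>|r \<rho>'| \<le> \<rho>\<close>.
  There remains the scalar inequality
  \<open>\<integral> \<rho> |\<partial>\<^sub>r\<phi>|\<^sup>2 + b |\<phi>|\<^sup>2 \<ge> \<nu> \<integral> |\<phi>|\<^sup>2 / r\<close>, which follows by completing the square
  with the Dirac-Coulomb ground state. To reach \<open>H\<^sup>1\<close>, the function is mollified, \<open>h\<close> is divided by
  \<open>1 + \<eta> r\<close> to be bounded, and \<open>1/r\<close> is replaced by \<open>1/(r + \<delta>)\<close>.
\<close>

section \<open>Test functions and mollifiers\<close>

text \<open>The obstacle is the varying weight. Were \<rho> constant, the cross terms of
  |\<sigma>.grad \<phi>|^2 would integrate to 0; here they leave a term with \<rho>' and of no fixed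
  sign. The field h is chosen to absorb it: its Jacobian is \<rho> I + r \<rho>' n n^T with n = x/r.
  The first part reproduces the cross terms, the second sees only the tangential gradient t. Let N
  be the cross terms of t, so that |t|^2 + N = |\<sigma>.t|^2. Then 0 <= |t|^2 + N <= 2 |t|^2 says
  exactly |N| <= |t|^2, and r \<rho>' N is paid for by \<rho> |t|^2. The ratio r \<rho>' / \<rho> =
  \<nu> / (a r + \<nu>) tends to 1 at the origin, so the constant 3, giving only N <= 2 |t|^2, would
  not do.

  The limits are nested. For each mollified spinor \<eta> tends to 0; then the mollification is
  removed at fixed \<delta>, where all weights are bounded and L^2 convergence suffices; last,
  \<delta> tends to 0 by monotone convergence, so that finiteness of the Coulomb integral is a
  result and not an assumption.\<close>

definition exp_bump :: "real poly \<Rightarrow> real \<Rightarrow> real" where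
  "exp_bump p t = (if 0 < t then poly p (1 / t) * exp (- (1 / t)) else 0)"

lemma tendsto_poly_times_exp_minus:
  "((\<lambda>y. poly p y * exp (- y)) \<longlongrightarrow> (0::real)) at_top"
proof -
  have "((\<lambda>y. \<Sum>i\<le>degree p. coeff p i * (y ^ i / exp y)) \<longlongrightarrow> (\<Sum>i\<le>degree p. coeff p i * 0)) at_top"
    by (intro tendsto_intros tendsto_power_div_exp_0)
  moreover have "(\<lambda>y. \<Sum>i\<le>degree p. coeff p i * (y ^ i / exp y)) = (\<lambda>y. poly p y * exp (- y))"
    by (simp add: poly_altdef exp_minus sum_distrib_right divide_inverse mult.assoc)
  ultimately show ?thesis by simp
qed

text \<open>The functions p(1/t) exp(-1/t), extended by zero, are closed under differentiation,
  since (1/t)' = -(1/t)^2 turns p into X^2 (p - p'). Carrying the polynomial makes smoothness of all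
  orders a single induction.\<close>

lemma has_real_derivative_exp_bump:
  "(exp_bump p has_real_derivative exp_bump ([:0, 0, 1:] * (p - pderiv p)) t) (at t)"
proof -
  consider "t > 0" | "t < 0" | "t = 0" by linarith
  then show ?thesis
  proof cases
    case 1
    have "((\<lambda>t. poly p (1 / t) * exp (- (1 / t))) has_real_derivative
       exp_bump ([:0, 0, 1:] * (p - pderiv p)) t) (at t)"
    proof (rule DERIV_cong[OF DERIV_mult])
      have inv: "((\<lambda>t. 1 / t) has_real_derivative - (1 / t\<^sup>2)) (at t)"
        using 1 by (auto intro!: derivative_eq_intros simp: power2_eq_square)
      show "((\<lambda>t. poly p (1 / t)) has_real_derivative poly (pderiv p) (1 / t) * (- (1 / t\<^sup>2))) (at t)"
        by (rule DERIV_chain2[OF poly_DERIV inv])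
      show "((\<lambda>t. exp (- (1 / t))) has_real_derivative exp (- (1 / t)) * - (- (1 / t\<^sup>2))) (at t)"
        by (rule DERIV_chain2[OF DERIV_exp DERIV_minus[OF inv]])
    qed (use 1 in \<open>simp add: exp_bump_def power2_eq_square algebra_simps\<close>)
    then show ?thesis
      by (rule has_field_derivative_transform_within_open[where S = "{0<..}"])
         (use 1 in \<open>auto simp: exp_bump_def\<close>)
  next
    case 2
    have "((\<lambda>t. 0) has_real_derivative exp_bump ([:0, 0, 1:] * (p - pderiv p)) t) (at t)"
      using 2 by (simp add: exp_bump_def)
    then show ?thesis
      by (rule has_field_derivative_transform_within_open[where S = "{..<0}"])
         (use 2 in \<open>auto simp: exp_bump_def\<close>)
  next
    case 3
    \<comment> \<open>The right difference quotient at 0 has one more factor 1/h, hence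
      \<open>pCons 0 p\<close>.\<close>
    have "((\<lambda>h. poly (pCons 0 p) (inverse h) * exp (- inverse h)) \<longlongrightarrow> 0) (at_right 0)"
      by (rule filterlim_compose[OF tendsto_poly_times_exp_minus filterlim_inverse_at_top_right])
    then have r: "((\<lambda>h. (exp_bump p (0 + h) - exp_bump p 0) / h) \<longlongrightarrow> 0) (at_right 0)"
      by (rule Lim_transform_eventually)
         (auto simp: exp_bump_def eventually_at_filter field_simps)
    have "((\<lambda>h. 0) \<longlongrightarrow> (0::real)) (at_left 0)" by simp
    then have l: "((\<lambda>h. (exp_bump p (0 + h) - exp_bump p 0) / h) \<longlongrightarrow> 0) (at_left 0)"
      by (rule Lim_transform_eventually)
         (auto simp: exp_bump_def eventually_at_filter field_simps)
    from l r show ?thesis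
      unfolding 3 DERIV_def by (simp add: filterlim_split_at exp_bump_def)
  qed
qed

section \<open>Calculus of iterated derivatives\<close>

lemma Ck_Suc_imp: "Ck (Suc k) f \<Longrightarrow> Ck k f"
proof (induction k arbitrary: f)
  case 0
  then show ?case
    by (auto simp: continuous_on_eq_continuous_at intro: differentiable_imp_continuous_within)
next
  case (Suc k)
  then show ?case by auto
qed

text \<open>\<open>Ck\<close> speaks of \<open>frechet_derivative\<close>, a chosen derivative;
  uniqueness lets any explicit candidate stand in for it.\<close>

lemma Ck_SucI:
  assumes "\<And>x. (f has_derivative f' x) (at x)" "\<And>v. Ck k (\<lambda>x. f' x v)"
  shows "Ck (Suc k) f"
proof -
  have "frechet_derivative f (at x) = f' x" for x
    using frechet_derivative_at[OF assms(1)] by metis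
  then show ?thesis using assms by (auto simp: differentiable_def)
qed

lemma Ck_SucD:
  assumes "Ck (Suc k) f"
  shows "(f has_derivative frechet_derivative f (at x)) (at x)"
    and "Ck k (\<lambda>x. frechet_derivative f (at x) v)"
  using assms frechet_derivative_works by auto

lemma Ck_const: "Ck k (\<lambda>x. c)"
proof (induction k arbitrary: c)
  case (Suc k)
  show ?case by (rule Ck_SucI[where f' = "\<lambda>x v. 0"]) (auto intro: Suc)
qed auto

lemma Ck_add:
  assumes "Ck k f" "Ck k g" shows "Ck k (\<lambda>x. f x + g x)"
  using assms
proof (induction k arbitrary: f g)
  case (Suc k)
  show ?case
    by (rule Ck_SucI[where f' = "\<lambda>x v. frechet_derivative f (at x) v + frechet_derivative g (at x) v"])
       (use Suc in \<open>auto intro!: has_derivative_add Suc.IH Ck_SucD\<close>)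
qed (auto intro: continuous_on_add)

lemma Ck_mult:
  fixes f g :: "'a::euclidean_space \<Rightarrow> real"
  assumes "Ck k f" "Ck k g" shows "Ck k (\<lambda>x. f x * g x)"
  using assms
proof (induction k arbitrary: f g)
  case (Suc k)
  show ?case
  proof (rule Ck_SucI)
    show "((\<lambda>x. f x * g x) has_derivative
        (\<lambda>v. f x * frechet_derivative g (at x) v + frechet_derivative f (at x) v * g x)) (at x)" for x
      by (intro has_derivative_mult Ck_SucD(1)[OF Suc.prems(1)] Ck_SucD(1)[OF Suc.prems(2)])
    show "Ck k (\<lambda>x. f x * frechet_derivative g (at x) v + frechet_derivative f (at x) v * g x)" for v
      by (intro Ck_add Suc.IH Ck_SucD(2)[OF Suc.prems(1)] Ck_SucD(2)[OF Suc.prems(2)]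
        Ck_Suc_imp[OF Suc.prems(1)] Ck_Suc_imp[OF Suc.prems(2)])
  qed
qed (auto intro: continuous_on_mult)

lemma Ck_affine:
  fixes f :: "'a::euclidean_space \<Rightarrow> real"
  assumes "Ck k f" shows "Ck k (\<lambda>x. f (a + c *\<^sub>R x))"
  using assms
proof (induction k arbitrary: f)
  case 0
  then show ?case by (auto intro!: continuous_intros intro: continuous_on_compose2)
next
  case (Suc k)
  have lin: "frechet_derivative f (at x) (c *\<^sub>R v) = c * frechet_derivative f (at x) v" for x v
    using linear_frechet_derivative[of f "at x"] Suc.prems by (simp add: linear_scale)
  show ?case
  proof (rule Ck_SucI[where f' = "\<lambda>x v. c * frechet_derivative f (at (a + c *\<^sub>R x)) v"])
    fix x
    have "((\<lambda>x. f (a + c *\<^sub>R x)) has_derivative (\<lambda>v. frechet_derivative f (at (a + c *\<^sub>R x)) (c *\<^sub>R v))) (at x)"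
      by (rule has_derivative_compose[OF _ Ck_SucD(1)[OF Suc.prems]]) (auto intro!: derivative_eq_intros)
    then show "((\<lambda>x. f (a + c *\<^sub>R x)) has_derivative (\<lambda>v. c * frechet_derivative f (at (a + c *\<^sub>R x)) v)) (at x)"
      by (simp add: lin)
    show "Ck k (\<lambda>x. c * frechet_derivative f (at (a + c *\<^sub>R x)) v)" for v
      using Suc.IH[of "\<lambda>x. frechet_derivative f (at x) v"] Suc.prems
      by (intro Ck_mult Ck_const) auto
  qed
qed

lemma Ck_exp_bump: "Ck k (\<lambda>x::'a::euclidean_space. exp_bump p (c + x \<bullet> w))"
proof (induction k arbitrary: p)
  case 0
  have "isCont (exp_bump p) t" for t
    by (rule DERIV_isCont[OF has_real_derivative_exp_bump])
  then have "continuous_on UNIV (exp_bump p)"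
    by (simp add: continuous_on_eq_continuous_at)
  then show ?case
    by (auto intro!: continuous_intros intro: continuous_on_compose2)
next
  case (Suc k)
  let ?q = "[:0, 0, 1:] * (p - pderiv p)"
  show ?case
  proof (rule Ck_SucI[where f' = "\<lambda>x v. exp_bump ?q (c + x \<bullet> w) * (v \<bullet> w)"])
    fix x :: 'a
    show "((\<lambda>x. exp_bump p (c + x \<bullet> w)) has_derivative (\<lambda>v. exp_bump ?q (c + x \<bullet> w) * (v \<bullet> w))) (at x)"
      by (rule has_derivative_compose[OF _ has_real_derivative_exp_bump[unfolded has_field_derivative_def]])
         (auto intro!: derivative_eq_intros)
  qed (intro Ck_mult Ck_const Suc.IH)
qed

lemma Ck_prod:
  fixes f :: "'i \<Rightarrow> 'a::euclidean_space \<Rightarrow> real"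
  assumes "\<And>i. i \<in> I \<Longrightarrow> Ck k (f i)" shows "Ck k (\<lambda>x. \<Prod>i\<in>I. f i x)"
  using assms by (induction I rule: infinite_finite_induct) (auto intro!: Ck_const Ck_mult)

section \<open>A smooth bump function of compact support\<close>

definition unit_bump :: "'a::euclidean_space \<Rightarrow> real" where
  "unit_bump x = (\<Prod>b\<in>Basis. exp_bump 1 (1 + x \<bullet> b) * exp_bump 1 (1 + x \<bullet> (- b)))"

lemma exp_bump_1_nonneg: "exp_bump 1 t \<ge> 0" and exp_bump_1_eq_0: "exp_bump 1 t = 0 \<longleftrightarrow> t \<le> 0"
  by (auto simp: exp_bump_def)

text \<open>A product over coordinates, supported in a cube, puts only affine arguments into
  \<open>exp_bump\<close>, so no derivative of the norm has to be handled.\<close>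

lemma Ck_unit_bump: "Ck k unit_bump"
  unfolding unit_bump_def[abs_def] by (intro Ck_prod Ck_mult Ck_exp_bump)

lemma unit_bump_nonneg: "unit_bump x \<ge> 0"
  unfolding unit_bump_def by (intro prod_nonneg ballI mult_nonneg_nonneg exp_bump_1_nonneg)

lemma unit_bump_0: "unit_bump 0 \<noteq> 0"
  by (simp add: unit_bump_def exp_bump_1_eq_0)

lemma unit_bump_support: "{x. unit_bump x \<noteq> 0} \<subseteq> cbox (- One) One"
  by (fastforce simp: unit_bump_def exp_bump_1_eq_0 mem_box not_le)

section \<open>Test functions: support, closure properties, integrability\<close>

lemma test_functionD:
  assumes "f \<in> test_functions"
  shows "Ck k f" "bounded {x. f x \<noteq> 0}"
  using assms bounded_subset[OF compact_imp_bounded closure_subset] by (auto simp: test_functions_def)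

lemma test_functionI:
  assumes "\<And>k. Ck k f" "bounded {x. f x \<noteq> 0}"
  shows "f \<in> test_functions"
  using assms by (auto simp: test_functions_def compact_closure)

lemma test_function_has_derivative:
  "f \<in> test_functions \<Longrightarrow> (f has_derivative frechet_derivative f (at x)) (at x)"
  using Ck_SucD(1)[OF test_functionD(1)] .

lemma test_function_continuous: "f \<in> test_functions \<Longrightarrow> continuous_on UNIV f"
  using test_functionD(1)[of f 0] by simp

lemma test_function_vanishes:
  fixes f :: "'a::euclidean_space \<Rightarrow> real"
  assumes "f \<in> test_functions"
  obtains R where "R > 0" "\<And>x. R \<le> norm x \<Longrightarrow> f x = 0"
proof -
  obtain R where "R > 0" "\<And>x. f x \<noteq> 0 \<Longrightarrow> norm x < R"
    using test_functionD(2)[OF assms] by (auto simp: bounded_pos_less)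
  then show thesis using that[of R] by fastforce
qed

lemma test_function_affine:
  fixes f :: "'a::euclidean_space \<Rightarrow> real"
  assumes "f \<in> test_functions" "c \<noteq> 0"
  shows "(\<lambda>x. f (a + c *\<^sub>R x)) \<in> test_functions"
proof (rule test_functionI)
  show "Ck k (\<lambda>x. f (a + c *\<^sub>R x))" for k
    by (intro Ck_affine test_functionD(1) assms)
  obtain R where R: "\<And>x. R \<le> norm x \<Longrightarrow> f x = 0"
    using test_function_vanishes[OF assms(1)] by metis
  have "norm x \<le> (R + norm a) / \<bar>c\<bar>" if "f (a + c *\<^sub>R x) \<noteq> 0" for x
  proof -
    have "norm (c *\<^sub>R x) \<le> norm (a + c *\<^sub>R x) + norm a"
      by (metis norm_triangle_sub norm_minus_commute add_diff_cancel_left' add.commute)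
    moreover have "norm (a + c *\<^sub>R x) \<le> R"
      using that R[of "a + c *\<^sub>R x"] by fastforce
    ultimately show ?thesis using assms(2)
      by (simp add: field_simps)
  qed
  then show "bounded {x. f (a + c *\<^sub>R x) \<noteq> 0}" by (auto simp: bounded_iff)
qed

lemma test_function_scale:
  assumes "f \<in> test_functions" shows "(\<lambda>x. c * f x) \<in> test_functions"
proof (rule test_functionI)
  show "bounded {x. c * f x \<noteq> 0}"
    by (rule bounded_subset[OF test_functionD(2)[OF assms]]) auto
qed (intro Ck_mult Ck_const test_functionD(1) assms)

lemma test_function_deriv:
  fixes f :: "'a::euclidean_space \<Rightarrow> real"
  assumes "f \<in> test_functions"
  shows "(\<lambda>x. frechet_derivative f (at x) v) \<in> test_functions"
proof (rule test_functionI)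
  show "Ck k (\<lambda>x. frechet_derivative f (at x) v)" for k
    by (intro Ck_SucD(2) test_functionD(1) assms)
  have "frechet_derivative f (at x) v = 0" if "x \<notin> closure {x. f x \<noteq> 0}" for x
  proof -
    have "(f has_derivative (\<lambda>_. 0)) (at x)"
      by (rule has_derivative_transform_within_open[where f = "\<lambda>_. 0" and s = "- closure {x. f x \<noteq> 0}"])
         (use that closure_subset[of "{x. f x \<noteq> 0}"] in auto)
    then show ?thesis by (metis frechet_derivative_at)
  qed
  then have "{x. frechet_derivative f (at x) v \<noteq> 0} \<subseteq> closure {x. f x \<noteq> 0}" by auto
  then show "bounded {x. frechet_derivative f (at x) v \<noteq> 0}"
    by (rule bounded_subset[rotated]) (use test_functionD(2)[OF assms] in auto)
qed

lemma test_function_bounded: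
  fixes f :: "'a::euclidean_space \<Rightarrow> real"
  assumes "f \<in> test_functions"
  obtains C where "C > 0" "\<And>x. \<bar>f x\<bar> \<le> C"
proof -
  obtain R where R: "R > 0" "\<And>x. R \<le> norm x \<Longrightarrow> f x = 0"
    using test_function_vanishes[OF assms] by metis
  have "compact (f ` cball 0 R)"
    by (intro compact_continuous_image continuous_on_subset[OF test_function_continuous[OF assms]]) auto
  then obtain C where C: "C > 0" "\<And>x. norm x \<le> R \<Longrightarrow> \<bar>f x\<bar> \<le> C"
    by (auto dest!: compact_imp_bounded simp: bounded_pos)
  show thesis
  proof (rule that[of C])
    show "\<bar>f x\<bar> \<le> C" for x using C R(2)[of x] by (cases "norm x \<le> R") auto
  qed (use C in auto)
qed

lemma test_function_integrable:
  fixes f :: "'a::euclidean_space \<Rightarrow> real"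
  assumes "f \<in> test_functions"
  shows "integrable lborel f"
proof -
  obtain R where R: "R > 0" "\<And>x. R \<le> norm x \<Longrightarrow> f x = 0"
    using test_function_vanishes[OF assms] by metis
  have "integrable lborel (\<lambda>x. indicator (cball 0 R) x *\<^sub>R f x)"
    using borel_integrable_compact[of "cball 0 R" f]
      continuous_on_subset[OF test_function_continuous[OF assms]]
    by (simp add: indicator_def if_distrib cong: if_cong)
  also have "(\<lambda>x. indicator (cball 0 R) x *\<^sub>R f x) = f"
    using R(2) by (fastforce simp: indicator_def)
  finally show ?thesis .
qed

lemma test_function_borel: "f \<in> test_functions \<Longrightarrow> f \<in> borel_measurable borel"
  using borel_measurable_continuous_onI[OF test_function_continuous] .

lemma unit_bump_test: "unit_bump \<in> test_functions"
  by (intro test_functionI Ck_unit_bump bounded_subset[OF bounded_cbox unit_bump_support])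

text \<open>If the integral were 0, the nonnegative bump would vanish almost everywhere. Its zero
  set is closed, hence would be the whole space, against the value at 0.\<close>

lemma unit_bump_integral_pos: "(\<integral>x. unit_bump x \<partial>(lborel :: 'a::euclidean_space measure)) > 0"
proof -
  have i: "integrable lborel (unit_bump :: 'a \<Rightarrow> real)"
    by (rule test_function_integrable[OF unit_bump_test])
  have "\<not> (AE x::'a in lborel. unit_bump x = 0)"
  proof
    assume ae: "AE x::'a in lborel. unit_bump x = 0"
    have "closed {x::'a. unit_bump x = 0}"
      by (rule closed_Collect_eq) (use test_function_continuous[OF unit_bump_test] in \<open>auto intro: continuous_intros\<close>)
    then have "(0::'a) \<in> {x. unit_bump x = 0}"
      by (rule mem_closed_if_AE_lebesgue) (use ae in \<open>auto intro: AE_completion\<close>)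
    then show False using unit_bump_0 by auto
  qed
  then have "(\<integral>x. unit_bump x \<partial>(lborel :: 'a measure)) \<noteq> 0"
    using integral_nonneg_eq_0_iff_AE[OF i] unit_bump_nonneg by auto
  then show ?thesis
    using integral_nonneg_AE[of "unit_bump :: 'a \<Rightarrow> real" lborel] unit_bump_nonneg by (auto simp: less_le)
qed

text \<open>The normalising factor is the integral of the rescaled bump itself and not a power of
  \<open>Suc n\<close>: total mass 1 is then immediate, and the scaling of the measure enters only
  through positivity of that integral.\<close>

definition mollifier :: "nat \<Rightarrow> 'a::euclidean_space \<Rightarrow> real" where
  "mollifier n x = inverse (\<integral>y. unit_bump (Suc n *\<^sub>R y) \<partial>(lborel :: 'a measure)) * unit_bump (Suc n *\<^sub>R x)"

lemma mollifier_test: "mollifier n \<in> test_functions"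
  unfolding mollifier_def[abs_def]
  using test_function_scale[OF test_function_affine[OF unit_bump_test, of "real (Suc n)" 0]] by simp

lemma lborel_scale_integral_pos:
  "(\<integral>y. unit_bump (real (Suc n) *\<^sub>R y) \<partial>(lborel :: 'a::euclidean_space measure)) > 0"
proof -
  have t: "(\<lambda>y::'a. unit_bump (real (Suc n) *\<^sub>R y)) \<in> test_functions"
    using test_function_affine[OF unit_bump_test, of "real (Suc n)" 0] by simp
  have m: "(unit_bump :: 'a \<Rightarrow> real) \<in> borel_measurable borel"
    by (rule test_function_borel[OF unit_bump_test])
  have *: "(lborel :: 'a measure) = density (distr lborel borel (\<lambda>x. 0 + real (Suc n) *\<^sub>R x)) (\<lambda>_. ennreal (\<bar>real (Suc n)\<bar> ^ DIM('a)))"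
    by (rule lborel_affine) auto
  have "(\<integral>x. unit_bump x \<partial>(lborel :: 'a measure)) = real (Suc n) ^ DIM('a) * (\<integral>y. unit_bump (real (Suc n) *\<^sub>R y) \<partial>(lborel :: 'a measure))"
    by (subst *) (use m in \<open>simp add: integral_density integral_distr del: of_nat_Suc\<close>)
  with unit_bump_integral_pos[where 'a = 'a] show ?thesis
    by (metis of_nat_0_less_iff zero_less_Suc zero_less_mult_pos zero_less_power)
qed

lemma mollifier_nonneg: "mollifier n (x::'a::euclidean_space) \<ge> 0"
  unfolding mollifier_def
  by (intro mult_nonneg_nonneg unit_bump_nonneg)
     (use lborel_scale_integral_pos[of n, where 'a = 'a] in \<open>simp add: less_imp_le del: of_nat_Suc\<close>)

lemma mollifier_integral: "(\<integral>x. mollifier n x \<partial>(lborel :: 'a::euclidean_space measure)) = 1"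
  unfolding mollifier_def using lborel_scale_integral_pos[of n, where 'a = 'a]
  by (simp del: of_nat_Suc)

text \<open>The support lies in a cube of half-side 1 / \<open>Suc n\<close>. Passing through the l1
  norm costs the dimension as a factor, which is harmless because only the shrinking to the origin
  matters.\<close>

lemma mollifier_support:
  fixes x :: "'a::euclidean_space"
  assumes "mollifier n x \<noteq> 0"
  shows "norm x \<le> DIM('a) / Suc n"
proof -
  have "unit_bump (real (Suc n) *\<^sub>R x) \<noteq> 0" using assms by (auto simp: mollifier_def)
  then have b: "real (Suc n) *\<^sub>R x \<in> cbox (- One) One" using unit_bump_support by blast
  have "norm (real (Suc n) *\<^sub>R x) \<le> (\<Sum>b\<in>Basis. \<bar>(real (Suc n) *\<^sub>R x) \<bullet> b\<bar>)" by (rule norm_le_l1)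
  also have "\<dots> \<le> (\<Sum>b\<in>(Basis::'a set). 1)"
    by (rule sum_mono) (use b in \<open>auto simp: mem_box abs_le_iff minus_le_iff\<close>)
  finally show ?thesis by (simp add: field_simps del: of_nat_Suc)
qed


section \<open>Symmetry of second derivatives\<close>

lemma test_function_line:
  fixes f :: "'a::euclidean_space \<Rightarrow> real"
  assumes "f \<in> test_functions"
  shows "((\<lambda>r. f (y + r *\<^sub>R d)) has_real_derivative frechet_derivative f (at (y + r *\<^sub>R d)) d) (at r)"
proof -
  have "((\<lambda>r. f (y + r *\<^sub>R d)) has_derivative (\<lambda>z. frechet_derivative f (at (y + r *\<^sub>R d)) (z *\<^sub>R d))) (at r)"
    by (rule has_derivative_compose[OF _ test_function_has_derivative[OF assms]])
       (auto intro!: derivative_eq_intros)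
  moreover have "linear (frechet_derivative f (at (y + r *\<^sub>R d)))"
    by (rule has_derivative_linear[OF test_function_has_derivative[OF assms]])
  ultimately show ?thesis
    by (simp add: has_field_derivative_def linear_scale mult.commute[of _ "frechet_derivative _ _ _"])
qed

text \<open>The double difference is an increment in v of an increment in w; the mean value theorem
  in each direction in turn yields a mixed derivative at a nearby point. The double difference is
  symmetric in v and w, which is what makes it useful.\<close>

lemma test_function_mixed_difference:
  fixes f :: "'a::euclidean_space \<Rightarrow> real"
  assumes f: "f \<in> test_functions" and h: "h > 0"
  obtains s t where "0 < s" "s < h" "0 < t" "t < h"
    "f (x + h *\<^sub>R v + h *\<^sub>R w) - f (x + h *\<^sub>R v) - f (x + h *\<^sub>R w) + f x =
     h\<^sup>2 * frechet_derivative (\<lambda>y. frechet_derivative f (at y) v) (at (x + s *\<^sub>R v + t *\<^sub>R w)) w"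
proof -
  define g where "g = (\<lambda>y. frechet_derivative f (at y) v)"
  have g: "g \<in> test_functions" unfolding g_def by (rule test_function_deriv[OF f])
  define p where "p = (\<lambda>r. f (x + h *\<^sub>R w + r *\<^sub>R v) - f (x + r *\<^sub>R v))"
  have "\<exists>z>0. z < h \<and> p h - p 0 = (h - 0) * (g (x + h *\<^sub>R w + z *\<^sub>R v) - g (x + z *\<^sub>R v))"
    unfolding p_def g_def by (rule MVT2[OF h]) (intro DERIV_diff test_function_line[OF f])
  then obtain s where s: "0 < s" "s < h" "p h - p 0 = h * (g (x + h *\<^sub>R w + s *\<^sub>R v) - g (x + s *\<^sub>R v))"
    by auto
  have "\<exists>z>0. z < h \<and> g (x + s *\<^sub>R v + h *\<^sub>R w) - g (x + s *\<^sub>R v + 0 *\<^sub>R w)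
      = (h - 0) * frechet_derivative g (at (x + s *\<^sub>R v + z *\<^sub>R w)) w"
    by (rule MVT2[OF h]) (intro test_function_line[OF g])
  then obtain t where t: "0 < t" "t < h" "g (x + s *\<^sub>R v + h *\<^sub>R w) - g (x + s *\<^sub>R v)
      = h * frechet_derivative g (at (x + s *\<^sub>R v + t *\<^sub>R w)) w"
    by auto
  have "p h - p 0 = h\<^sup>2 * frechet_derivative g (at (x + s *\<^sub>R v + t *\<^sub>R w)) w"
    using s(3) t(3) by (simp add: power2_eq_square add_ac)
  then show thesis
    using that[OF s(1,2) t(1,2)] by (simp add: p_def g_def algebra_simps)
qed

text \<open>Schwarz's theorem: the double difference quotient tends to either mixed derivative, as
  second derivatives of a test function are continuous. For mollifiers it makes the Hessian of a
  mollified spinor symmetric.\<close>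

lemma test_function_deriv_commute:
  fixes f :: "'a::euclidean_space \<Rightarrow> real"
  assumes f: "f \<in> test_functions"
  shows "frechet_derivative (\<lambda>y. frechet_derivative f (at y) v) (at x) w =
    frechet_derivative (\<lambda>y. frechet_derivative f (at y) w) (at x) v"
proof -
  have lim: "(\<lambda>n. (f (x + h n *\<^sub>R v + h n *\<^sub>R w) - f (x + h n *\<^sub>R v) - f (x + h n *\<^sub>R w) + f x) / (h n)\<^sup>2)
      \<longlonglongrightarrow> frechet_derivative (\<lambda>y. frechet_derivative f (at y) v) (at x) w"
    if h: "h \<longlonglongrightarrow> 0" "\<And>n. h n > 0" for h v w
  proof -
    let ?q = "\<lambda>y. frechet_derivative (\<lambda>y. frechet_derivative f (at y) v) (at y) w"
    have "\<exists>s t. 0 < s \<and> s < h n \<and> 0 < t \<and> t < h n \<and>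
      (f (x + h n *\<^sub>R v + h n *\<^sub>R w) - f (x + h n *\<^sub>R v) - f (x + h n *\<^sub>R w) + f x) / (h n)\<^sup>2
       = ?q (x + s *\<^sub>R v + t *\<^sub>R w)" for n
    proof (rule test_function_mixed_difference[OF f h(2)[of n], of x v w])
      fix s t assume "0 < s" "s < h n" "0 < t" "t < h n" and
        "f (x + h n *\<^sub>R v + h n *\<^sub>R w) - f (x + h n *\<^sub>R v) - f (x + h n *\<^sub>R w) + f x
          = (h n)\<^sup>2 * ?q (x + s *\<^sub>R v + t *\<^sub>R w)"
      then show ?thesis using h(2)[of n] by (intro exI[of _ s] exI[of _ t]) simp
    qed
    then obtain s t where st: "\<And>n. 0 < s n" "\<And>n. s n < h n" "\<And>n. 0 < t n" "\<And>n. t n < h n"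
      "\<And>n. (f (x + h n *\<^sub>R v + h n *\<^sub>R w) - f (x + h n *\<^sub>R v) - f (x + h n *\<^sub>R w) + f x) / (h n)\<^sup>2
       = ?q (x + s n *\<^sub>R v + t n *\<^sub>R w)" by metis
    have "s \<longlonglongrightarrow> 0" "t \<longlonglongrightarrow> 0"
      by (rule tendsto_sandwich[OF _ _ tendsto_const h(1)]; use st in \<open>auto intro!: always_eventually less_imp_le\<close>)+
    then have "(\<lambda>n. x + s n *\<^sub>R v + t n *\<^sub>R w) \<longlonglongrightarrow> x + 0 *\<^sub>R v + 0 *\<^sub>R w"
      by (intro tendsto_intros)
    moreover have "isCont ?q x"
      using test_function_continuous[OF test_function_deriv[OF test_function_deriv[OF f]]]
      by (simp add: continuous_on_eq_continuous_at)
    ultimately have "(\<lambda>n. ?q (x + s n *\<^sub>R v + t n *\<^sub>R w)) \<longlonglongrightarrow> ?q x"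
      using isCont_tendsto_compose by force
    then show ?thesis by (simp add: st(5))
  qed
  have h: "(\<lambda>n. inverse (real (Suc n))) \<longlonglongrightarrow> 0" "\<And>n. inverse (real (Suc n)) > 0"
    using LIMSEQ_inverse_real_of_nat by auto
  have c: "x + a *\<^sub>R w + a *\<^sub>R v = x + a *\<^sub>R v + a *\<^sub>R w" for a by (simp add: add_ac)
  have d: "p - q - r + z = p - r - q + z" for p q r z :: real by simp
  show ?thesis
    using LIMSEQ_unique[OF lim[OF h, of v w]] lim[OF h, of w v] unfolding c by (simp add: d[of _ "f (x + _ *\<^sub>R w)"])
qed

section \<open>Translation and mollification in \<open>L\<^sup>2\<close>\<close>

text \<open>A Borel version of \<open>L2_space\<close>. Borel functions remain measurable under
  composition with continuous maps and jointly as functions of x - y, as convolution and Fubini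
  require; elements of \<open>L2_space\<close> enter through representatives equal to them almost
  everywhere.\<close>

definition borel_L2 :: "('a::euclidean_space \<Rightarrow> 'b::euclidean_space) set" where
  "borel_L2 = {f. f \<in> borel_measurable borel \<and> integrable lborel (\<lambda>x. (norm (f x))\<^sup>2)}"

lemma borel_L2_measurable [measurable_dest]: "f \<in> borel_L2 \<Longrightarrow> f \<in> borel_measurable borel"
  and borel_L2_integrable: "f \<in> borel_L2 \<Longrightarrow> integrable lborel (\<lambda>x. (norm (f x))\<^sup>2)"
  by (auto simp: borel_L2_def)

lemma borel_L2_nn_finite: "f \<in> borel_L2 \<Longrightarrow> (\<integral>\<^sup>+x. ennreal ((norm (f x))\<^sup>2) \<partial>lborel) < \<infinity>"
  using borel_L2_integrable[of f] by (auto simp: integrable_iff_bounded)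

lemma borel_L2_I:
  assumes "f \<in> borel_measurable borel" "(\<integral>\<^sup>+x. ennreal ((norm (f x))\<^sup>2) \<partial>lborel) < \<infinity>"
  shows "f \<in> borel_L2"
  using assms by (auto simp: borel_L2_def integrable_iff_bounded)

lemma norm_add_sq_le: "(norm (x + y))\<^sup>2 \<le> 2 * (norm x)\<^sup>2 + 2 * (norm (y::'b::real_inner))\<^sup>2"
proof -
  have "(norm (x + y))\<^sup>2 + (norm (x - y))\<^sup>2 = 2 * (norm x)\<^sup>2 + 2 * (norm y)\<^sup>2"
    by (simp add: power2_norm_eq_inner inner_simps inner_commute)
  then show ?thesis by (smt (verit) zero_le_power2)
qed

lemma norm_diff_sq_le: "(norm (x - y))\<^sup>2 \<le> 2 * (norm x)\<^sup>2 + 2 * (norm (y::'b::real_inner))\<^sup>2"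
  using norm_add_sq_le[of x "- y"] by simp

lemma borel_L2_add:
  assumes f: "f \<in> borel_L2" and g: "g \<in> borel_L2" shows "(\<lambda>x. f x + g x) \<in> borel_L2"
proof -
  have [measurable]: "f \<in> borel_measurable borel" "g \<in> borel_measurable borel" using f g by auto
  have "integrable lborel (\<lambda>x. (norm (f x + g x))\<^sup>2)"
    by (rule Bochner_Integration.integrable_bound[of _ "\<lambda>x. 2 * (norm (f x))\<^sup>2 + 2 * (norm (g x))\<^sup>2"])
       (use norm_add_sq_le in \<open>auto intro!: integrable_add integrable_mult_right borel_L2_integrable f g\<close>)
  then show ?thesis by (simp add: borel_L2_def)
qed

lemma borel_L2_linear:
  assumes f: "f \<in> borel_L2" and T: "bounded_linear T" shows "(\<lambda>x. T (f x)) \<in> borel_L2"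
proof -
  obtain K where K: "\<And>x. norm (T x) \<le> norm x * K" using bounded_linear.bounded[OF T] by blast
  have [measurable]: "f \<in> borel_measurable borel" "T \<in> borel_measurable borel"
    using f borel_measurable_continuous_onI[OF linear_continuous_on[OF T]] by auto
  have "integrable lborel (\<lambda>x. (norm (T (f x)))\<^sup>2)"
  proof (rule Bochner_Integration.integrable_bound[of _ "\<lambda>x. K\<^sup>2 * (norm (f x))\<^sup>2"])
    have "(norm (T (f x)))\<^sup>2 \<le> K\<^sup>2 * (norm (f x))\<^sup>2" for x
      using power_mono[OF K norm_ge_zero, of "f x" 2] by (simp add: power_mult_distrib mult.commute)
    then show "AE x in lborel. norm ((norm (T (f x)))\<^sup>2) \<le> norm (K\<^sup>2 * (norm (f x))\<^sup>2)" by simp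
  qed (auto intro!: integrable_mult_right borel_L2_integrable f)
  then show ?thesis by (simp add: borel_L2_def)
qed

lemma borel_L2_diff:
  assumes "f \<in> borel_L2" "g \<in> borel_L2" shows "(\<lambda>x. f x - g x) \<in> borel_L2"
  using borel_L2_add[OF assms(1) borel_L2_linear[OF assms(2), of uminus]]
  by (simp add: bounded_linear_minus[OF bounded_linear_ident])

lemma zero_borel_L2: "(\<lambda>x. 0) \<in> borel_L2"
  by (simp add: borel_L2_def)

lemma borel_L2_sum:
  assumes "\<And>i. i \<in> I \<Longrightarrow> f i \<in> borel_L2" shows "(\<lambda>x. \<Sum>i\<in>I. f i x) \<in> borel_L2"
  using assms by (induction I rule: infinite_finite_induct) (auto intro: borel_L2_add simp: zero_borel_L2)

lemma borel_L2_prod_integrable: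
  assumes f: "f \<in> borel_L2" and g: "g \<in> borel_L2"
    and h: "h \<in> borel_measurable borel" and le: "\<And>x. norm (h x) \<le> C * (norm (f x) * norm (g x))"
  shows "integrable lborel (h :: 'a::euclidean_space \<Rightarrow> 'c::{banach, second_countable_topology})"
proof (rule Bochner_Integration.integrable_bound[of _ "\<lambda>x. \<bar>C\<bar> * ((norm (f x))\<^sup>2 + (norm (g x))\<^sup>2)"])
  show "integrable lborel (\<lambda>x. \<bar>C\<bar> * ((norm (f x))\<^sup>2 + (norm (g x))\<^sup>2))"
    by (intro integrable_mult_right Bochner_Integration.integrable_add borel_L2_integrable f g)
  have "norm (h x) \<le> \<bar>C\<bar> * ((norm (f x))\<^sup>2 + (norm (g x))\<^sup>2)" for x
  proof -
    have "norm (f x) * norm (g x) \<le> (norm (f x))\<^sup>2 + (norm (g x))\<^sup>2"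
      using sum_squares_bound[of "norm (f x)" "norm (g x)"]
        mult_nonneg_nonneg[OF norm_ge_zero norm_ge_zero, of "f x" "g x"] by linarith
    then have "\<bar>C\<bar> * (norm (f x) * norm (g x)) \<le> \<bar>C\<bar> * ((norm (f x))\<^sup>2 + (norm (g x))\<^sup>2)"
      by (intro mult_left_mono) auto
    moreover have "C * (norm (f x) * norm (g x)) \<le> \<bar>C\<bar> * (norm (f x) * norm (g x))"
      by (intro mult_right_mono) auto
    ultimately show ?thesis using le[of x] by linarith
  qed
  then show "AE x in lborel. norm (h x) \<le> norm (\<bar>C\<bar> * ((norm (f x))\<^sup>2 + (norm (g x))\<^sup>2))"
    by (simp add: abs_mult)
qed (use h in simp)

lemma test_function_L2: "f \<in> test_functions \<Longrightarrow> f \<in> borel_L2"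
proof -
  assume f: "f \<in> test_functions"
  have "(\<lambda>x. f x * f x) \<in> test_functions"
  proof (rule test_functionI)
    show "bounded {x. f x * f x \<noteq> 0}"
      by (rule bounded_subset[OF test_functionD(2)[OF f]]) auto
  qed (intro Ck_mult test_functionD(1) f)
  from test_function_integrable[OF this] show "f \<in> borel_L2"
    using test_function_borel[OF f] by (simp add: borel_L2_def power2_eq_square)
qed

section \<open>Invariance of Lebesgue measure, approximation and translation in L^2\<close>

lemma lborel_distr_shift: "distr lborel borel (\<lambda>x. x + a) = (lborel :: 'a::euclidean_space measure)"
  by (subst lborel_affine[of 1 a], auto simp: density_1 add.commute)

lemma lborel_distr_reflect: "distr lborel borel (\<lambda>x. a - x) = (lborel :: 'a::euclidean_space measure)"
  by (subst lborel_affine[of "-1" a], auto simp: density_1)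

lemma nn_integral_shift:
  assumes "f \<in> borel_measurable borel"
  shows "(\<integral>\<^sup>+x. f (x + a) \<partial>lborel) = (\<integral>\<^sup>+x. f x \<partial>(lborel :: 'a::euclidean_space measure))"
  by (subst (2) lborel_distr_shift[symmetric, of a]) (use assms in \<open>simp add: nn_integral_distr\<close>)

lemma integral_shift:
  fixes f :: "'a::euclidean_space \<Rightarrow> 'b::{banach, second_countable_topology}"
  assumes "f \<in> borel_measurable borel"
  shows "(\<integral>x. f (x + a) \<partial>lborel) = (\<integral>x. f x \<partial>lborel)"
  by (subst (2) lborel_distr_shift[symmetric, of a]) (use assms in \<open>simp add: integral_distr\<close>)

lemma integrable_shift:
  fixes f :: "'a::euclidean_space \<Rightarrow> 'b::{banach, second_countable_topology}"
  assumes "f \<in> borel_measurable borel"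
  shows "integrable lborel (\<lambda>x. f (x + a)) \<longleftrightarrow> integrable lborel f"
  by (subst (2) lborel_distr_shift[symmetric, of a]) (use assms in \<open>simp add: integrable_distr_eq\<close>)

lemma integral_reflect:
  fixes f :: "'a::euclidean_space \<Rightarrow> 'b::{banach, second_countable_topology}"
  assumes "f \<in> borel_measurable borel"
  shows "(\<integral>x. f (a - x) \<partial>lborel) = (\<integral>x. f x \<partial>lborel)"
  by (subst (2) lborel_distr_reflect[symmetric, of a]) (use assms in \<open>simp add: integral_distr\<close>)

lemma integrable_reflect:
  fixes f :: "'a::euclidean_space \<Rightarrow> 'b::{banach, second_countable_topology}"
  assumes "f \<in> borel_measurable borel"
  shows "integrable lborel (\<lambda>x. f (a - x)) \<longleftrightarrow> integrable lborel f"
  by (subst (2) lborel_distr_reflect[symmetric, of a]) (use assms in \<open>simp add: integrable_distr_eq\<close>)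

text \<open>For M > 0 this is the radial retraction onto the closed ball of radius M; writing it
  with \<open>max\<close> makes continuity visible without a case split.\<close>

definition radial_trunc :: "real \<Rightarrow> 'b::real_normed_vector \<Rightarrow> 'b" where
  "radial_trunc M v = (M / max M (norm v)) *\<^sub>R v"

definition ball_cutoff :: "real \<Rightarrow> 'a::real_normed_vector \<Rightarrow> real" where
  "ball_cutoff M x = max 0 (min 1 (M + 1 - norm x))"

lemma radial_trunc:
  fixes v :: "'b::real_normed_vector"
  assumes "M > 0"
  shows "norm (radial_trunc M v) \<le> M" "norm (radial_trunc M v) \<le> norm v"
    "norm v \<le> M \<Longrightarrow> radial_trunc M v = v" "continuous_on UNIV (radial_trunc M :: 'b \<Rightarrow> 'b)"
proof -
  have mx: "max M (norm v) > 0" "M / max M (norm v) \<le> 1" "M / max M (norm v) \<ge> 0" for v :: 'b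
    using assms by (auto simp: divide_le_eq_1 less_max_iff_disj)
  show "norm (radial_trunc M v) \<le> norm v"
    using mult_right_mono[OF mx(2) norm_ge_zero, of v v]
    unfolding radial_trunc_def norm_scaleR real_norm_def abs_of_nonneg[OF mx(3)] by simp
  have "norm (radial_trunc M v) = M * (norm v / max M (norm v))"
    using assms by (simp add: radial_trunc_def abs_of_pos)
  also have "\<dots> \<le> M * 1"
    using assms mx(1)[of v] by (intro mult_left_mono) (auto simp: divide_le_eq_1)
  finally show "norm (radial_trunc M v) \<le> M" by simp
  show "norm v \<le> M \<Longrightarrow> radial_trunc M v = v" using assms by (simp add: radial_trunc_def max_absorb1)
  show "continuous_on UNIV (radial_trunc M :: 'b \<Rightarrow> 'b)"
    unfolding radial_trunc_def[abs_def] using mx(1) by (intro continuous_intros) (metis less_irrefl)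
qed

lemma ball_cutoff:
  "0 \<le> ball_cutoff M x" "ball_cutoff M x \<le> 1" "norm x \<le> M \<Longrightarrow> ball_cutoff M x = 1"
  "M + 1 \<le> norm x \<Longrightarrow> ball_cutoff M x = 0" "continuous_on UNIV (ball_cutoff M)"
  by (auto simp: ball_cutoff_def[abs_def] intro!: continuous_intros)

lemma nn_integral_dominated_convergence_sq:
  fixes u :: "nat \<Rightarrow> 'a::euclidean_space \<Rightarrow> 'b::euclidean_space"
  assumes [measurable]: "\<And>i. u i \<in> borel_measurable borel" "w \<in> borel_measurable borel"
    and bound: "\<And>i x. (norm (u i x))\<^sup>2 \<le> w x"
    and w: "(\<integral>\<^sup>+x. ennreal (w x) \<partial>lborel) < \<infinity>"
    and lim: "AE x in lborel. (\<lambda>i. u i x) \<longlonglongrightarrow> 0"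
  shows "(\<lambda>i. \<integral>\<^sup>+x. ennreal ((norm (u i x))\<^sup>2) \<partial>lborel) \<longlonglongrightarrow> 0"
proof -
  have "(\<lambda>i. \<integral>\<^sup>+x. ennreal ((norm (u i x))\<^sup>2) \<partial>lborel) \<longlonglongrightarrow> (\<integral>\<^sup>+x. 0 \<partial>(lborel :: 'a measure))"
  proof (rule nn_integral_dominated_convergence[where w = "\<lambda>x. ennreal (w x)"])
    show "AE x in lborel. (\<lambda>i. ennreal ((norm (u i x))\<^sup>2)) \<longlonglongrightarrow> 0"
      using lim
    proof eventually_elim
      fix x assume "(\<lambda>i. u i x) \<longlonglongrightarrow> 0"
      then have "(\<lambda>i. (norm (u i x))\<^sup>2) \<longlonglongrightarrow> (norm (0::'b))\<^sup>2" by (intro tendsto_intros)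
      then show "(\<lambda>i. ennreal ((norm (u i x))\<^sup>2)) \<longlonglongrightarrow> 0"
        using tendsto_ennrealI by fastforce
    qed
  qed (use bound w in \<open>auto intro!: ennreal_leI\<close>)
  then show ?thesis by simp
qed

lemma nn_integral_cball_const_finite:
  "(\<integral>\<^sup>+x. ennreal (c * indicator (cball 0 r) x) \<partial>(lborel :: 'a::euclidean_space measure)) < \<infinity>"
proof -
  have "(\<integral>\<^sup>+x. ennreal (c * indicator (cball 0 r) x) \<partial>(lborel :: 'a measure)) =
      (\<integral>\<^sup>+x. ennreal c * indicator (cball 0 r) x \<partial>(lborel :: 'a measure))"
    by (intro nn_integral_cong) (auto simp: indicator_def)
  also have "\<dots> = ennreal c * emeasure lborel (cball (0::'a) r)"
    by (rule nn_integral_cmult_indicator) simp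
  also have "\<dots> < \<infinity>"
    using emeasure_lborel_cball_finite[of "0::'a" r] by (simp add: ennreal_mult_less_top)
  finally show ?thesis .
qed

lemma numeral_times_ennreal: "0 \<le> a \<Longrightarrow> numeral w * ennreal a = ennreal (numeral w * a)"
  by (simp add: ennreal_mult)

text \<open>\<open>measurable_on\<close> provides continuous functions converging almost everywhere, which are
  then truncated in domain and range.\<close>

lemma L2_continuous_approx:
  fixes f :: "'a::euclidean_space \<Rightarrow> 'b::euclidean_space"
  assumes f: "f \<in> borel_L2" and e: "e > 0"
  obtains g C R where "continuous_on UNIV g" "\<And>x. norm (g x) \<le> C" "\<And>x. R \<le> norm x \<Longrightarrow> g x = 0"
    "(\<integral>\<^sup>+x. ennreal ((norm (f x - g x))\<^sup>2) \<partial>lborel) < ennreal e"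
proof -
  have [measurable]: "f \<in> borel_measurable borel" using f by auto
  have cm [measurable]: "radial_trunc (real (Suc M)) \<in> borel_measurable (borel :: 'b measure)"
     "ball_cutoff (real M) \<in> borel_measurable (borel :: 'a measure)" for M
    by (auto intro!: borel_measurable_continuous_onI ball_cutoff radial_trunc)
  \<comment> \<open>The spatial cutoff will give the continuous approximants a common bounded
    support, the truncation of values a common bound, so that dominated convergence applies to them.
    As f must be cut in the same way, it is first replaced by \<open>F M\<close>.\<close>
  define F where "F M x = ball_cutoff (real (Suc M)) x *\<^sub>R radial_trunc (real (Suc M)) (f x)" for M x
  have "(\<lambda>M. \<integral>\<^sup>+x. ennreal ((norm (f x - F M x))\<^sup>2) \<partial>lborel) \<longlonglongrightarrow> 0"
  proof (rule nn_integral_dominated_convergence_sq[where w = "\<lambda>x. 4 * (norm (f x))\<^sup>2"])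
    show "(\<lambda>x. f x - F M x) \<in> borel_measurable borel" for M
      using cm(1)[of M] cm(2)[of "Suc M"] unfolding F_def
      by (intro borel_measurable_diff borel_measurable_scaleR measurable_compose[OF \<open>f \<in> borel_measurable borel\<close>]) auto
    show "(norm (f x - F M x))\<^sup>2 \<le> 4 * (norm (f x))\<^sup>2" for M x
    proof -
      have "norm (F M x) \<le> 1 * norm (f x)"
        unfolding F_def norm_scaleR
        by (intro mult_mono) (simp_all add: abs_of_nonneg ball_cutoff radial_trunc del: of_nat_Suc)
      then have "norm (f x - F M x) \<le> 2 * norm (f x)"
        using norm_triangle_ineq4[of "f x" "F M x"] by simp
      from power_mono[OF this norm_ge_zero, of 2] show ?thesis by (simp add: power_mult_distrib)
    qed
    have "integrable lborel (\<lambda>x. 4 * (norm (f x))\<^sup>2)"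
      by (intro integrable_mult_right borel_L2_integrable f)
    then show "(\<integral>\<^sup>+x. ennreal (4 * (norm (f x))\<^sup>2) \<partial>lborel) < \<infinity>"
      by (subst nn_integral_eq_integral) auto
    have "(\<lambda>M. f x - F M x) \<longlonglongrightarrow> 0" for x
    proof (rule tendsto_eventually)
      obtain N where N: "norm x \<le> real N" "norm (f x) \<le> real N"
        by (metis real_arch_simple max.bounded_iff)
      show "\<forall>\<^sub>F M in sequentially. f x - F M x = 0"
        using eventually_ge_at_top[of N]
      proof eventually_elim
        fix M assume "N \<le> M"
        then have "norm x \<le> real (Suc M)" "norm (f x) \<le> real (Suc M)" using N by linarith+
        then show "f x - F M x = 0" by (simp add: F_def ball_cutoff radial_trunc del: of_nat_Suc)
      qed
    qed
    then show "AE x in lborel. (\<lambda>M. f x - F M x) \<longlonglongrightarrow> 0" by simp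
  qed simp
  \<comment> \<open>Each of the two errors enters with a factor 2 from
    \<open>norm_add_sq_le\<close>, so e/8 twice yields e/2 < e.\<close>
  then have "\<forall>\<^sub>F M in sequentially. (\<integral>\<^sup>+x. ennreal ((norm (f x - F M x))\<^sup>2) \<partial>lborel) < ennreal (e / 8)"
    using e by (intro order_tendstoD) auto
  then obtain M where M: "(\<integral>\<^sup>+x. ennreal ((norm (f x - F M x))\<^sup>2) \<partial>lborel) < ennreal (e / 8)"
    by (auto simp: eventually_sequentially)
  have "f \<in> borel_measurable (lebesgue_on UNIV)"
    unfolding lebesgue_on_UNIV_eq by (rule measurable_completion) simp
  then have "f measurable_on UNIV"
    by (subst measurable_on_iff_borel_measurable) auto
  then obtain N h where N: "negligible N" and h: "\<And>n. continuous_on UNIV (h n)"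
      "\<And>x. x \<notin> N \<Longrightarrow> (\<lambda>n. h n x) \<longlonglongrightarrow> f x"
    by (auto simp: measurable_on_def)
  define G where "G n x = ball_cutoff (real (Suc M)) x *\<^sub>R radial_trunc (real (Suc M)) (h n x)" for n x
  have Gc: "continuous_on UNIV (G n)" for n
    unfolding G_def
    by (intro continuous_intros ball_cutoff continuous_on_compose2[OF radial_trunc(4) h(1)]) auto
  have bd: "norm (ball_cutoff (real (Suc M)) x *\<^sub>R radial_trunc (real (Suc M)) v) \<le> real (Suc M)"
    for x :: 'a and v :: 'b
  proof -
    have "norm (ball_cutoff (real (Suc M)) x *\<^sub>R radial_trunc (real (Suc M)) v) \<le> 1 * real (Suc M)"
      unfolding norm_scaleR
      by (intro mult_mono) (simp_all add: abs_of_nonneg ball_cutoff radial_trunc del: of_nat_Suc)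
    then show ?thesis by simp
  qed
  have "(\<lambda>n. \<integral>\<^sup>+x. ennreal ((norm (F M x - G n x))\<^sup>2) \<partial>lborel) \<longlonglongrightarrow> 0"
  proof (rule nn_integral_dominated_convergence_sq[where w = "\<lambda>x. (2 * real (Suc M))\<^sup>2 * indicator (cball 0 (real (Suc M) + 1)) x"])
    show "(\<lambda>x. F M x - G n x) \<in> borel_measurable borel" for n
      using borel_measurable_continuous_onI[OF Gc[of n]] cm(1)[of M] cm(2)[of "Suc M"]
      unfolding F_def by (auto intro!: borel_measurable_diff)
    show "(norm (F M x - G n x))\<^sup>2 \<le> (2 * real (Suc M))\<^sup>2 * indicator (cball 0 (real (Suc M) + 1)) x" for n x
    proof (cases "norm x \<le> real (Suc M) + 1")
      case True
      have "norm (F M x - G n x) \<le> 2 * real (Suc M)"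
        unfolding F_def G_def mult_2 by (rule order_trans[OF norm_triangle_ineq4 add_mono[OF bd bd]])
      from power_mono[OF this norm_ge_zero, of 2] True show ?thesis by (simp del: of_nat_Suc)
    next
      case False
      then show ?thesis by (simp add: F_def G_def ball_cutoff del: of_nat_Suc)
    qed
    show "(\<integral>\<^sup>+x. ennreal ((2 * real (Suc M))\<^sup>2 * indicator (cball 0 (real (Suc M) + 1)) x) \<partial>(lborel :: 'a measure)) < \<infinity>"
      by (rule nn_integral_cball_const_finite)
    have "AE x in lebesgue. x \<notin> N"
      using N by (intro AE_not_in) (simp add: negligible_iff_null_sets)
    then have "AE x in lborel. x \<notin> N" by (simp add: AE_completion_iff)
    then show "AE x in lborel. (\<lambda>n. F M x - G n x) \<longlonglongrightarrow> 0"
    proof eventually_elim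
      fix x assume "x \<notin> N"
      then have "(\<lambda>n. radial_trunc (real (Suc M)) (h n x)) \<longlonglongrightarrow> radial_trunc (real (Suc M)) (f x)"
        by (intro continuous_on_tendsto_compose[OF radial_trunc(4) h(2)]) auto
      then have "(\<lambda>n. F M x - G n x) \<longlonglongrightarrow> F M x - F M x"
        unfolding F_def G_def by (intro tendsto_intros)
      then show "(\<lambda>n. F M x - G n x) \<longlonglongrightarrow> 0" by simp
    qed
  qed (auto intro!: borel_measurable_times borel_measurable_indicator)
  then have "\<forall>\<^sub>F n in sequentially. (\<integral>\<^sup>+x. ennreal ((norm (F M x - G n x))\<^sup>2) \<partial>lborel) < ennreal (e / 8)"
    using e by (intro order_tendstoD) auto
  then obtain n where n: "(\<integral>\<^sup>+x. ennreal ((norm (F M x - G n x))\<^sup>2) \<partial>lborel) < ennreal (e / 8)"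
    by (auto simp: eventually_sequentially)
  have [measurable]: "F M \<in> borel_measurable borel" "G n \<in> borel_measurable borel"
    using borel_measurable_continuous_onI[OF Gc[of n]] cm(1)[of M] cm(2)[of "Suc M"]
    unfolding F_def by (auto intro!: borel_measurable_scaleR)
  have "(\<integral>\<^sup>+x. ennreal ((norm (f x - G n x))\<^sup>2) \<partial>lborel) \<le>
    (\<integral>\<^sup>+x. 2 * ennreal ((norm (f x - F M x))\<^sup>2) + 2 * ennreal ((norm (F M x - G n x))\<^sup>2) \<partial>lborel)"
  proof (rule nn_integral_mono)
    fix x
    have "(norm (f x - G n x))\<^sup>2 \<le> 2 * (norm (f x - F M x))\<^sup>2 + 2 * (norm (F M x - G n x))\<^sup>2"
      using norm_add_sq_le[of "f x - F M x" "F M x - G n x"] by simp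
    from ennreal_leI[OF this]
    show "ennreal ((norm (f x - G n x))\<^sup>2) \<le> 2 * ennreal ((norm (f x - F M x))\<^sup>2) + 2 * ennreal ((norm (F M x - G n x))\<^sup>2)"
      by (simp add: ennreal_plus ennreal_mult)
  qed
  also have "\<dots> = 2 * (\<integral>\<^sup>+x. ennreal ((norm (f x - F M x))\<^sup>2) \<partial>lborel) + 2 * (\<integral>\<^sup>+x. ennreal ((norm (F M x - G n x))\<^sup>2) \<partial>lborel)"
    by (simp add: nn_integral_add nn_integral_cmult)
  also have "\<dots> \<le> 2 * ennreal (e / 8) + 2 * ennreal (e / 8)"
    using M n by (intro add_mono mult_left_mono) auto
  also have "\<dots> = ennreal (2 * (e / 8) + 2 * (e / 8))"
    using e by (simp add: numeral_times_ennreal flip: ennreal_plus)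
  also have "\<dots> < ennreal e" using e by (intro ennreal_lessI) auto
  finally have "(\<integral>\<^sup>+x. ennreal ((norm (f x - G n x))\<^sup>2) \<partial>lborel) < ennreal e" .
  moreover have "norm (G n x) \<le> real (Suc M)" for x unfolding G_def by (rule bd)
  moreover have "real (Suc M) + 1 \<le> norm x \<Longrightarrow> G n x = 0" for x
    by (simp add: G_def ball_cutoff del: of_nat_Suc)
  ultimately show thesis using that[OF Gc] by blast
qed


text \<open>For a continuous g of bounded support dominated convergence applies. The errors f - g
  taken at x and at x - \<open>y n\<close> have the same L^2 norm by translation invariance, so one
  good approximation serves all shifts.\<close>

lemma L2_translation_continuous:
  fixes f :: "'a::euclidean_space \<Rightarrow> 'b::euclidean_space"
  assumes f: "f \<in> borel_L2" and y: "y \<longlonglongrightarrow> 0"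
  shows "(\<lambda>n. \<integral>\<^sup>+x. ennreal ((norm (f (x - y n) - f x))\<^sup>2) \<partial>lborel) \<longlonglongrightarrow> 0"
proof (rule order_tendstoI)
  fix e :: ennreal assume "0 < e"
  \<comment> \<open>As e may be infinite, a real d below it is fixed. The share d/16 enters with
    weights 2, 4 and 4, in total 10 d/16 < d.\<close>
  then obtain d where d: "d > 0" "ennreal d \<le> e"
    by (cases e) (auto intro: that[of 1] that)
  obtain g C R where g: "continuous_on UNIV g" "\<And>x. norm (g x) \<le> C" "\<And>x. R \<le> norm x \<Longrightarrow> g x = 0"
    "(\<integral>\<^sup>+x. ennreal ((norm (f x - g x))\<^sup>2) \<partial>lborel) < ennreal (d / 16)"
    using L2_continuous_approx[OF f, of "d / 16"] d by auto
  have [measurable]: "f \<in> borel_measurable borel" "g \<in> borel_measurable borel"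
    using f borel_measurable_continuous_onI[OF g(1)] by auto
  \<comment> \<open>A common bound on the shifts puts the supports of all translates of g into one
    ball, where the majorant lives.\<close>
  obtain B where B: "\<And>n. norm (y n) \<le> B"
    using convergent_imp_Bseq[OF convergentI[OF y]] by (auto simp: Bseq_def)
  have "(\<lambda>n. \<integral>\<^sup>+x. ennreal ((norm (g (x - y n) - g x))\<^sup>2) \<partial>lborel) \<longlonglongrightarrow> 0"
  proof (rule nn_integral_dominated_convergence_sq[where w = "\<lambda>x. (2 * C)\<^sup>2 * indicator (cball 0 (R + B)) x"])
    show "(norm (g (x - y n) - g x))\<^sup>2 \<le> (2 * C)\<^sup>2 * indicator (cball 0 (R + B)) x" for n x
    proof (cases "norm x \<le> R + B")
      case True
      have "norm (g (x - y n) - g x) \<le> 2 * C"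
        using norm_triangle_ineq4[of "g (x - y n)" "g x"] g(2)[of x] g(2)[of "x - y n"] by linarith
      from power_mono[OF this norm_ge_zero, of 2] True show ?thesis by simp
    next
      case False
      then have "R \<le> norm x" "R \<le> norm (x - y n)"
        using B[of n] norm_triangle_ineq2[of x "y n"] norm_ge_zero[of "y n"] by linarith+
      with False show ?thesis by (simp add: g(3))
    qed
    show "(\<integral>\<^sup>+x. ennreal ((2 * C)\<^sup>2 * indicator (cball 0 (R + B)) x) \<partial>(lborel :: 'a measure)) < \<infinity>"
      by (rule nn_integral_cball_const_finite)
    have "(\<lambda>n. g (x - y n) - g x) \<longlonglongrightarrow> 0" for x
    proof -
      have "(\<lambda>n. g (x - y n)) \<longlonglongrightarrow> g (x - 0)"
        by (intro continuous_on_tendsto_compose[OF g(1)] tendsto_intros y) auto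
      from tendsto_diff[OF this tendsto_const[of "g x"]] show ?thesis by simp
    qed
    then show "AE x in lborel. (\<lambda>n. g (x - y n) - g x) \<longlonglongrightarrow> 0" by simp
  qed (auto intro!: borel_measurable_times borel_measurable_indicator)
  then have "\<forall>\<^sub>F n in sequentially. (\<integral>\<^sup>+x. ennreal ((norm (g (x - y n) - g x))\<^sup>2) \<partial>lborel) < ennreal (d / 16)"
    using d by (intro order_tendstoD) auto
  then show "\<forall>\<^sub>F n in sequentially. (\<integral>\<^sup>+x. ennreal ((norm (f (x - y n) - f x))\<^sup>2) \<partial>lborel) < e"
  proof eventually_elim
    fix n assume n: "(\<integral>\<^sup>+x. ennreal ((norm (g (x - y n) - g x))\<^sup>2) \<partial>lborel) < ennreal (d / 16)"
    let ?I = "\<integral>\<^sup>+x. ennreal ((norm (f x - g x))\<^sup>2) \<partial>lborel"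
    have shift: "(\<integral>\<^sup>+x. ennreal ((norm (f (x - y n) - g (x - y n)))\<^sup>2) \<partial>lborel) = ?I"
      using nn_integral_shift[of "\<lambda>x. ennreal ((norm (f x - g x))\<^sup>2)" "- y n"] by simp
    have "(\<integral>\<^sup>+x. ennreal ((norm (f (x - y n) - f x))\<^sup>2) \<partial>lborel) \<le>
      (\<integral>\<^sup>+x. 2 * ennreal ((norm (g (x - y n) - g x))\<^sup>2) +
        (4 * ennreal ((norm (f (x - y n) - g (x - y n)))\<^sup>2) + 4 * ennreal ((norm (f x - g x))\<^sup>2)) \<partial>lborel)"
    proof (rule nn_integral_mono)
      fix x
      have "(norm (f (x - y n) - f x))\<^sup>2 \<le> 2 * (norm (g (x - y n) - g x))\<^sup>2 +
        (4 * (norm (f (x - y n) - g (x - y n)))\<^sup>2 + 4 * (norm (f x - g x))\<^sup>2)"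
      proof -
        have "f (x - y n) - f x = (g (x - y n) - g x) + ((f (x - y n) - g (x - y n)) - (f x - g x))"
          by simp
        then have "(norm (f (x - y n) - f x))\<^sup>2 \<le> 2 * (norm (g (x - y n) - g x))\<^sup>2 +
            2 * (norm ((f (x - y n) - g (x - y n)) - (f x - g x)))\<^sup>2"
          by (metis norm_add_sq_le)
        then show ?thesis
          using norm_diff_sq_le[of "f (x - y n) - g (x - y n)" "f x - g x"] by linarith
      qed
      from ennreal_leI[OF this]
      show "ennreal ((norm (f (x - y n) - f x))\<^sup>2) \<le> 2 * ennreal ((norm (g (x - y n) - g x))\<^sup>2) +
        (4 * ennreal ((norm (f (x - y n) - g (x - y n)))\<^sup>2) + 4 * ennreal ((norm (f x - g x))\<^sup>2))"
        by (simp add: ennreal_plus ennreal_mult)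
    qed
    also have "\<dots> = 2 * (\<integral>\<^sup>+x. ennreal ((norm (g (x - y n) - g x))\<^sup>2) \<partial>lborel) + (4 * ?I + 4 * ?I)"
      unfolding shift[symmetric] by (simp add: nn_integral_add nn_integral_cmult shift)
    also have "\<dots> \<le> 2 * ennreal (d / 16) + (4 * ennreal (d / 16) + 4 * ennreal (d / 16))"
      using n g(4) by (intro add_mono mult_left_mono) auto
    also have "\<dots> = ennreal (2 * (d / 16) + (4 * (d / 16) + 4 * (d / 16)))"
      using d by (simp add: numeral_times_ennreal flip: ennreal_plus)
    also have "\<dots> < ennreal d" using d by (intro ennreal_lessI) auto
    finally show "(\<integral>\<^sup>+x. ennreal ((norm (f (x - y n) - f x))\<^sup>2) \<partial>lborel) < e" using d(2) by simp
  qed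
qed simp

section \<open>Convolution with test functions\<close>

definition mollify :: "('a::euclidean_space \<Rightarrow> real) \<Rightarrow> ('a \<Rightarrow> 'b::euclidean_space) \<Rightarrow> 'a \<Rightarrow> 'b" where
  "mollify K f x = (\<integral>y. K (x - y) *\<^sub>R f y \<partial>lborel)"

lemma test_function_reflect: "K \<in> test_functions \<Longrightarrow> (\<lambda>y. K (x - y)) \<in> test_functions"
  for K :: "'a::euclidean_space \<Rightarrow> real"
  using test_function_affine[of K "-1" x] by simp

lemma mollify_integrable:
  assumes "K \<in> test_functions" "f \<in> borel_L2"
  shows "integrable lborel (\<lambda>y. K (x - y) *\<^sub>R f y)"
  by (rule borel_L2_prod_integrable[OF test_function_L2[OF test_function_reflect[OF assms(1), of x]] assms(2), where C = 1])
     (use test_function_borel[OF test_function_reflect[OF assms(1), of x]] assms(2) in auto)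

lemma mollify_swap:
  assumes "K \<in> test_functions" "f \<in> borel_L2"
  shows "mollify K f x = (\<integral>y. K y *\<^sub>R f (x - y) \<partial>lborel)"
    and "integrable lborel (\<lambda>y. K y *\<^sub>R f (x - y))"
proof -
  have [measurable]: "K \<in> borel_measurable borel" "f \<in> borel_measurable borel"
    using assms test_function_borel by auto
  show "mollify K f x = (\<integral>y. K y *\<^sub>R f (x - y) \<partial>lborel)"
    unfolding mollify_def using integral_reflect[of "\<lambda>y. K (x - y) *\<^sub>R f y" x] by simp
  show "integrable lborel (\<lambda>y. K y *\<^sub>R f (x - y))"
    using integrable_reflect[of "\<lambda>y. K (x - y) *\<^sub>R f y" x] mollify_integrable[OF assms] by simp
qed

lemma mollify_borel_measurable:
  assumes "K \<in> test_functions" "f \<in> borel_L2"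
  shows "mollify K f \<in> borel_measurable borel"
proof -
  have [measurable]: "K \<in> borel_measurable borel" "f \<in> borel_measurable borel"
    using assms test_function_borel by auto
  show ?thesis unfolding mollify_def[abs_def]
    by (rule lborel.borel_measurable_lebesgue_integral) measurable
qed

text \<open>Cauchy-Schwarz with respect to the weight \<open>\<bar>K\<bar>\<close>, followed by Tonelli.\<close>

lemma L2_average_bound:
  fixes K :: "'a::euclidean_space \<Rightarrow> real" and G :: "'a \<Rightarrow> 'a \<Rightarrow> 'b::euclidean_space"
  assumes [measurable]: "K \<in> borel_measurable borel" "case_prod G \<in> borel_measurable (borel \<Otimes>\<^sub>M borel)"
    and bd: "\<And>y. K y \<noteq> 0 \<Longrightarrow> (\<integral>\<^sup>+x. ennreal ((norm (G x y))\<^sup>2) \<partial>lborel) \<le> B"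
  shows "(\<integral>\<^sup>+x. ennreal ((norm (\<integral>y. K y *\<^sub>R G x y \<partial>lborel))\<^sup>2) \<partial>lborel) \<le>
    (\<integral>\<^sup>+y. ennreal \<bar>K y\<bar> \<partial>lborel) * ((\<integral>\<^sup>+y. ennreal \<bar>K y\<bar> \<partial>lborel) * B)"
proof -
  let ?k = "\<integral>\<^sup>+y. ennreal \<bar>K y\<bar> \<partial>lborel"
  have "ennreal ((norm (\<integral>y. K y *\<^sub>R G x y \<partial>lborel))\<^sup>2) \<le>
    ?k * (\<integral>\<^sup>+y. ennreal \<bar>K y\<bar> * ennreal ((norm (G x y))\<^sup>2) \<partial>lborel)" for x
  \<comment> \<open>If the vector-valued integrand is not integrable, its integral is 0 by
    convention and the bound is trivial.\<close>
  proof (cases "integrable lborel (\<lambda>y. K y *\<^sub>R G x y)")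
    case True
    have [measurable]: "G x \<in> borel_measurable borel"
      using measurable_compose[OF measurable_Pair1' assms(2), of x] by simp
    have "ennreal (norm (\<integral>y. K y *\<^sub>R G x y \<partial>lborel)) \<le> (\<integral>\<^sup>+y. ennreal (norm (K y *\<^sub>R G x y)) \<partial>lborel)"
      by (rule integral_norm_bound_ennreal[OF True])
    also have "\<dots> = (\<integral>\<^sup>+y. ennreal (sqrt \<bar>K y\<bar>) * ennreal (sqrt \<bar>K y\<bar> * norm (G x y)) \<partial>lborel)"
      by (rule nn_integral_cong) (simp add: ennreal_mult[symmetric] mult.assoc[symmetric])
    finally have "ennreal ((norm (\<integral>y. K y *\<^sub>R G x y \<partial>lborel))\<^sup>2) \<le> \<dots>\<^sup>2"
      by (simp add: power_mono flip: ennreal_power)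
    also have "\<dots> \<le> (\<integral>\<^sup>+y. (ennreal (sqrt \<bar>K y\<bar>))\<^sup>2 \<partial>lborel) * (\<integral>\<^sup>+y. (ennreal (sqrt \<bar>K y\<bar> * norm (G x y)))\<^sup>2 \<partial>lborel)"
      by (rule Cauchy_Schwarz_nn_integral) auto
    also have "\<dots> = ?k * (\<integral>\<^sup>+y. ennreal \<bar>K y\<bar> * ennreal ((norm (G x y))\<^sup>2) \<partial>lborel)"
      by (simp add: ennreal_power power_mult_distrib ennreal_mult)
    finally show ?thesis .
  qed (simp add: not_integrable_integral_eq)
  then have "(\<integral>\<^sup>+x. ennreal ((norm (\<integral>y. K y *\<^sub>R G x y \<partial>lborel))\<^sup>2) \<partial>lborel) \<le>
    (\<integral>\<^sup>+x. ?k * (\<integral>\<^sup>+y. ennreal \<bar>K y\<bar> * ennreal ((norm (G x y))\<^sup>2) \<partial>lborel) \<partial>lborel)"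
    by (rule nn_integral_mono)
  also have "\<dots> = ?k * (\<integral>\<^sup>+x. (\<integral>\<^sup>+y. ennreal \<bar>K y\<bar> * ennreal ((norm (G x y))\<^sup>2) \<partial>lborel) \<partial>lborel)"
    by (rule nn_integral_cmult) measurable
  also have "(\<integral>\<^sup>+x. (\<integral>\<^sup>+y. ennreal \<bar>K y\<bar> * ennreal ((norm (G x y))\<^sup>2) \<partial>lborel) \<partial>lborel)
    = (\<integral>\<^sup>+y. (\<integral>\<^sup>+x. ennreal \<bar>K y\<bar> * ennreal ((norm (G x y))\<^sup>2) \<partial>lborel) \<partial>lborel)"
    by (rule lborel_pair.Fubini'[symmetric]) measurable
  also have "\<dots> = (\<integral>\<^sup>+y. ennreal \<bar>K y\<bar> * (\<integral>\<^sup>+x. ennreal ((norm (G x y))\<^sup>2) \<partial>lborel) \<partial>lborel)"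
    by (intro nn_integral_cong nn_integral_cmult) measurable
  also have "\<dots> \<le> (\<integral>\<^sup>+y. ennreal \<bar>K y\<bar> * B \<partial>lborel)"
  proof (rule nn_integral_mono)
    show "ennreal \<bar>K y\<bar> * (\<integral>\<^sup>+x. ennreal ((norm (G x y))\<^sup>2) \<partial>lborel) \<le> ennreal \<bar>K y\<bar> * B" for y
      by (cases "K y = 0") (auto intro: mult_left_mono bd)
  qed
  also have "\<dots> = ?k * B" by (rule nn_integral_multc) measurable
  finally show ?thesis by (simp add: mult_left_mono)
qed

lemma nn_integral_reflect_sq:
  assumes "f \<in> borel_L2"
  shows "(\<integral>\<^sup>+x. ennreal ((norm (f (x - y)))\<^sup>2) \<partial>lborel) = (\<integral>\<^sup>+x. ennreal ((norm (f x))\<^sup>2) \<partial>lborel)"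
  using nn_integral_shift[of "\<lambda>x. ennreal ((norm (f x))\<^sup>2)" "- y"] assms by simp

lemma mollify_L2:
  assumes K: "K \<in> test_functions" and f: "f \<in> borel_L2"
  shows "mollify K f \<in> borel_L2"
proof (rule borel_L2_I)
  have [measurable]: "K \<in> borel_measurable borel" "f \<in> borel_measurable borel"
    using K f test_function_borel by auto
  have "(\<integral>\<^sup>+x. ennreal ((norm (\<integral>y. K y *\<^sub>R f (x - y) \<partial>lborel))\<^sup>2) \<partial>lborel) \<le>
    (\<integral>\<^sup>+y. ennreal \<bar>K y\<bar> \<partial>lborel) * ((\<integral>\<^sup>+y. ennreal \<bar>K y\<bar> \<partial>lborel) * (\<integral>\<^sup>+x. ennreal ((norm (f x))\<^sup>2) \<partial>lborel))"
    by (rule L2_average_bound) (measurable, simp add: nn_integral_reflect_sq[OF f])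
  also have "\<dots> < \<infinity>"
    using test_function_integrable[OF K] borel_L2_nn_finite[OF f]
    by (auto simp: integrable_iff_bounded ennreal_mult_less_top)
  finally show "(\<integral>\<^sup>+x. ennreal ((norm (mollify K f x))\<^sup>2) \<partial>lborel) < \<infinity>"
    unfolding mollify_swap(1)[OF K f] .
qed (rule mollify_borel_measurable[OF K f])

text \<open>The kernel has mass 1, so \<open>mollify (mollifier n) f x - f x\<close> averages the
  differences f(x - y) - f(x) over its small support; \<open>L2_average_bound\<close> reduces the
  claim to continuity of translations.\<close>

lemma mollifier_L2_converges:
  fixes f :: "'a::euclidean_space \<Rightarrow> 'b::euclidean_space"
  assumes f: "f \<in> borel_L2"
  shows "(\<lambda>n. \<integral>\<^sup>+x. ennreal ((norm (mollify (mollifier n) f x - f x))\<^sup>2) \<partial>lborel) \<longlonglongrightarrow> 0"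
proof -
  define T where "T y = (\<integral>\<^sup>+x. ennreal ((norm (f (x - y) - f x))\<^sup>2) \<partial>lborel)" for y
  have T: "(T \<longlongrightarrow> 0) (at 0)"
    unfolding tendsto_at_iff_sequentially T_def comp_def
    using L2_translation_continuous[OF f] by auto
  have [measurable]: "f \<in> borel_measurable borel" "mollifier n \<in> borel_measurable (borel :: 'a measure)" for n
    using f test_function_borel[OF mollifier_test] by auto
  have le: "(\<integral>\<^sup>+x. ennreal ((norm (mollify (mollifier n) f x - f x))\<^sup>2) \<partial>lborel) \<le> B"
    if B: "\<And>y. norm y \<le> DIM('a) / Suc n \<Longrightarrow> T y \<le> B" for n B
  proof -
    have i: "integrable lborel (mollifier n :: 'a \<Rightarrow> real)"
      by (rule test_function_integrable[OF mollifier_test])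
    have "mollify (mollifier n) f x - f x = (\<integral>y. mollifier n y *\<^sub>R (f (x - y) - f x) \<partial>lborel)" for x
      using mollify_swap[OF mollifier_test f, of n x] i
      by (simp add: scaleR_diff_right mollifier_integral)
    moreover have "(\<integral>\<^sup>+y. ennreal \<bar>mollifier n y\<bar> \<partial>(lborel :: 'a measure)) = 1"
      using nn_integral_eq_integral[OF i] by (simp add: mollifier_nonneg mollifier_integral abs_of_nonneg)
    moreover have "(\<integral>\<^sup>+x. ennreal ((norm (\<integral>y. mollifier n y *\<^sub>R (f (x - y) - f x) \<partial>lborel))\<^sup>2) \<partial>lborel) \<le>
      (\<integral>\<^sup>+y. ennreal \<bar>mollifier n y\<bar> \<partial>(lborel :: 'a measure)) * ((\<integral>\<^sup>+y. ennreal \<bar>mollifier n y\<bar> \<partial>(lborel :: 'a measure)) * B)"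
      by (rule L2_average_bound) (measurable, use B mollifier_support in \<open>force simp: T_def\<close>)
    ultimately show ?thesis by simp
  qed
  show ?thesis
  proof (rule order_tendstoI)
    fix e :: ennreal assume "0 < e"
    then obtain e' where e': "0 < e'" "e' < e" using dense by blast
    have "\<forall>\<^sub>F y in at 0. T y < e'" using T e'(1) by (rule order_tendstoD)
    then obtain d where d: "d > 0" "\<And>y. y \<noteq> 0 \<Longrightarrow> norm y < d \<Longrightarrow> T y < e'"
      by (auto simp: eventually_at)
    \<comment> \<open>The limit at 0 says nothing about y = 0 itself, which lies in the support of
      every mollifier.\<close>
    have T0: "T 0 = 0" by (simp add: T_def)
    have "(\<lambda>n. DIM('a) / Suc n) \<longlonglongrightarrow> 0"
      using tendsto_mult[OF tendsto_const[of "real DIM('a)"] LIMSEQ_inverse_real_of_nat]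
      by (simp add: divide_inverse)
    then have "\<forall>\<^sub>F n in sequentially. DIM('a) / Suc n < d" using d(1) by (rule order_tendstoD)
    then show "\<forall>\<^sub>F n in sequentially. (\<integral>\<^sup>+x. ennreal ((norm (mollify (mollifier n) f x - f x))\<^sup>2) \<partial>lborel) < e"
    proof eventually_elim
      fix n assume n: "DIM('a) / Suc n < d"
      have "T y \<le> e'" if "norm y \<le> DIM('a) / Suc n" for y
        using d(2)[of y] n that T0 by (cases "y = 0") (auto intro: less_imp_le)
      from le[of n e', OF this] e'(2)
      show "(\<integral>\<^sup>+x. ennreal ((norm (mollify (mollifier n) f x - f x))\<^sup>2) \<partial>lborel) < e" by simp
    qed
  qed simp
qed

section \<open>Directional and weak derivatives\<close>

text \<open>Integration by parts only ever differentiates along one fixed direction. Restricted to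
  lines, a derivative can be read off from difference quotients under the integral sign.\<close>

definition has_dir_deriv :: "'a::euclidean_space \<Rightarrow> ('a \<Rightarrow> 'b::real_normed_vector) \<Rightarrow> ('a \<Rightarrow> 'b) \<Rightarrow> bool" where
  "has_dir_deriv e f f' \<longleftrightarrow> (\<forall>x. ((\<lambda>t. f (x + t *\<^sub>R e)) has_vector_derivative f' x) (at 0))"

lemma has_dir_deriv_line:
  assumes "has_dir_deriv e f f'"
  shows "((\<lambda>t. f (x + t *\<^sub>R e)) has_vector_derivative f' (x + s *\<^sub>R e)) (at s)"
proof -
  have "((\<lambda>t. f ((x + s *\<^sub>R e) + t *\<^sub>R e)) has_vector_derivative f' (x + s *\<^sub>R e)) (at (s - s))"
    using assms by (simp add: has_dir_deriv_def)
  then have "((\<lambda>t. f ((x + s *\<^sub>R e) + t *\<^sub>R e)) \<circ> (\<lambda>t. t - s) has_vector_derivative 1 *\<^sub>R f' (x + s *\<^sub>R e)) (at s)"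
    by (intro vector_diff_chain_at) (auto intro!: derivative_eq_intros)
  then show ?thesis by (simp add: comp_def algebra_simps)
qed

lemma has_dir_deriv_bilinear:
  assumes "bounded_bilinear B" "has_dir_deriv e f f'" "has_dir_deriv e g g'"
  shows "has_dir_deriv e (\<lambda>x. B (f x) (g x)) (\<lambda>x. B (f x) (g' x) + B (f' x) (g x))"
  unfolding has_dir_deriv_def
proof
  fix x
  show "((\<lambda>t. B (f (x + t *\<^sub>R e)) (g (x + t *\<^sub>R e))) has_vector_derivative B (f x) (g' x) + B (f' x) (g x)) (at 0)"
    using bounded_bilinear.has_vector_derivative[OF assms(1), of "\<lambda>t. f (x + t *\<^sub>R e)" "f' x" 0 UNIV
        "\<lambda>t. g (x + t *\<^sub>R e)" "g' x"] assms(2,3)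
    by (simp add: has_dir_deriv_def)
qed

lemma has_dir_derivI:
  assumes "\<And>x. (f has_derivative F x) (at x)"
  shows "has_dir_deriv e f (\<lambda>x. F x e)"
  unfolding has_dir_deriv_def has_vector_derivative_def
proof
  fix x
  have "((\<lambda>t. f (x + t *\<^sub>R e)) has_derivative (\<lambda>t. F x (t *\<^sub>R e))) (at 0)"
    by (rule has_derivative_compose[of _ "\<lambda>t. t *\<^sub>R e" 0 UNIV f "F x"])
       (use assms in \<open>auto intro!: derivative_eq_intros\<close>)
  moreover have "linear (F x)" using assms has_derivative_linear by blast
  ultimately show "((\<lambda>t. f (x + t *\<^sub>R e)) has_derivative (\<lambda>t. t *\<^sub>R F x e)) (at 0)"
    by (simp add: linear_scale)
qed

text \<open>Limits of quotients can be tested on sequences, which is the form in which dominated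
  convergence delivers a derivative.\<close>

lemma has_vector_derivative_at_0_iff:
  "(F has_vector_derivative D) (at 0) \<longleftrightarrow> ((\<lambda>t. (F t - F 0) /\<^sub>R t) \<longlongrightarrow> D) (at 0)"
proof -
  have "(F has_vector_derivative D) (at 0) \<longleftrightarrow> ((\<lambda>h. norm (F h - F 0 - h *\<^sub>R D) / norm h) \<longlongrightarrow> 0) (at 0)"
    by (simp add: has_vector_derivative_def has_derivative_at bounded_linear_scaleR_left)
  also have "\<dots> \<longleftrightarrow> ((\<lambda>h. norm ((F h - F 0) /\<^sub>R h - D)) \<longlongrightarrow> 0) (at 0)"
  proof (rule filterlim_cong[OF refl refl])
    have "norm (F h - F 0 - h *\<^sub>R D) / norm h = norm ((F h - F 0) /\<^sub>R h - D)" if "h \<noteq> 0" for h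
    proof -
      have "F h - F 0 - h *\<^sub>R D = h *\<^sub>R ((F h - F 0) /\<^sub>R h - D)"
        using that by (simp add: scaleR_diff_right)
      then show ?thesis using that by simp
    qed
    then show "\<forall>\<^sub>F h in at 0. norm (F h - F 0 - h *\<^sub>R D) / norm h = norm ((F h - F 0) /\<^sub>R h - D)"
      by (auto simp: eventually_at_filter)
  qed
  also have "\<dots> \<longleftrightarrow> ((\<lambda>t. (F t - F 0) /\<^sub>R t) \<longlongrightarrow> D) (at 0)"
    by (simp add: tendsto_norm_zero_iff LIM_zero_iff)
  finally show ?thesis .
qed

text \<open>Differentiation under the integral. The difference quotients of K are bounded by a bound
  for its derivative and, for bounded increments, vanish outside one ball about x; against f this is
  an integrable majorant.\<close>

lemma mollify_has_dir_deriv: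
  fixes K :: "'a::euclidean_space \<Rightarrow> real" and f :: "'a \<Rightarrow> 'b::euclidean_space"
  assumes K: "K \<in> test_functions" and f: "f \<in> borel_L2"
  shows "has_dir_deriv v (mollify K f) (mollify (\<lambda>z. frechet_derivative K (at z) v) f)"
  unfolding has_dir_deriv_def
proof
  fix x
  let ?K' = "\<lambda>z. frechet_derivative K (at z) v"
  have K': "?K' \<in> test_functions" by (rule test_function_deriv[OF K])
  have [measurable]: "K \<in> borel_measurable borel" "?K' \<in> borel_measurable borel" "f \<in> borel_measurable borel"
    using test_function_borel[OF K] test_function_borel[OF K'] f by auto
  obtain C where C: "C > 0" "\<And>z. \<bar>?K' z\<bar> \<le> C" using test_function_bounded[OF K'] by metis
  obtain R where R: "\<And>z. R \<le> norm z \<Longrightarrow> K z = 0" using test_function_vanishes[OF K] by metis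
  have lip: "\<bar>K (z + t *\<^sub>R v) - K z\<bar> \<le> C * \<bar>t\<bar>" for z t
    using field_differentiable_bound[of UNIV "\<lambda>t. K (z + t *\<^sub>R v)" "\<lambda>t. ?K' (z + t *\<^sub>R v)" C t 0]
      test_function_line[OF K] C(2) by simp
  have "(\<lambda>n. (mollify K f (x + X n *\<^sub>R v) - mollify K f x) /\<^sub>R X n) \<longlonglongrightarrow> mollify ?K' f x"
    if X: "X \<longlonglongrightarrow> 0" "\<And>n. X n \<noteq> 0" for X
  proof -
    obtain B where B: "\<And>n. \<bar>X n\<bar> \<le> B"
      using convergent_imp_Bseq[OF convergentI[OF X(1)]] by (auto simp: Bseq_def)
    \<comment> \<open>Outside the ball of this radius about x, both K(x - y) and its translate by
      \<open>X n *\<^sub>R v\<close> vanish, for every n.\<close>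
    define r where "r = R + B * norm v"
    have eq: "(mollify K f (x + X n *\<^sub>R v) - mollify K f x) /\<^sub>R X n
        = (\<integral>y. ((K ((x - y) + X n *\<^sub>R v) - K (x - y)) / X n) *\<^sub>R f y \<partial>lborel)" for n
    proof -
      have "mollify K f (x + X n *\<^sub>R v) - mollify K f x
          = (\<integral>y. K (x + X n *\<^sub>R v - y) *\<^sub>R f y - K (x - y) *\<^sub>R f y \<partial>lborel)"
        unfolding mollify_def
        by (rule Bochner_Integration.integral_diff[symmetric]) (intro mollify_integrable K f)+
      also have "inverse (X n) *\<^sub>R \<dots> = (\<integral>y. inverse (X n) *\<^sub>R (K (x + X n *\<^sub>R v - y) *\<^sub>R f y - K (x - y) *\<^sub>R f y) \<partial>lborel)"
        by (rule integral_scaleR_right[symmetric])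
      also have "\<dots> = (\<integral>y. ((K ((x - y) + X n *\<^sub>R v) - K (x - y)) / X n) *\<^sub>R f y \<partial>lborel)"
      proof (rule Bochner_Integration.integral_cong[OF refl])
        fix y
        have "x + X n *\<^sub>R v - y = (x - y) + X n *\<^sub>R v" by simp
        moreover have "inverse c *\<^sub>R (a *\<^sub>R z - b *\<^sub>R z) = ((a - b) / c) *\<^sub>R z" for a b c :: real and z :: 'b
          by (simp add: scaleR_diff_left[symmetric] divide_inverse mult.commute[of _ "inverse c"])
        ultimately show "inverse (X n) *\<^sub>R (K (x + X n *\<^sub>R v - y) *\<^sub>R f y - K (x - y) *\<^sub>R f y)
            = ((K ((x - y) + X n *\<^sub>R v) - K (x - y)) / X n) *\<^sub>R f y" by metis
      qed
      finally show ?thesis .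
    qed
    show ?thesis
      unfolding eq unfolding mollify_def
    proof (rule integral_dominated_convergence[where w = "\<lambda>y. C * (indicator (cball x r) y * norm (f y))"])
      show "integrable lborel (\<lambda>y. C * (indicator (cball x r) y * norm (f y)))"
      proof (rule borel_L2_prod_integrable[OF _ f, of "indicator (cball x r) :: 'a \<Rightarrow> real" _ C])
        show "(indicator (cball x r) :: 'a \<Rightarrow> real) \<in> borel_L2"
        proof -
          have "(norm (indicator (cball x r) y :: real))\<^sup>2 = indicator (cball x r) y" for y
            by (simp add: indicator_def)
          then show ?thesis
            using emeasure_lborel_cball_finite[of x r]
            by (simp add: borel_L2_def borel_measurable_indicator integrable_real_indicator)
        qed
        have [measurable]: "(indicator (cball x r) :: 'a \<Rightarrow> real) \<in> borel_measurable borel"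
          by (rule borel_measurable_indicator) simp
        show "(\<lambda>y. C * (indicator (cball x r) y * norm (f y))) \<in> borel_measurable borel"
          by measurable
      qed (use C in \<open>auto simp: abs_mult\<close>)
      show "AE y in lborel. norm (((K ((x - y) + X n *\<^sub>R v) - K (x - y)) / X n) *\<^sub>R f y)
          \<le> C * (indicator (cball x r) y * norm (f y))" for n
      proof (intro AE_I2)
        fix y
        have "\<bar>(K ((x - y) + X n *\<^sub>R v) - K (x - y)) / X n\<bar> \<le> C * indicator (cball x r) y"
        proof (cases "dist x y \<le> r")
          case True
          then show ?thesis using lip[of "x - y" "X n"] X(2)[of n] by (simp add: divide_le_eq)
        next
          case False
          have "norm (X n *\<^sub>R v) \<le> B * norm v" using B[of n] by (simp add: mult_right_mono)
          moreover have "0 \<le> B * norm v" using B[of n] by (intro mult_nonneg_nonneg) auto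
          moreover have "norm (x - y) > R + B * norm v" using False by (simp add: dist_norm r_def)
          moreover have "norm (x - y) \<le> norm ((x - y) + X n *\<^sub>R v) + norm (X n *\<^sub>R v)"
            by (metis add_diff_cancel_right' norm_triangle_ineq4)
          ultimately have "R \<le> norm (x - y)" "R \<le> norm ((x - y) + X n *\<^sub>R v)" by linarith+
          then show ?thesis using C(1) by (simp add: R)
        qed
        from mult_right_mono[OF this norm_ge_zero, of "f y"]
        show "norm (((K ((x - y) + X n *\<^sub>R v) - K (x - y)) / X n) *\<^sub>R f y) \<le> C * (indicator (cball x r) y * norm (f y))"
          by (simp add: mult.assoc)
      qed
      show "AE y in lborel. (\<lambda>n. ((K ((x - y) + X n *\<^sub>R v) - K (x - y)) / X n) *\<^sub>R f y) \<longlonglongrightarrow> ?K' (x - y) *\<^sub>R f y"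
      proof (intro AE_I2 tendsto_scaleR tendsto_const)
        fix y
        have "((\<lambda>t. K ((x - y) + t *\<^sub>R v)) has_real_derivative ?K' (x - y)) (at 0)"
          using test_function_line[OF K, of "x - y" v 0] by simp
        then have "((\<lambda>t. (K ((x - y) + t *\<^sub>R v) - K (x - y)) / t) \<longlongrightarrow> ?K' (x - y)) (at 0)"
          by (simp add: DERIV_def)
        then show "(\<lambda>n. (K ((x - y) + X n *\<^sub>R v) - K (x - y)) / X n) \<longlonglongrightarrow> ?K' (x - y)"
          using X unfolding tendsto_at_iff_sequentially by (auto simp: comp_def)
      qed
    qed measurable
  qed
  then show "((\<lambda>t. mollify K f (x + t *\<^sub>R v)) has_vector_derivative mollify ?K' f x) (at 0)"
    unfolding has_vector_derivative_at_0_iff tendsto_at_iff_sequentially by (auto simp: comp_def)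
qed

text \<open>Write f(x + e) - f(x) as the integral of f' along the segment and integrate over x.
  Translation invariance makes the left side 0 and, after Fubini, the right side the integral of f'.
  Integrability thus takes the place of compact support.\<close>

lemma integral_dir_deriv_eq_0:
  fixes f :: "'a::euclidean_space \<Rightarrow> real"
  assumes d: "has_dir_deriv e f f'" and i: "integrable lborel f" "integrable lborel f'"
  shows "(\<integral>x. f' x \<partial>lborel) = 0"
proof -
  have [measurable]: "f \<in> borel_measurable borel" "f' \<in> borel_measurable borel"
    using i by (auto dest: borel_measurable_integrable)
  \<comment> \<open>The indicator turns the integral over the segment into one over the line, so
    that Fubini applies to a product of Lebesgue measures.\<close>
  define h where "h s x = indicator {0..1::real} s * f' (x + s *\<^sub>R e)" for s x
  have hm: "case_prod h \<in> borel_measurable (lborel \<Otimes>\<^sub>M lborel)"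
    unfolding h_def by measurable
  have shift: "(\<integral>x. f' (x + a) \<partial>lborel) = (\<integral>x. f' x \<partial>lborel)"
    "(\<integral>x. \<bar>f' (x + a)\<bar> \<partial>lborel) = (\<integral>x. \<bar>f' x\<bar> \<partial>lborel)"
    "integrable lborel (\<lambda>x. f' (x + a))" for a
    using integral_shift[of f' a] integral_shift[of "\<lambda>x. \<bar>f' x\<bar>" a] integrable_shift[of f' a] i by auto
  have ind: "integrable lborel (\<lambda>s. indicator {0..1::real} s * c)" for c :: real
    by (intro integrable_mult_left integrable_real_indicator) auto
  have hi: "integrable (lborel \<Otimes>\<^sub>M lborel) (case_prod h)"
  proof (rule lborel_pair.Fubini_integrable[OF hm])
    show "integrable lborel (\<lambda>s. \<integral>x. norm (case (s, x) of (s, x) \<Rightarrow> h s x) \<partial>lborel)"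
      using ind[of "\<integral>x. \<bar>f' x\<bar> \<partial>lborel"] by (simp add: h_def abs_mult shift)
    show "AE s in lborel. integrable lborel (\<lambda>x. case (s, x) of (s, x) \<Rightarrow> h s x)"
      using shift(3) by (simp add: h_def)
  qed
  have "AE x in lborel. (\<integral>s. h s x \<partial>lborel) = f (x + e) - f x"
    using lborel_pair.AE_integrable_snd[OF hi]
  proof eventually_elim
    fix x assume "integrable lborel (\<lambda>s. h s x)"
    then have si: "set_integrable lborel {0..1} (\<lambda>s. f' (x + s *\<^sub>R e))"
      by (simp add: set_integrable_def h_def)
    have "((\<lambda>s. f' (x + s *\<^sub>R e)) has_integral f (x + 1 *\<^sub>R e) - f (x + 0 *\<^sub>R e)) {0..1}"
      by (rule fundamental_theorem_of_calculus)
         (auto intro: has_vector_derivative_at_within has_dir_deriv_line[OF d])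
    then show "(\<integral>s. h s x \<partial>lborel) = f (x + e) - f x"
      using set_borel_integral_eq_integral(2)[OF si]
      by (simp add: set_lebesgue_integral_def h_def integral_unique)
  qed
  then have "(\<integral>x. (\<integral>s. h s x \<partial>lborel) \<partial>lborel) = (\<integral>x. f (x + e) - f x \<partial>lborel)"
    using borel_measurable_integrable[OF lborel_pair.integrable_snd[OF hi]]
    by (intro integral_cong_AE) auto
  also have "\<dots> = 0"
    using integral_shift[of f e] integrable_shift[of f e] i by simp
  also have "(\<integral>x. (\<integral>s. h s x \<partial>lborel) \<partial>lborel) = (\<integral>s. (\<integral>x. h s x \<partial>lborel) \<partial>lborel)"
    by (rule lborel_pair.Fubini_integral[OF hi])
  also have "\<dots> = (\<integral>x. f' x \<partial>lborel)"
    by (simp add: h_def shift)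
  finally show ?thesis .
qed

section \<open>Borel representatives and weak derivatives\<close>

lemma lebesgue_borel_representative:
  fixes f :: "'a::euclidean_space \<Rightarrow> 'b::euclidean_space"
  assumes f: "f \<in> borel_measurable lebesgue"
  obtains g where "g \<in> borel_measurable borel" "AE x in lebesgue. f x = g x"
proof -
  have "\<exists>g\<in>borel_measurable lborel. AE x in lborel. f x \<bullet> b = g x" for b
    by (rule completion_ex_borel_measurable_real) (use f in measurable)
  then obtain g where g: "\<And>b. g b \<in> borel_measurable lborel" "\<And>b. AE x in lborel. f x \<bullet> b = g b x"
    by metis
  have "AE x in lborel. \<forall>b\<in>Basis. f x \<bullet> b = g b x"
    using g(2) by (intro AE_finite_allI) auto
  then have "AE x in lborel. f x = (\<Sum>b\<in>Basis. g b x *\<^sub>R b)"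
  proof eventually_elim
    fix x assume "\<forall>b\<in>Basis. f x \<bullet> b = g b x"
    then show "f x = (\<Sum>b\<in>Basis. g b x *\<^sub>R b)"
      using euclidean_representation[of "f x"] by (metis (no_types, lifting) sum.cong)
  qed
  then show thesis
    using that[of "\<lambda>x. \<Sum>b\<in>Basis. g b x *\<^sub>R b"] g(1) by (auto intro: AE_completion)
qed

lemma L2_space_borel_representative:
  assumes "f \<in> L2_space"
  obtains g where "g \<in> borel_L2" "AE x in lebesgue. f x = g x"
proof -
  have f: "f \<in> borel_measurable lebesgue" "integrable lebesgue (\<lambda>x. (norm (f x))\<^sup>2)"
    using assms by (auto simp: L2_space_def)
  obtain g where g: "g \<in> borel_measurable borel" "AE x in lebesgue. f x = g x"
    using lebesgue_borel_representative[OF f(1)] by metis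
  have [measurable]: "g \<in> borel_measurable borel" by fact
  have gl: "(\<lambda>x. (norm (g x))\<^sup>2) \<in> borel_measurable lebesgue"
    by (rule measurable_completion) simp
  have "integrable lebesgue (\<lambda>x. (norm (g x))\<^sup>2)"
    by (rule Bochner_Integration.integrable_cong_AE_imp[OF f(2) gl]) (use g(2) in auto)
  then have "integrable lborel (\<lambda>x. (norm (g x))\<^sup>2)"
    by (subst (asm) integrable_completion) auto
  then show thesis using that[of g] g by (simp add: borel_L2_def)
qed

text \<open>The weak derivative is tested with \<eta>(y) = K(x - y), whose derivative carries a
  minus sign that cancels the one in the definition. Combined with
  \<open>mollify_has_dir_deriv\<close>: mollifying the weak derivative gives the classical
  derivative of the mollified function.\<close>

lemma mollify_weak_partial:
  fixes K :: "real^'n::finite \<Rightarrow> real" and f g f0 g0 :: "real^'n \<Rightarrow> 'b::euclidean_space"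
  assumes K: "K \<in> test_functions" and w: "has_weak_partial k f0 g0" and f0: "f0 \<in> L2_space"
    and f: "f \<in> borel_L2" "AE x in lebesgue. f0 x = f x"
    and g: "g \<in> borel_L2" "AE x in lebesgue. g0 x = g x"
  shows "mollify (\<lambda>z. frechet_derivative K (at z) (axis k 1)) f = mollify K g"
proof
  fix x
  define \<eta> where "\<eta> y = K (x - y)" for y
  have \<eta>: "\<eta> \<in> test_functions" unfolding \<eta>_def[abs_def] by (rule test_function_reflect[OF K])
  have d\<eta>: "frechet_derivative \<eta> (at y) v = - frechet_derivative K (at (x - y)) v" for y v
  proof -
    have "(\<eta> has_derivative (\<lambda>v. frechet_derivative K (at (x - y)) (- v))) (at y)"
      unfolding \<eta>_def[abs_def]
      by (rule has_derivative_compose[OF _ test_function_has_derivative[OF K]])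
         (auto intro!: derivative_eq_intros)
    then have "frechet_derivative \<eta> (at y) = (\<lambda>v. frechet_derivative K (at (x - y)) (- v))"
      by (metis frechet_derivative_at)
    moreover have "linear (frechet_derivative K (at (x - y)))"
      by (rule has_derivative_linear[OF test_function_has_derivative[OF K]])
    ultimately show ?thesis by (simp add: linear_neg)
  qed
  have g0: "g0 \<in> L2_space" using w by (simp add: has_weak_partial_def)
  have leb: "(\<integral>y. h y *\<^sub>R u0 y \<partial>lebesgue) = (\<integral>y. h y *\<^sub>R u y \<partial>lborel)"
    if "h \<in> test_functions" "u0 \<in> L2_space" "u \<in> borel_L2" "AE x in lebesgue. u0 x = u x"
    for h :: "real^'n \<Rightarrow> real" and u0 u :: "real^'n \<Rightarrow> 'b"
  proof -
    have [measurable]: "h \<in> borel_measurable borel" "u \<in> borel_measurable borel"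
      using that test_function_borel by auto
    have m: "h \<in> borel_measurable lebesgue" "u \<in> borel_measurable lebesgue" "u0 \<in> borel_measurable lebesgue"
      using that(2) by (auto simp: L2_space_def intro!: measurable_completion)
    have "(\<integral>y. h y *\<^sub>R u0 y \<partial>lebesgue) = (\<integral>y. h y *\<^sub>R u y \<partial>lebesgue)"
      by (rule integral_cong_AE) (use m that(4) in auto)
    also have "\<dots> = (\<integral>y. h y *\<^sub>R u y \<partial>lborel)"
      by (rule integral_completion) simp
    finally show ?thesis .
  qed
  have "(\<integral>y. frechet_derivative \<eta> (at y) (axis k 1) *\<^sub>R f y \<partial>lborel) = - (\<integral>y. \<eta> y *\<^sub>R g y \<partial>lborel)"
    using w \<eta> leb[OF test_function_deriv[OF \<eta>] f0 f] leb[OF \<eta> g0 g]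
    by (auto simp: has_weak_partial_def)
  then show "mollify (\<lambda>z. frechet_derivative K (at z) (axis k 1)) f x = mollify K g x"
    by (simp add: mollify_def d\<eta> \<eta>_def)
qed

section \<open>Pauli algebra\<close>

text \<open>The real inner product on \<open>complex^2\<close> is the real part of the Hermitian
  one, and the Pauli matrices are Hermitian.\<close>

lemma pauli_adjoint: "(pauli k *v u) \<bullet> w = u \<bullet> (pauli k *v w)"
  by (simp add: pauli_def matrix_vector_mult_def inner_vec_def sum_2 inner_complex_def)

lemma pauli_involution: "pauli k *v (pauli k *v u) = u"
  by (auto simp: pauli_def matrix_vector_mult_def sum_2 vec_eq_iff forall_2)

lemma pauli_anticommute:
  assumes "j \<noteq> k" shows "pauli j *v (pauli k *v u) = - (pauli k *v (pauli j *v u))"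
proof -
  have "j = 1 \<or> j = 2 \<or> j = 3" "k = 1 \<or> k = 2 \<or> k = 3" by (rule exhaust_3)+
  with assms show ?thesis
    by (auto simp: pauli_def matrix_vector_mult_def sum_2 vec_eq_iff forall_2)
qed

lemma bounded_linear_pauli: "bounded_linear (\<lambda>v. pauli k *v v)"
  by (rule linear_conv_bounded_linear[THEN iffD1])
     (auto intro!: linearI simp: matrix_vector_mult_def vec_eq_iff sum_2 scaleR_add_right algebra_simps)

lemma pauli_inner_pauli: "(pauli k *v u) \<bullet> (pauli k *v w) = u \<bullet> w"
  by (simp add: pauli_adjoint pauli_involution)

text \<open>Anticommutation makes the product of two different Pauli matrices skew-adjoint. This
  skewness turns the cross terms of |\<sigma>.grad u|^2 into two-forms of the gradient.\<close>

lemma pauli_inner_skew: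
  assumes "j \<noteq> k"
  shows "(pauli j *v u) \<bullet> (pauli k *v w) = - ((pauli j *v w) \<bullet> (pauli k *v u))"
proof -
  have "(pauli j *v u) \<bullet> (pauli k *v w) = u \<bullet> (pauli j *v (pauli k *v w))"
    by (simp add: pauli_adjoint)
  also have "\<dots> = - (u \<bullet> (pauli k *v (pauli j *v w)))"
    using pauli_anticommute[OF assms] by (simp add: inner_minus_right)
  also have "\<dots> = - ((pauli j *v w) \<bullet> (pauli k *v u))"
    by (metis pauli_adjoint inner_commute)
  finally show ?thesis .
qed

text \<open>Each Pauli matrix is an isometry, which gives the squares. The cross terms are listed
  cyclically to match the minors of the null Lagrangian.\<close>

lemma norm_pauli_sum_sq:
  "(norm (pauli 1 *v t1 + pauli 2 *v t2 + pauli 3 *v t3))\<^sup>2 =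
   (norm t1)\<^sup>2 + (norm t2)\<^sup>2 + (norm t3)\<^sup>2 +
   2 * ((pauli 2 *v t2) \<bullet> (pauli 3 *v t3) + (pauli 3 *v t3) \<bullet> (pauli 1 *v t1) + (pauli 1 *v t1) \<bullet> (pauli 2 *v t2))"
  unfolding power2_norm_eq_inner
  by (simp add: inner_add_left inner_add_right pauli_inner_pauli)
     (simp add: inner_commute)

lemma pauli_orthogonal: "j \<noteq> k \<Longrightarrow> (pauli j *v u) \<bullet> (pauli k *v u) = 0"
  using pauli_inner_skew[of j k u u] by simp

text \<open>Gradients tangential to a sphere have only two components, so the Cauchy-Schwarz
  constant in \<open>|\<sigma>\<cdot>t|\<^sup>2 \<le> c |t|\<^sup>2\<close> drops from \<open>3\<close> to \<open>2\<close>.\<close>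

lemma norm_pauli_tangential_le:
  assumes n: "n1\<^sup>2 + n2\<^sup>2 + n3\<^sup>2 = 1" and t: "n1 *\<^sub>R t1 + n2 *\<^sub>R t2 + n3 *\<^sub>R t3 = 0"
  shows "(norm (pauli 1 *v t1 + pauli 2 *v t2 + pauli 3 *v t3))\<^sup>2 \<le>
    2 * ((norm t1)\<^sup>2 + (norm t2)\<^sup>2 + (norm t3)\<^sup>2)"
proof -
  define S where "S = pauli 1 *v t1 + pauli 2 *v t2 + pauli 3 *v t3"
  define a1 where "a1 = pauli 1 *v S"
  define a2 where "a2 = pauli 2 *v S"
  define a3 where "a3 = pauli 3 *v S"
  \<comment> \<open>B is \<sigma>.n applied to S, and the vectors a - n B form the tangential part
    of the triple a. As t is tangential, |S|^2 = t.a sees only that part, whose squared norm is 3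
    |S|^2 - |B|^2 = 2 |S|^2.\<close>
  define B where "B = n1 *\<^sub>R a1 + n2 *\<^sub>R a2 + n3 *\<^sub>R a3"
  have aa: "a1 \<bullet> a1 = S \<bullet> S" "a2 \<bullet> a2 = S \<bullet> S" "a3 \<bullet> a3 = S \<bullet> S"
    "a1 \<bullet> a2 = 0" "a1 \<bullet> a3 = 0" "a2 \<bullet> a3 = 0" "a2 \<bullet> a1 = 0" "a3 \<bullet> a1 = 0" "a3 \<bullet> a2 = 0"
    by (simp_all add: a1_def a2_def a3_def pauli_inner_pauli pauli_orthogonal)
  have aB: "a1 \<bullet> B = n1 * (S \<bullet> S)" "a2 \<bullet> B = n2 * (S \<bullet> S)" "a3 \<bullet> B = n3 * (S \<bullet> S)"
    by (simp_all add: B_def inner_add_right aa)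
  have BB: "B \<bullet> B = S \<bullet> S"
  proof -
    have "B \<bullet> B = (n1\<^sup>2 + n2\<^sup>2 + n3\<^sup>2) * (S \<bullet> S)"
      by (subst (1) B_def) (simp add: inner_add_left aB power2_eq_square algebra_simps)
    then show ?thesis using n by simp
  qed
  have St: "S \<bullet> S = t1 \<bullet> a1 + t2 \<bullet> a2 + t3 \<bullet> a3"
    by (subst (1) S_def) (simp add: inner_add_left pauli_adjoint a1_def a2_def a3_def)
  have tB: "n1 * (t1 \<bullet> B) + n2 * (t2 \<bullet> B) + n3 * (t3 \<bullet> B) = 0"
    using arg_cong[OF t, of "\<lambda>z. z \<bullet> B"] by (simp add: inner_add_left)
  have e: "(norm (2 *\<^sub>R t - (a - m *\<^sub>R B)))\<^sup>2 =
      4 * (norm t)\<^sup>2 - 4 * (t \<bullet> a) + 4 * (m * (t \<bullet> B)) + (a \<bullet> a - 2 * m * (a \<bullet> B) + m\<^sup>2 * (B \<bullet> B))" for t a m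
    unfolding power2_norm_eq_inner
    by (simp add: inner_diff_left inner_diff_right inner_commute power2_eq_square algebra_simps)
  \<comment> \<open>Cauchy-Schwarz between t and the tangential part of a, in the form of a sum of
    squares; the factor 2 on t is the one that produces the constant 2.\<close>
  have "0 \<le> (norm (2 *\<^sub>R t1 - (a1 - n1 *\<^sub>R B)))\<^sup>2 + (norm (2 *\<^sub>R t2 - (a2 - n2 *\<^sub>R B)))\<^sup>2
      + (norm (2 *\<^sub>R t3 - (a3 - n3 *\<^sub>R B)))\<^sup>2" by simp
  also have "\<dots> = 4 * ((norm t1)\<^sup>2 + (norm t2)\<^sup>2 + (norm t3)\<^sup>2) - 4 * (S \<bullet> S)
      + (3 * (S \<bullet> S) - (n1\<^sup>2 + n2\<^sup>2 + n3\<^sup>2) * (S \<bullet> S))"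
    using tB St unfolding e aa aB BB by (simp add: power2_eq_square algebra_simps)
  also have "\<dots> = 4 * ((norm t1)\<^sup>2 + (norm t2)\<^sup>2 + (norm t3)\<^sup>2) - 2 * (S \<bullet> S)"
    unfolding n by simp
  finally show ?thesis unfolding S_def[symmetric] power2_norm_eq_inner by simp
qed

text \<open>Projecting the gradient transforms its minors by the cofactor matrix of I - n n^T, which
  is n n^T. So only the component W of the vector of minors along n survives.\<close>

lemma skew_form_tangential:
  fixes w :: "'b::real_inner \<Rightarrow> 'b \<Rightarrow> real"
  assumes w: "bounded_bilinear w" and skew: "\<And>u v. w u v = - w v u"
    and n: "n1\<^sup>2 + n2\<^sup>2 + n3\<^sup>2 = 1"
    and pr: "pr = n1 *\<^sub>R p1 + n2 *\<^sub>R p2 + n3 *\<^sub>R p3"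
  defines "W \<equiv> n1 * w p2 p3 + n2 * w p3 p1 + n3 * w p1 p2"
  shows "w (p2 - n2 *\<^sub>R pr) (p3 - n3 *\<^sub>R pr) = n1 * W"
    and "w (p3 - n3 *\<^sub>R pr) (p1 - n1 *\<^sub>R pr) = n2 * W"
    and "w (p1 - n1 *\<^sub>R pr) (p2 - n2 *\<^sub>R pr) = n3 * W"
proof -
  interpret bounded_bilinear w by fact
  have z: "w u u = 0" for u using skew[of u u] by simp
  have s: "w p2 p1 = - w p1 p2" "w p3 p2 = - w p2 p3" "w p1 p3 = - w p3 p1" by (rule skew)+
  note ex = diff_left diff_right add_left add_right scaleR_left scaleR_right z s
  have n': "n1 * n1 = 1 - n2 * n2 - n3 * n3" using n by (simp add: power2_eq_square algebra_simps)
  show "w (p2 - n2 *\<^sub>R pr) (p3 - n3 *\<^sub>R pr) = n1 * W"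
    using n' unfolding pr W_def by (simp add: ex) algebra
  show "w (p3 - n3 *\<^sub>R pr) (p1 - n1 *\<^sub>R pr) = n2 * W"
    using n' unfolding pr W_def by (simp add: ex) algebra
  show "w (p1 - n1 *\<^sub>R pr) (p2 - n2 *\<^sub>R pr) = n3 * W"
    using n' unfolding pr W_def by (simp add: ex) algebra
qed

definition pauli_form :: "3 \<Rightarrow> 3 \<Rightarrow> complex^2 \<Rightarrow> complex^2 \<Rightarrow> real" where
  "pauli_form j k p q = (pauli j *v p) \<bullet> (pauli k *v q)"

lemma bounded_bilinear_pauli_form: "bounded_bilinear (pauli_form j k)"
  unfolding pauli_form_def[abs_def]
  by (rule bounded_bilinear.comp[OF bounded_bilinear_inner bounded_linear_pauli bounded_linear_pauli])

lemma pauli_form_skew: "j \<noteq> k \<Longrightarrow> pauli_form j k p q = - pauli_form j k q p"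
  unfolding pauli_form_def by (rule pauli_inner_skew)

text \<open>With \<open>A = \<rho> I + g n \<otimes> n\<close>, the last two terms are
  \<open>2 \<Sum>\<^sub>l \<Sum>\<^sub>i A\<^sub>l\<^sub>i \<omega>\<^sub>l(p\<^sub>i\<^sub>+\<^sub>1, p\<^sub>i\<^sub>+\<^sub>2)\<close>
  with cyclic indices, which is a null Lagrangian when \<open>A\<close> is the Jacobian of a vector field.\<close>

lemma pauli_gradient_ge_radial:
  fixes p1 p2 p3 :: "complex^2"
  assumes n: "n1\<^sup>2 + n2\<^sup>2 + n3\<^sup>2 = 1" and g: "\<bar>g\<bar> \<le> \<rho>"
  defines "cyc \<equiv> \<lambda>j k. n1 * pauli_form j k p2 p3 + n2 * pauli_form j k p3 p1 + n3 * pauli_form j k p1 p2"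
  shows "\<rho> * (norm (pauli 1 *v p1 + pauli 2 *v p2 + pauli 3 *v p3))\<^sup>2 \<ge>
    \<rho> * (norm (n1 *\<^sub>R p1 + n2 *\<^sub>R p2 + n3 *\<^sub>R p3))\<^sup>2
    + 2 * (\<rho> * (pauli_form 2 3 p2 p3 + pauli_form 3 1 p3 p1 + pauli_form 1 2 p1 p2))
    + 2 * (g * (n1 * cyc 2 3 + n2 * cyc 3 1 + n3 * cyc 1 2))"
proof -
  define pr where "pr = n1 *\<^sub>R p1 + n2 *\<^sub>R p2 + n3 *\<^sub>R p3"
  define t1 where "t1 = p1 - n1 *\<^sub>R pr"
  define t2 where "t2 = p2 - n2 *\<^sub>R pr"
  define t3 where "t3 = p3 - n3 *\<^sub>R pr"
  define T where "T = (norm t1)\<^sup>2 + (norm t2)\<^sup>2 + (norm t3)\<^sup>2"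
  \<comment> \<open>These are the cross terms of the tangential gradient, because its minors are n1,
    n2, n3 times the normal components \<open>cyc\<close>.\<close>
  define N where "N = 2 * (n1 * cyc 2 3 + n2 * cyc 3 1 + n3 * cyc 1 2)"
  have ne: "(2::3) \<noteq> 3" "(3::3) \<noteq> 1" "(1::3) \<noteq> 2" by auto
  note tang = skew_form_tangential[OF bounded_bilinear_pauli_form pauli_form_skew n pr_def, folded t1_def t2_def t3_def]
  have "(norm (pauli 1 *v t1 + pauli 2 *v t2 + pauli 3 *v t3))\<^sup>2 = T + N"
    unfolding norm_pauli_sum_sq T_def N_def cyc_def
    using tang(1)[OF ne(1)] tang(2)[OF ne(2)] tang(3)[OF ne(3)] by (simp add: pauli_form_def)
  moreover have "n1 *\<^sub>R t1 + n2 *\<^sub>R t2 + n3 *\<^sub>R t3 = 0"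
  proof -
    have "n1 *\<^sub>R t1 + n2 *\<^sub>R t2 + n3 *\<^sub>R t3 = pr - (n1\<^sup>2 + n2\<^sup>2 + n3\<^sup>2) *\<^sub>R pr"
      by (simp add: t1_def t2_def t3_def pr_def[symmetric] scaleR_diff_right power2_eq_square scaleR_add_left)
         (simp add: pr_def algebra_simps)
    then show ?thesis using n by simp
  qed
  \<comment> \<open>The tangential constant 2 gives N <= T, nonnegativity of the square gives -T <=
    N. The two-sided bound is what admits g of either sign.\<close>
  ultimately have "T + N \<le> 2 * T" "0 \<le> T + N"
    using norm_pauli_tangential_le[OF n] unfolding T_def by (metis, metis zero_le_power2)
  then have NT: "\<bar>N\<bar> \<le> T" by linarith
  have "g * N \<le> \<bar>g\<bar> * \<bar>N\<bar>" by (metis abs_ge_self abs_mult)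
  also have "\<dots> \<le> \<rho> * T" using g NT by (intro mult_mono) auto
  finally have gN: "g * N \<le> \<rho> * T" .
  have "(norm p1)\<^sup>2 + (norm p2)\<^sup>2 + (norm p3)\<^sup>2 = (norm pr)\<^sup>2 + T"
  proof -
    have "T = p1 \<bullet> p1 + p2 \<bullet> p2 + p3 \<bullet> p3 - 2 * (n1 * (p1 \<bullet> pr) + n2 * (p2 \<bullet> pr) + n3 * (p3 \<bullet> pr))
        + (n1\<^sup>2 + n2\<^sup>2 + n3\<^sup>2) * (pr \<bullet> pr)"
      unfolding T_def t1_def t2_def t3_def power2_norm_eq_inner
      by (simp add: inner_diff_left inner_diff_right inner_commute power2_eq_square algebra_simps)
    moreover have "n1 * (p1 \<bullet> pr) + n2 * (p2 \<bullet> pr) + n3 * (p3 \<bullet> pr) = pr \<bullet> pr"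
      by (subst (4) pr_def) (simp add: inner_add_left)
    ultimately show ?thesis unfolding n power2_norm_eq_inner by simp
  qed
  then have "\<rho> * (norm (pauli 1 *v p1 + pauli 2 *v p2 + pauli 3 *v p3))\<^sup>2 =
    \<rho> * (norm pr)\<^sup>2 + \<rho> * T + 2 * (\<rho> * (pauli_form 2 3 p2 p3 + pauli_form 3 1 p3 p1 + pauli_form 1 2 p1 p2))"
    unfolding norm_pauli_sum_sq pauli_form_def by (simp add: algebra_simps)
  with gN show ?thesis unfolding N_def pr_def by (simp add: algebra_simps)
qed

text \<open>Away from 0 this is the product rule. At 0 the formula reads R(0) (v.l), and continuity
  of R is enough for it because the factor x.l already vanishes to first order.\<close>

lemma radial_field_has_derivative:
  fixes l x :: "'a::euclidean_space"
  assumes R: "\<And>r. r > 0 \<Longrightarrow> (R has_real_derivative R' r) (at r)" "isCont R 0"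
  shows "((\<lambda>x. R (norm x) * (x \<bullet> l)) has_derivative
    (\<lambda>v. R (norm x) * (v \<bullet> l) + R' (norm x) * ((x \<bullet> v) / norm x) * (x \<bullet> l))) (at x)"
proof (cases "x = 0")
  case False
  have "((\<lambda>x. R (norm x)) has_derivative (\<lambda>v. R' (norm x) * ((x \<bullet> v) / norm x))) (at x)"
  proof -
    have "(norm has_derivative (\<lambda>v. (x \<bullet> v) / norm x)) (at x)"
      using has_derivative_norm[OF False] by (simp add: sgn_div_norm inner_commute field_simps)
    from has_derivative_compose[OF this R(1)[unfolded has_field_derivative_def]] False
    show ?thesis by simp
  qed
  moreover have "((\<lambda>x. x \<bullet> l) has_derivative (\<lambda>v. v \<bullet> l)) (at x)"
    by (auto intro!: derivative_eq_intros)
  ultimately show ?thesis by (rule has_derivative_mult)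
next
  case True
  have "((\<lambda>v. (R (norm v) - R 0) * (v \<bullet> l) / norm v) \<longlongrightarrow> 0) (at 0)"
  proof (rule Lim_null_comparison)
    show "\<forall>\<^sub>F v in at 0. norm ((R (norm v) - R 0) * (v \<bullet> l) / norm v) \<le> \<bar>R (norm v) - R 0\<bar> * norm l"
    proof (rule eventually_at_filter[THEN iffD2], rule always_eventually, intro allI impI)
      fix v :: 'a assume "v \<noteq> 0"
      then have "\<bar>v \<bullet> l\<bar> / norm v \<le> norm l"
        using Cauchy_Schwarz_ineq2[of v l] by (simp add: divide_le_eq mult.commute)
      from mult_left_mono[OF this abs_ge_zero]
      show "norm ((R (norm v) - R 0) * (v \<bullet> l) / norm v) \<le> \<bar>R (norm v) - R 0\<bar> * norm l"
        by (simp add: abs_mult)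
    qed
    have "((\<lambda>v. R (norm v)) \<longlongrightarrow> R (norm (0::'a))) (at (0::'a))"
      using R(2) by (intro isCont_tendsto_compose[of _ R]) (auto intro: tendsto_norm_zero tendsto_ident_at)
    then have "((\<lambda>v::'a. \<bar>R (norm v) - R 0\<bar> * norm l) \<longlongrightarrow> \<bar>R 0 - R 0\<bar> * norm l) (at 0)"
      by (intro tendsto_intros) simp
    then show "((\<lambda>v::'a. \<bar>R (norm v) - R 0\<bar> * norm l) \<longlongrightarrow> 0) (at 0)" by simp
  qed
  then have "((\<lambda>v. norm (R (norm v) * (v \<bullet> l) - R 0 * (v \<bullet> l)) / norm v) \<longlongrightarrow> 0) (at 0)"
    using tendsto_norm_zero by (fastforce simp: left_diff_distrib)
  moreover have "bounded_linear (\<lambda>v. R 0 * (v \<bullet> l))"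
    by (intro bounded_linear_intros)
  ultimately show ?thesis using True by (simp add: has_derivative_at)
qed

section \<open>The null Lagrangian\<close>

lemma borel_measurable_bilinear_comp:
  fixes w :: "'b::euclidean_space \<Rightarrow> 'b \<Rightarrow> real"
  assumes "bounded_bilinear w" "f \<in> borel_measurable M" "g \<in> borel_measurable M"
  shows "(\<lambda>x. w (f x) (g x)) \<in> borel_measurable M"
  by (rule borel_measurable_continuous_Pair[OF assms(2,3)])
     (auto intro!: bounded_bilinear.continuous_on[OF assms(1)] continuous_intros)

lemma integrable_bounded_times_bilinear:
  fixes w :: "'b::euclidean_space \<Rightarrow> 'b \<Rightarrow> real" and m :: "'a::euclidean_space \<Rightarrow> real"
  assumes w: "bounded_bilinear w" and m: "m \<in> borel_measurable borel" "\<And>x. \<bar>m x\<bar> \<le> C"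
    and f: "f \<in> borel_L2" and g: "g \<in> borel_L2"
  shows "integrable lborel (\<lambda>x. m x * w (f x) (g x))"
proof -
  obtain K where K: "0 \<le> K" "\<And>a b. norm (w a b) \<le> norm a * norm b * K"
    using bounded_bilinear.nonneg_bounded[OF w] by blast
  have [measurable]: "(\<lambda>x. w (f x) (g x)) \<in> borel_measurable borel" "m \<in> borel_measurable borel"
    using borel_measurable_bilinear_comp[OF w borel_L2_measurable[OF f] borel_L2_measurable[OF g]] m by auto
  have "0 \<le> C" using m(2)[of undefined] by linarith
  then have "norm (m x * w (f x) (g x)) \<le> C * K * (norm (f x) * norm (g x))" for x
    using mult_mono[OF m(2)[of x] K(2)[of "f x" "g x"]] by (simp add: abs_mult mult_ac)
  then show ?thesis
    by (intro borel_L2_prod_integrable[OF f g]) measurable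
qed

lemma integrable_bounded_times_norm_sq:
  assumes "m \<in> borel_measurable borel" "\<And>x. \<bar>m x\<bar> \<le> C" "f \<in> borel_L2"
  shows "integrable lborel (\<lambda>x. m x * (norm (f x))\<^sup>2)"
  using integrable_bounded_times_bilinear[OF bounded_bilinear_inner assms assms(3)]
  by (simp add: power2_norm_eq_inner)

lemma borel_L2_bounded_scaleR:
  assumes m: "m \<in> borel_measurable borel" "\<And>x. \<bar>m x\<bar> \<le> C" and f: "f \<in> borel_L2"
  shows "(\<lambda>x. m x *\<^sub>R f x) \<in> borel_L2"
proof -
  have [measurable]: "f \<in> borel_measurable borel" "m \<in> borel_measurable borel" using f m by auto
  have "\<bar>(m x)\<^sup>2\<bar> \<le> C\<^sup>2" for x
    using power_mono[OF m(2)[of x] abs_ge_zero, of 2] by simp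
  then have "integrable lborel (\<lambda>x. (m x)\<^sup>2 * (norm (f x))\<^sup>2)"
    by (intro integrable_bounded_times_norm_sq[OF _ _ f]) measurable
  then show ?thesis by (simp add: borel_L2_def power_mult_distrib)
qed

text \<open>With h and h' bounded and all other factors in L^2, the product
  \<open>h x * w (f x) (g x)\<close> and its directional derivative are integrable, so
  \<open>integral_dir_deriv_eq_0\<close> leaves no boundary term. The boundedness asked for here
  dictates how the radial fields are regularised.\<close>

lemma integral_by_parts_bilinear:
  fixes w :: "'b::euclidean_space \<Rightarrow> 'b \<Rightarrow> real" and h h' :: "'a::euclidean_space \<Rightarrow> real"
  assumes w: "bounded_bilinear w"
    and h: "has_dir_deriv e h h'" "h \<in> borel_measurable borel" "\<And>x. \<bar>h x\<bar> \<le> C"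
    and h': "h' \<in> borel_measurable borel" "\<And>x. \<bar>h' x\<bar> \<le> C'"
    and f: "has_dir_deriv e f f'" "f \<in> borel_L2" "f' \<in> borel_L2"
    and g: "has_dir_deriv e g g'" "g \<in> borel_L2" "g' \<in> borel_L2"
  shows "(\<integral>x. h x * w (f x) (g' x) + h x * w (f' x) (g x) + h' x * w (f x) (g x) \<partial>lborel) = 0"
    and "integrable lborel (\<lambda>x. h x * w (f x) (g' x) + h x * w (f' x) (g x) + h' x * w (f x) (g x))"
proof -
  note int = integrable_bounded_times_bilinear[OF w]
  show i: "integrable lborel (\<lambda>x. h x * w (f x) (g' x) + h x * w (f' x) (g x) + h' x * w (f x) (g x))"
    by (intro Bochner_Integration.integrable_add int[OF h(2,3)] int[OF h'] f g)
  have "has_dir_deriv e (\<lambda>x. h x * w (f x) (g x))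
      (\<lambda>x. h x * (w (f x) (g' x) + w (f' x) (g x)) + h' x * w (f x) (g x))"
    by (rule has_dir_deriv_bilinear[OF bounded_bilinear_mult h(1) has_dir_deriv_bilinear[OF w f(1) g(1)]])
  then have "has_dir_deriv e (\<lambda>x. h x * w (f x) (g x))
      (\<lambda>x. h x * w (f x) (g' x) + h x * w (f' x) (g x) + h' x * w (f x) (g x))"
    by (simp add: distrib_left)
  then show "(\<integral>x. h x * w (f x) (g' x) + h x * w (f' x) (g x) + h' x * w (f x) (g x) \<partial>lborel) = 0"
    by (rule integral_dir_deriv_eq_0[OF _ int[OF h(2,3) f(2) g(2)] i])
qed

text \<open>A spinor u with gradient p and symmetric Hessian q, all square integrable, with
  classical derivatives along the axes: what the mollification of an H^1 spinor provides.\<close>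

locale C2_spinor =
  fixes u :: "real^3 \<Rightarrow> complex^2" and p :: "3 \<Rightarrow> real^3 \<Rightarrow> complex^2"
    and q :: "3 \<Rightarrow> 3 \<Rightarrow> real^3 \<Rightarrow> complex^2"
  assumes u_L2: "u \<in> borel_L2" and p_L2: "\<And>k. p k \<in> borel_L2" and q_L2: "\<And>j k. q j k \<in> borel_L2"
    and du: "\<And>k. has_dir_deriv (axis k 1) u (p k)"
    and dp: "\<And>j k. has_dir_deriv (axis j 1) (p k) (q j k)"
    and q_commute: "\<And>j k. q j k = q k j"
begin

text \<open>The two-form \<open>\<omega>(du \<and> du)\<close> is exact, hence orthogonal to \<open>dh\<close>.\<close>

lemma null_lagrangian:
  fixes w :: "complex^2 \<Rightarrow> complex^2 \<Rightarrow> real" and h :: "real^3 \<Rightarrow> real" and h' :: "3 \<Rightarrow> real^3 \<Rightarrow> real"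
  assumes w: "bounded_bilinear w" and skew: "\<And>u v. w u v = - w v u"
    and dh: "\<And>i. has_dir_deriv (axis i 1) h (h' i)"
    and h: "h \<in> borel_measurable borel" "\<And>x. \<bar>h x\<bar> \<le> C"
    and h': "\<And>i. h' i \<in> borel_measurable borel" "\<And>i x. \<bar>h' i x\<bar> \<le> C'"
  shows "(\<integral>x. h' 1 x * w (p 2 x) (p 3 x) + h' 2 x * w (p 3 x) (p 1 x) + h' 3 x * w (p 1 x) (p 2 x) \<partial>lborel) = 0"
proof -
  \<comment> \<open>\<open>T i j k\<close> is the derivative along axis i of
    \<open>h x * w (p j x) (p k x)\<close>, so it integrates to 0. In the cyclic sum the terms with
    second derivatives cancel in pairs, by symmetry of q and skewness of w.\<close>
  define T where "T i j k x = h x * w (p j x) (q i k x) + h x * w (q i j x) (p k x) + h' i x * w (p j x) (p k x)" for i j k x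
  have T: "(\<integral>x. T i j k x \<partial>lborel) = 0" "integrable lborel (T i j k)" for i j k
    unfolding T_def
    by (rule integral_by_parts_bilinear[OF w dh h h' dp p_L2 q_L2 dp p_L2 q_L2])+
  have "h' 1 x * w (p 2 x) (p 3 x) + h' 2 x * w (p 3 x) (p 1 x) + h' 3 x * w (p 1 x) (p 2 x)
      = T 1 2 3 x + T 2 3 1 x + T 3 1 2 x" for x
    using skew[of "q 1 2 x" "p 3 x"] skew[of "q 2 3 x" "p 1 x"] skew[of "q 3 1 x" "p 2 x"]
    by (simp add: T_def q_commute[of 2 1] q_commute[of 3 2] q_commute[of 1 3] algebra_simps)
  then show ?thesis using T by (simp add: Bochner_Integration.integral_add)
qed

definition radial_deriv :: "real^3 \<Rightarrow> complex^2" where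
  "radial_deriv x = (x $ 1 / norm x) *\<^sub>R p 1 x + (x $ 2 / norm x) *\<^sub>R p 2 x + (x $ 3 / norm x) *\<^sub>R p 3 x"

definition pauli_grad :: "real^3 \<Rightarrow> complex^2" where
  "pauli_grad x = pauli 1 *v p 1 x + pauli 2 *v p 2 x + pauli 3 *v p 3 x"

lemma pauli_grad_L2: "pauli_grad \<in> borel_L2"
  unfolding pauli_grad_def[abs_def]
  by (intro borel_L2_add borel_L2_linear[OF p_L2 bounded_linear_pauli])

lemma abs_component_div_norm_le: "\<bar>x $ k / norm x\<bar> \<le> 1" for x :: "real^3"
  using component_le_norm_cart[of x k] by (cases "x = 0") (auto simp: divide_le_eq)

lemma radial_deriv_L2: "radial_deriv \<in> borel_L2"
  unfolding radial_deriv_def[abs_def]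
  by (intro borel_L2_add borel_L2_bounded_scaleR[OF _ abs_component_div_norm_le p_L2]) measurable

lemma unit_vector_components:
  fixes x :: "real^3"
  assumes "x \<noteq> 0" shows "(x $ 1 / norm x)\<^sup>2 + (x $ 2 / norm x)\<^sup>2 + (x $ 3 / norm x)\<^sup>2 = 1"
proof -
  have "(norm x)\<^sup>2 = (x $ 1)\<^sup>2 + (x $ 2)\<^sup>2 + (x $ 3)\<^sup>2"
    by (simp add: norm_vec_def L2_set_def sum_3 real_sqrt_pow2_iff)
  moreover have "(norm x)\<^sup>2 / (norm x)\<^sup>2 = 1" using assms by simp
  ultimately have "((x $ 1)\<^sup>2 + (x $ 2)\<^sup>2 + (x $ 3)\<^sup>2) / (norm x)\<^sup>2 = 1" by simp
  then show ?thesis by (simp add: power_divide add_divide_distrib)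
qed

text \<open>The pointwise bound is used with \<rho> = R and g = r R', the null Lagrangian with each
  component of the field R(|x|) x. The constants C and B bound this field and its Jacobian.\<close>

lemma pauli_gradient_ge_radial_integral:
  fixes R R' :: "real \<Rightarrow> real"
  assumes R: "\<And>r. r > 0 \<Longrightarrow> (R has_real_derivative R' r) (at r)" "isCont R 0"
    and Rm [measurable]: "R \<in> borel_measurable borel" "R' \<in> borel_measurable borel"
    and R0: "R 0 = 0"
    and Rb: "\<And>r. r \<ge> 0 \<Longrightarrow> 0 \<le> R r" "\<And>r. r \<ge> 0 \<Longrightarrow> R r \<le> B" "\<And>r. r \<ge> 0 \<Longrightarrow> R r * r \<le> C"
    and g: "\<And>r. r \<ge> 0 \<Longrightarrow> \<bar>r * R' r\<bar> \<le> R r"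
  shows "(\<integral>x. R (norm x) * (norm (radial_deriv x))\<^sup>2 \<partial>lborel) \<le> (\<integral>x. R (norm x) * (norm (pauli_grad x))\<^sup>2 \<partial>lborel)"
proof -
  define h where "h l x = R (norm x) * (x \<bullet> axis l 1)" for l and x :: "real^3"
  define h' where "h' l i x = R (norm x) * (axis i 1 \<bullet> (axis l 1 :: real^3)) + R' (norm x) * ((x \<bullet> axis i 1) / norm x) * (x \<bullet> axis l 1)"
    for l i and x :: "real^3"
  have dh: "has_dir_deriv (axis i 1) (h l) (h' l i)" for i l
    unfolding h_def[abs_def] h'_def[abs_def]
    by (rule has_dir_derivI, rule radial_field_has_derivative[OF R])
  have hm: "h l \<in> borel_measurable borel" "h' l i \<in> borel_measurable borel" for l i
    unfolding h_def[abs_def] h'_def[abs_def] by measurable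
  \<comment> \<open>The Jacobian R I + r R' n n^T. At x = 0 the second term is 0 by the convention
    on division, in agreement with the derivative there.\<close>
  have h'_eq: "h' l i x = (if i = l then R (norm x) else 0) + (norm x * R' (norm x)) * (x $ i / norm x) * (x $ l / norm x)" for l i x
  proof -
    have "(axis i 1 :: real^3) $ l = (if i = l then 1 else 0)" by (simp add: axis_def)
    then show ?thesis by (cases "x = 0") (simp_all add: h'_def inner_axis)
  qed
  have hb: "\<bar>h l x\<bar> \<le> C" for l x
  proof -
    have "\<bar>h l x\<bar> \<le> R (norm x) * norm x"
      unfolding h_def inner_axis using component_le_norm_cart[of x l] Rb(1)[of "norm x"]
      by (simp add: abs_mult mult_left_mono)
    then show ?thesis using Rb(3)[of "norm x"] by simp
  qed
  have h'b: "\<bar>h' l i x\<bar> \<le> 2 * B" for l i x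
  proof -
    let ?t = "(norm x * R' (norm x)) * (x $ i / norm x) * (x $ l / norm x)"
    have "\<bar>?t\<bar> \<le> B * 1 * 1"
      unfolding abs_mult[of _ "x $ l / norm x"] abs_mult[of _ "x $ i / norm x"]
      using g[of "norm x"] Rb(1,2)[of "norm x"]
      by (intro mult_mono abs_component_div_norm_le) auto
    moreover have "\<bar>if i = l then R (norm x) else 0\<bar> \<le> B"
      using Rb(1,2)[of "norm x"] by (cases "i = l") auto
    ultimately show ?thesis
      unfolding h'_eq using abs_triangle_ineq[of "if i = l then R (norm x) else 0" ?t] by linarith
  qed
  define L where "L l w x = h' l 1 x * w (p 2 x) (p 3 x) + h' l 2 x * w (p 3 x) (p 1 x) + h' l 3 x * w (p 1 x) (p 2 x)"
    for l x and w :: "complex^2 \<Rightarrow> complex^2 \<Rightarrow> real"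
  have L: "(\<integral>x. L l (pauli_form j k) x \<partial>lborel) = 0" "integrable lborel (L l (pauli_form j k))"
    if "j \<noteq> k" for l j k
  proof -
    show "(\<integral>x. L l (pauli_form j k) x \<partial>lborel) = 0"
      unfolding L_def
      by (rule null_lagrangian[OF bounded_bilinear_pauli_form pauli_form_skew[OF that] dh hm(1) hb hm(2) h'b])
    show "integrable lborel (L l (pauli_form j k))"
      unfolding L_def
      by (intro Bochner_Integration.integrable_add
          integrable_bounded_times_bilinear[OF bounded_bilinear_pauli_form hm(2) h'b p_L2 p_L2])
  qed
  have ne: "(2::3) \<noteq> 3" "(3::3) \<noteq> 1" "(1::3) \<noteq> 2" by auto
  have pw: "R (norm x) * (norm (radial_deriv x))\<^sup>2 + 2 * (L 1 (pauli_form 2 3) x + L 2 (pauli_form 3 1) x + L 3 (pauli_form 1 2) x)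
      \<le> R (norm x) * (norm (pauli_grad x))\<^sup>2" for x
  proof (cases "x = 0")
    \<comment> \<open>There is no unit normal at the origin; \<open>R 0 = 0\<close> makes both sides
      0.\<close>
    case True
    then show ?thesis by (simp add: L_def h'_eq R0)
  next
    case False
    have "2 * (L 1 (pauli_form 2 3) x + L 2 (pauli_form 3 1) x + L 3 (pauli_form 1 2) x) =
       2 * (R (norm x) * (pauli_form 2 3 (p 2 x) (p 3 x) + pauli_form 3 1 (p 3 x) (p 1 x) + pauli_form 1 2 (p 1 x) (p 2 x)))
       + 2 * (norm x * R' (norm x) * (
          x $ 1 / norm x * (x $ 1 / norm x * pauli_form 2 3 (p 2 x) (p 3 x) + x $ 2 / norm x * pauli_form 2 3 (p 3 x) (p 1 x) + x $ 3 / norm x * pauli_form 2 3 (p 1 x) (p 2 x))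
        + x $ 2 / norm x * (x $ 1 / norm x * pauli_form 3 1 (p 2 x) (p 3 x) + x $ 2 / norm x * pauli_form 3 1 (p 3 x) (p 1 x) + x $ 3 / norm x * pauli_form 3 1 (p 1 x) (p 2 x))
        + x $ 3 / norm x * (x $ 1 / norm x * pauli_form 1 2 (p 2 x) (p 3 x) + x $ 2 / norm x * pauli_form 1 2 (p 3 x) (p 1 x) + x $ 3 / norm x * pauli_form 1 2 (p 1 x) (p 2 x))))"
    proof -
      define n1 where "n1 = x $ 1 / norm x"
      define n2 where "n2 = x $ 2 / norm x"
      define n3 where "n3 = x $ 3 / norm x"
      define G where "G = norm x * R' (norm x)"
      have c: "h' 1 1 x = R (norm x) + G * n1 * n1" "h' 1 2 x = G * n2 * n1" "h' 1 3 x = G * n3 * n1"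
        "h' 2 1 x = G * n1 * n2" "h' 2 2 x = R (norm x) + G * n2 * n2" "h' 2 3 x = G * n3 * n2"
        "h' 3 1 x = G * n1 * n3" "h' 3 2 x = G * n2 * n3" "h' 3 3 x = R (norm x) + G * n3 * n3"
        unfolding h'_eq n1_def n2_def n3_def G_def by simp_all
      show ?thesis unfolding L_def c n1_def[symmetric] n2_def[symmetric] n3_def[symmetric] G_def[symmetric]
        by (simp only: distrib_left distrib_right mult_ac add_ac)
    qed
    moreover note pauli_gradient_ge_radial[OF unit_vector_components[OF False] g[OF norm_ge_zero], of x "p 1 x" "p 2 x" "p 3 x"]
    ultimately show ?thesis unfolding radial_deriv_def pauli_grad_def by linarith
  qed
  have Rm': "(\<lambda>x::real^3. R (norm x)) \<in> borel_measurable borel" by measurable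
  have Rb': "\<bar>R (norm x)\<bar> \<le> B" for x :: "real^3" using Rb(1,2)[of "norm x"] by simp
  note iR = integrable_bounded_times_norm_sq[OF Rm' Rb' radial_deriv_L2]
  note iP = integrable_bounded_times_norm_sq[OF Rm' Rb' pauli_grad_L2]
  \<comment> \<open>Every L integrates to 0, so it can be added to the radial term for free, after
    which the pointwise bound applies.\<close>
  have "(\<integral>x. R (norm x) * (norm (radial_deriv x))\<^sup>2 \<partial>lborel) =
    (\<integral>x. R (norm x) * (norm (radial_deriv x))\<^sup>2 + 2 * (L 1 (pauli_form 2 3) x + L 2 (pauli_form 3 1) x + L 3 (pauli_form 1 2) x) \<partial>lborel)"
    using iR L[OF ne(1)] L[OF ne(2)] L[OF ne(3)]
    by (simp add: Bochner_Integration.integral_add)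
  also have "\<dots> \<le> (\<integral>x. R (norm x) * (norm (pauli_grad x))\<^sup>2 \<partial>lborel)"
    by (intro integral_mono pw iP Bochner_Integration.integrable_add integrable_mult_right iR L[OF ne(1)] L[OF ne(2)] L[OF ne(3)])
  finally show ?thesis .
qed

end

section \<open>The radial Hardy inequality\<close>

text \<open>For \<open>v = u(x)\<close>, \<open>w = \<partial>\<^sub>r u(x)\<close> and
  \<open>\<rho> = r / (a r + \<nu>)\<close> this is the square \<open>\<rho> |w + (b/\<nu>) r m v / \<rho>|\<^sup>2 \<ge> 0\<close>;
  for \<open>\<delta> = 0\<close> it is an equality on the ground state
  \<open>r powr -b * exp (-\<nu> r)\<close> of the Dirac-Coulomb operator.\<close>

lemma radial_square_completion:
  fixes v w :: "'b::real_inner"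
  assumes ab: "a * b = \<nu>\<^sup>2" "a + b = 2" and pos: "0 < a" "0 < b" "0 < \<nu>" "0 < r" "0 < \<delta>"
  defines "m \<equiv> 1 / (r + \<delta>)"
  shows "\<nu> * m * (norm v)\<^sup>2 \<le> r / (a * r + \<nu>) * (norm w)\<^sup>2 + b * (norm v)\<^sup>2
    + b / \<nu> * (2 * (r * m) * (v \<bullet> w) + (3 * m - m\<^sup>2 * r) * (norm v)\<^sup>2)"
proof -
  define c where "c = r * m"
  define d where "d = a * r + \<nu>"
  \<comment> \<open>With \<rho> = r / d this is (b/\<nu>) r m / \<rho>. For \<delta> = 0 it equals
    \<nu> + b/r, minus the logarithmic derivative of the ground state.\<close>
  define k where "k = b / \<nu> * m * d"
  have d: "d > 0" using pos by (simp add: d_def add_pos_pos)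
  have m: "m > 0" using pos by (simp add: m_def)
  have c: "0 \<le> c" "c \<le> 1" using pos m by (simp_all add: c_def m_def)
  have "0 \<le> r / d * (norm (w + k *\<^sub>R v))\<^sup>2" using d pos by simp
  also have "(norm (w + k *\<^sub>R v))\<^sup>2 = (norm w)\<^sup>2 + 2 * k * (v \<bullet> w) + k\<^sup>2 * (norm v)\<^sup>2"
    unfolding power2_norm_eq_inner
    by (simp add: inner_add_left inner_add_right inner_commute power2_eq_square algebra_simps)
  also have "r / d * \<dots> = r / d * (norm w)\<^sup>2 + 2 * (b / \<nu>) * c * (v \<bullet> w) + (b / \<nu>)\<^sup>2 * (c * m * d) * (norm v)\<^sup>2"
    using d by (simp add: k_def c_def power2_eq_square field_simps)
  finally have sq: "0 \<le> r / d * (norm w)\<^sup>2 + 2 * (b / \<nu>) * c * (v \<bullet> w) + (b / \<nu>)\<^sup>2 * (c * m * d) * (norm v)\<^sup>2" .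
  have "(b / \<nu>)\<^sup>2 * (c * m * d) + \<nu> * m \<le> b + b / \<nu> * (3 * m - m\<^sup>2 * r)"
  proof -
    have "(b / \<nu>)\<^sup>2 * (c * m * d) = b * (a * b / \<nu>\<^sup>2) * c\<^sup>2 + b\<^sup>2 / \<nu> * (c * m)"
      using pos by (simp add: d_def c_def power2_eq_square field_simps)
    also have "\<dots> = b * c\<^sup>2 + b\<^sup>2 / \<nu> * (c * m)" using ab(1) pos by simp
    \<comment> \<open>The losses c <= 1 here and m^2 r <= m below become equalities at \<delta> = 0,
      so nothing is given away in the limit.\<close>
    also have "\<dots> \<le> b * 1 + b\<^sup>2 / \<nu> * (1 * m)"
      using c m pos by (intro add_mono mult_left_mono mult_right_mono) (auto simp: power_le_one)
    finally have 1: "(b / \<nu>)\<^sup>2 * (c * m * d) \<le> b + b\<^sup>2 / \<nu> * m" by simp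
    have "m\<^sup>2 * r \<le> m" using c m by (simp add: c_def power2_eq_square mult_left_le mult.commute mult.left_commute)
    then have "b / \<nu> * (2 * m) \<le> b / \<nu> * (3 * m - m\<^sup>2 * r)"
      using pos by (intro mult_left_mono) auto
    \<comment> \<open>Here b^2 + \<nu>^2 = b (a + b) = 2 b. The 2 matches the divergence 2/|x| of
      the field x/|x|, so the Coulomb term exactly uses up what the divergence supplies.\<close>
    moreover have "b\<^sup>2 / \<nu> * m + \<nu> * m = b / \<nu> * (2 * m)"
    proof -
      have "b\<^sup>2 / \<nu> * m + \<nu> * m = (b\<^sup>2 + \<nu>\<^sup>2) / \<nu> * m"
        using pos by (simp add: power2_eq_square field_simps)
      also have "b\<^sup>2 + \<nu>\<^sup>2 = b * (a + b)" using ab(1) by (simp add: power2_eq_square algebra_simps)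
      finally show ?thesis unfolding ab(2) by simp
    qed
    ultimately show ?thesis using 1 by linarith
  qed
  from mult_right_mono[OF this, of "(norm v)\<^sup>2"] sq
  show ?thesis unfolding d_def[symmetric] c_def[symmetric]
    by (simp add: algebra_simps)
qed

context C2_spinor
begin

text \<open>The bound 1 / (a \<eta>) on the regularised field blows up as \<eta> tends to 0, but it
  only serves to make integrals vanish. The limit concerns the weights alone, and these stay below
  \<rho> <= 1/a.\<close>

lemma pauli_ge_radial_coulomb:
  assumes a: "0 < a" and nu: "0 < \<nu>"
  shows "(\<integral>x. norm x / (a * norm x + \<nu>) * (norm (radial_deriv x))\<^sup>2 \<partial>lborel)
    \<le> (\<integral>x. norm x / (a * norm x + \<nu>) * (norm (pauli_grad x))\<^sup>2 \<partial>lborel)"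
proof -
  define R where "R \<eta> r = r / ((a * r + \<nu>) * (1 + \<eta> * r))" for \<eta> r :: real
  define R' where "R' \<eta> r = (\<nu> - a * \<eta> * r\<^sup>2) / ((a * r + \<nu>) * (1 + \<eta> * r))\<^sup>2" for \<eta> r :: real
  have le: "(\<integral>x. R \<eta> (norm x) * (norm (radial_deriv x))\<^sup>2 \<partial>lborel) \<le> (\<integral>x. R \<eta> (norm x) * (norm (pauli_grad x))\<^sup>2 \<partial>lborel)"
    if e: "\<eta> > 0" for \<eta>
  proof (rule pauli_gradient_ge_radial_integral[where R' = "R' \<eta>" and B = "1 / a" and C = "1 / (a * \<eta>)"])
    have D: "(a * r + \<nu>) * (1 + \<eta> * r) > 0" if "r \<ge> 0" for r
      using that a nu e by (intro mult_pos_pos add_nonneg_pos add_pos_nonneg) auto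
    show "(R \<eta> has_real_derivative R' \<eta> r) (at r)" if "r > 0" for r
    proof -
      let ?P = "\<lambda>r. (a * r + \<nu>) * (1 + \<eta> * r)" and ?P' = "a * (1 + \<eta> * r) + (a * r + \<nu>) * \<eta>"
      have "(?P has_real_derivative ?P') (at r)" by (auto intro!: derivative_eq_intros)
      then have "(R \<eta> has_real_derivative (1 * ?P r - r * ?P') / (?P r * ?P r)) (at r)"
        unfolding R_def[abs_def] by (intro DERIV_divide DERIV_ident) (use D[of r] that in auto)
      moreover have "1 * ?P r - r * ?P' = \<nu> - a * \<eta> * r\<^sup>2"
        by (simp add: power2_eq_square algebra_simps)
      ultimately show ?thesis unfolding R'_def power2_eq_square[of "_ * _"] by simp
    qed
    show "isCont (R \<eta>) 0" unfolding R_def[abs_def] using nu by (intro continuous_intros) auto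
    show "R \<eta> \<in> borel_measurable borel" "R' \<eta> \<in> borel_measurable borel"
      unfolding R_def[abs_def] R'_def[abs_def] by measurable
    show "R \<eta> 0 = 0" by (simp add: R_def)
    show "0 \<le> R \<eta> r" if "r \<ge> 0" for r using D[OF that] that by (simp add: R_def)
    show "R \<eta> r \<le> 1 / a" if "r \<ge> 0" for r
    proof -
      have "r * a \<le> (a * r + \<nu>) * (1 + \<eta> * r)"
        using that a nu e by (simp add: algebra_simps add_nonneg_nonneg)
      then show ?thesis using D[OF that] a by (simp add: R_def field_simps)
    qed
    show "R \<eta> r * r \<le> 1 / (a * \<eta>)" if "r \<ge> 0" for r
    proof -
      have "r * r * (a * \<eta>) \<le> (a * r + \<nu>) * (1 + \<eta> * r)"
        using that a nu e by (simp add: algebra_simps add_nonneg_nonneg)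
      then show ?thesis using D[OF that] a e by (simp add: R_def field_simps)
    qed
    show "\<bar>r * R' \<eta> r\<bar> \<le> R \<eta> r" if r: "r \<ge> 0" for r
    proof -
      let ?D = "(a * r + \<nu>) * (1 + \<eta> * r)"
      have nn: "0 \<le> a * r" "0 \<le> \<nu> * \<eta> * r" "0 \<le> a * \<eta> * r\<^sup>2" using r a nu e by auto
      have "?D = a * r + \<nu> + a * \<eta> * r\<^sup>2 + \<nu> * \<eta> * r" by (simp add: power2_eq_square algebra_simps)
      \<comment> \<open>Both \<nu> and a \<eta> r^2 are summands of the expanded denominator, so it
        dominates their difference. This difference does change sign, as r R' is negative for large
        r.\<close>
      then have "\<bar>\<nu> - a * \<eta> * r\<^sup>2\<bar> \<le> ?D" using nn nu by linarith
      then have "r * (\<bar>\<nu> - a * \<eta> * r\<^sup>2\<bar> / ?D\<^sup>2) \<le> r * (?D / ?D\<^sup>2)"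
        using r D[OF r] by (intro mult_left_mono divide_right_mono) auto
      also have "\<dots> = R \<eta> r" using D[OF r] by (simp add: R_def power2_eq_square)
      finally show ?thesis using r by (simp add: R'_def abs_mult)
    qed
  qed
  have lim: "(\<lambda>n. \<integral>x. R (inverse (real (Suc n))) (norm x) * (norm (f x))\<^sup>2 \<partial>lborel)
     \<longlonglongrightarrow> (\<integral>x. norm x / (a * norm x + \<nu>) * (norm (f x))\<^sup>2 \<partial>lborel)" if f: "f \<in> borel_L2"
    for f :: "real^3 \<Rightarrow> complex^2"
  proof (rule integral_dominated_convergence[where w = "\<lambda>x. norm x / (a * norm x + \<nu>) * (norm (f x))\<^sup>2"])
    have [measurable]: "f \<in> borel_measurable borel" using f by auto
    have "\<bar>norm x / (a * norm x + \<nu>)\<bar> \<le> 1 / a" for x :: "real^3"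
    proof -
      have "0 < a * norm x + \<nu>" using a nu by (simp add: add_nonneg_pos)
      then show ?thesis using a nu by (simp add: field_simps)
    qed
    then show "integrable lborel (\<lambda>x. norm x / (a * norm x + \<nu>) * (norm (f x))\<^sup>2)"
      by (intro integrable_bounded_times_norm_sq[OF _ _ f]) measurable
    show "(\<lambda>x. norm x / (a * norm x + \<nu>) * (norm (f x))\<^sup>2) \<in> borel_measurable lborel"
      "(\<lambda>x. R (inverse (real (Suc n))) (norm x) * (norm (f x))\<^sup>2) \<in> borel_measurable lborel" for n
      unfolding R_def by measurable
    have Req: "R \<eta> r = r / (a * r + \<nu>) * (1 / (1 + \<eta> * r))" for \<eta> r by (simp add: R_def)
    show "AE x in lborel. norm (R (inverse (real (Suc n))) (norm x) * (norm (f x))\<^sup>2)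
        \<le> norm x / (a * norm x + \<nu>) * (norm (f x))\<^sup>2" for n
    proof (intro AE_I2)
      fix x :: "real^3"
      have p: "0 \<le> norm x / (a * norm x + \<nu>)" using a nu by (simp add: add_nonneg_nonneg)
      have "0 \<le> inverse (real (Suc n)) * norm x" by simp
      then have "1 / (1 + inverse (real (Suc n)) * norm x) \<le> 1" "0 \<le> 1 / (1 + inverse (real (Suc n)) * norm x)"
        by (simp_all add: divide_le_eq del: of_nat_Suc)
      from mult_left_le[OF this(1) p] mult_nonneg_nonneg[OF p this(2)]
      have "R (inverse (real (Suc n))) (norm x) \<le> norm x / (a * norm x + \<nu>)"
        "0 \<le> R (inverse (real (Suc n))) (norm x)" unfolding Req by blast+
      from mult_right_mono[OF this(1) zero_le_power2] this(2)
      show "norm (R (inverse (real (Suc n))) (norm x) * (norm (f x))\<^sup>2) \<le> norm x / (a * norm x + \<nu>) * (norm (f x))\<^sup>2"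
        by (simp only: real_norm_def abs_mult abs_of_nonneg abs_power2)
    qed
    show "AE x in lborel. (\<lambda>n. R (inverse (real (Suc n))) (norm x) * (norm (f x))\<^sup>2)
        \<longlonglongrightarrow> norm x / (a * norm x + \<nu>) * (norm (f x))\<^sup>2"
    proof (intro AE_I2)
      fix x :: "real^3"
      have "(\<lambda>n. norm x / (a * norm x + \<nu>) * (1 / (1 + inverse (real (Suc n)) * norm x)) * (norm (f x))\<^sup>2)
        \<longlonglongrightarrow> norm x / (a * norm x + \<nu>) * (1 / (1 + 0 * norm x)) * (norm (f x))\<^sup>2"
        by (intro tendsto_intros LIMSEQ_inverse_real_of_nat) simp
      then show "(\<lambda>n. R (inverse (real (Suc n))) (norm x) * (norm (f x))\<^sup>2)
        \<longlonglongrightarrow> norm x / (a * norm x + \<nu>) * (norm (f x))\<^sup>2" unfolding Req by simp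
    qed
  qed
  show ?thesis
    by (rule LIMSEQ_le[OF lim[OF radial_deriv_L2] lim[OF pauli_grad_L2]]) (use le in auto)
qed

text \<open>The last group of terms in the completed square is b/\<nu> times the divergence of |u|^2
  x / (|x| + \<delta>). It integrates to 0, since \<delta> > 0 keeps this field's coefficient and
  its derivatives bounded.\<close>

lemma radial_hardy:
  assumes ab: "a * b = \<nu>\<^sup>2" "a + b = 2" and pos: "0 < a" "0 < b" "0 < \<nu>" "0 < \<delta>"
  shows "\<nu> * (\<integral>x. 1 / (norm x + \<delta>) * (norm (u x))\<^sup>2 \<partial>lborel)
    \<le> (\<integral>x. norm x / (a * norm x + \<nu>) * (norm (radial_deriv x))\<^sup>2 \<partial>lborel) + b * (\<integral>x. (norm (u x))\<^sup>2 \<partial>lborel)"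
proof -
  define R where "R r = 1 / (r + \<delta>)" for r
  define R' where "R' r = - 1 / (r + \<delta>)\<^sup>2" for r
  define F where "F k x = R (norm x) * (x \<bullet> axis k 1)" for k and x :: "real^3"
  define F' where "F' k x = R (norm x) * (axis k 1 \<bullet> (axis k 1 :: real^3)) + R' (norm x) * ((x \<bullet> axis k 1) / norm x) * (x \<bullet> axis k 1)"
    for k and x :: "real^3"
  have [measurable]: "R \<in> borel_measurable borel" "R' \<in> borel_measurable borel"
    unfolding R_def[abs_def] R'_def[abs_def] by measurable
  have dF: "has_dir_deriv (axis k 1) (F k) (F' k)" for k
    unfolding F_def[abs_def] F'_def[abs_def]
  proof (rule has_dir_derivI, rule radial_field_has_derivative)
    show "(R has_real_derivative R' r) (at r)" if "r > 0" for r
      unfolding R_def[abs_def] R'_def using that pos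
      by (auto intro!: derivative_eq_intros simp: power2_eq_square)
    show "isCont R 0" unfolding R_def[abs_def] using pos by (intro continuous_intros) auto
  qed
  have Fm: "F k \<in> borel_measurable borel" "F' k \<in> borel_measurable borel" for k
    unfolding F_def[abs_def] F'_def[abs_def] by measurable
  have d: "0 < norm x + \<delta>" for x :: "real^3" using pos by (simp add: add_nonneg_pos)
  have Fb: "\<bar>F k x\<bar> \<le> 1" for k x
    using component_le_norm_cart[of x k] d[of x] pos
    by (simp add: F_def R_def inner_axis abs_mult divide_le_eq)
  have F'_eq: "F' k x = 1 / (norm x + \<delta>) - (1 / (norm x + \<delta>))\<^sup>2 * norm x * (x $ k / norm x)\<^sup>2" for k x
    by (cases "x = 0") (simp_all add: F'_def R_def R'_def inner_axis power2_eq_square)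
  have F'b: "\<bar>F' k x\<bar> \<le> 1 / \<delta> + 1 / \<delta>" for k x
  proof -
    have 1: "\<bar>1 / (norm x + \<delta>)\<bar> \<le> 1 / \<delta>" using pos d[of x] by (simp add: frac_le)
    have 2: "1 / (norm x + \<delta>) * norm x \<le> 1" using d[of x] pos by (simp add: divide_le_eq)
    let ?t = "1 / (norm x + \<delta>) * (1 / (norm x + \<delta>) * norm x) * (x $ k / norm x)\<^sup>2"
    have "\<bar>?t\<bar> \<le> 1 / \<delta> * 1 * 1"
      unfolding abs_mult[of _ "(x $ k / norm x)\<^sup>2"] abs_mult[of "1 / (norm x + \<delta>)" "1 / (norm x + \<delta>) * norm x"]
      using 1 2 d[of x] pos abs_component_div_norm_le[of x k]
      by (intro mult_mono) (auto simp: abs_square_le_1)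
    moreover have "F' k x = 1 / (norm x + \<delta>) - ?t"
      unfolding F'_eq by (simp add: power2_eq_square mult.assoc)
    ultimately show ?thesis
      using 1 abs_triangle_ineq4[of "1 / (norm x + \<delta>)" ?t] by linarith
  qed
  \<comment> \<open>The k-th summand of the divergence, in the shape in which
    \<open>integral_by_parts_bilinear\<close> delivers it.\<close>
  define T where "T k x = F k x * (u x \<bullet> p k x) + F k x * (p k x \<bullet> u x) + F' k x * (u x \<bullet> u x)" for k x
  have T: "(\<integral>x. T k x \<partial>lborel) = 0" "integrable lborel (T k)" for k
    unfolding T_def
    by (rule integral_by_parts_bilinear[OF bounded_bilinear_inner dF Fm(1) Fb Fm(2) F'b du u_L2 p_L2 du u_L2 p_L2])+
  have rb: "\<bar>norm x / (a * norm x + \<nu>)\<bar> \<le> 1 / a" for x :: "real^3"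
  proof -
    have "0 < a * norm x + \<nu>" using pos by (simp add: add_nonneg_pos)
    then show ?thesis using pos by (simp add: field_simps)
  qed
  have i1: "integrable lborel (\<lambda>x. norm x / (a * norm x + \<nu>) * (norm (radial_deriv x))\<^sup>2)"
    by (rule integrable_bounded_times_norm_sq[OF _ rb radial_deriv_L2]) measurable
  have i2: "integrable lborel (\<lambda>x. 1 / (norm x + \<delta>) * (norm (u x))\<^sup>2)"
    by (rule integrable_bounded_times_norm_sq[OF _ _ u_L2, where C = "1 / \<delta>"])
       (use pos d in \<open>auto simp: frac_le\<close>)
  have "AE x in lborel. x \<noteq> (0 :: real^3)" by (rule AE_lborel_singleton)
  then have pw: "AE x in lborel. \<nu> * (1 / (norm x + \<delta>) * (norm (u x))\<^sup>2) \<le>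
      norm x / (a * norm x + \<nu>) * (norm (radial_deriv x))\<^sup>2 + b * (norm (u x))\<^sup>2 + b / \<nu> * (T 1 x + T 2 x + T 3 x)"
  proof eventually_elim
    fix x :: "real^3" assume x: "x \<noteq> 0"
    define r where "r = norm x"
    define m where "m = 1 / (r + \<delta>)"
    have r: "r > 0" using x by (simp add: r_def)
    have Fx: "F k x = r * m * (x $ k / r)" for k
      using r by (simp add: F_def R_def r_def m_def inner_axis)
    have "T 1 x + T 2 x + T 3 x = 2 * (r * m) * (u x \<bullet> radial_deriv x) +
       (3 * m - m\<^sup>2 * r * ((x $ 1 / r)\<^sup>2 + (x $ 2 / r)\<^sup>2 + (x $ 3 / r)\<^sup>2)) * (norm (u x))\<^sup>2"
      unfolding T_def Fx F'_eq radial_deriv_def r_def[symmetric] m_def[symmetric] power2_norm_eq_inner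
      by (simp add: inner_add_right inner_commute[of "p _ x"] algebra_simps)
    also have "(x $ 1 / r)\<^sup>2 + (x $ 2 / r)\<^sup>2 + (x $ 3 / r)\<^sup>2 = 1"
      unfolding r_def by (rule unit_vector_components[OF x])
    finally show "\<nu> * (1 / (norm x + \<delta>) * (norm (u x))\<^sup>2) \<le>
      norm x / (a * norm x + \<nu>) * (norm (radial_deriv x))\<^sup>2 + b * (norm (u x))\<^sup>2 + b / \<nu> * (T 1 x + T 2 x + T 3 x)"
      using radial_square_completion[OF ab pos(1-3) r pos(4), of "u x" "radial_deriv x"]
      by (simp add: r_def m_def mult.assoc)
  qed
  have i3: "integrable lborel (\<lambda>x. norm x / (a * norm x + \<nu>) * (norm (radial_deriv x))\<^sup>2 + b * (norm (u x))\<^sup>2)"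
    by (intro Bochner_Integration.integrable_add i1 integrable_mult_right borel_L2_integrable u_L2)
  have i4: "integrable lborel (\<lambda>x. b / \<nu> * (T 1 x + T 2 x + T 3 x))"
    by (intro integrable_mult_right Bochner_Integration.integrable_add T)
  have "(\<integral>x. \<nu> * (1 / (norm x + \<delta>) * (norm (u x))\<^sup>2) \<partial>lborel) \<le>
      (\<integral>x. norm x / (a * norm x + \<nu>) * (norm (radial_deriv x))\<^sup>2 + b * (norm (u x))\<^sup>2 + b / \<nu> * (T 1 x + T 2 x + T 3 x) \<partial>lborel)"
    by (rule integral_mono_AE[OF _ _ pw]) (intro integrable_mult_right i2 Bochner_Integration.integrable_add i3 i4)+
  also have "\<dots> = (\<integral>x. norm x / (a * norm x + \<nu>) * (norm (radial_deriv x))\<^sup>2 \<partial>lborel) + b * (\<integral>x. (norm (u x))\<^sup>2 \<partial>lborel)"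
    using Bochner_Integration.integral_add[OF i3 i4] i1 borel_L2_integrable[OF u_L2] T
    by (simp add: Bochner_Integration.integral_add)
  finally show ?thesis by (simp only: integral_mult_right_zero)
qed

lemma dirac_coulomb_bound:
  assumes ab: "a * b = \<nu>\<^sup>2" "a + b = 2" and pos: "0 < a" "0 < b" "0 < \<nu>" "0 < \<delta>"
  shows "\<nu> * (\<integral>x. 1 / (norm x + \<delta>) * (norm (u x))\<^sup>2 \<partial>lborel)
    \<le> (\<integral>x. norm x / (a * norm x + \<nu>) * (norm (pauli_grad x))\<^sup>2 \<partial>lborel) + b * (\<integral>x. (norm (u x))\<^sup>2 \<partial>lborel)"
  using radial_hardy[OF assms] pauli_ge_radial_coulomb[OF pos(1,3)] by linarith

end

section \<open>Passage to \<open>H\<^sup>1\<close>\<close>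

text \<open>Used for constant matrices: the Pauli gradient of a mollified spinor is the
  mollification of the weak Pauli gradient.\<close>

lemma mollify_linear:
  assumes K: "K \<in> test_functions" and f: "f \<in> borel_L2" and T: "bounded_linear T"
  shows "mollify K (\<lambda>x. T (f x)) x = T (mollify K f x)"
proof -
  have "T (mollify K f x) = (\<integral>y. T (K (x - y) *\<^sub>R f y) \<partial>lborel)"
    unfolding mollify_def by (rule integral_bounded_linear[OF T mollify_integrable[OF K f], symmetric])
  then show ?thesis by (simp add: mollify_def linear_scale[OF bounded_linear.linear[OF T]])
qed

lemma mollify_add:
  assumes K: "K \<in> test_functions" and f: "f \<in> borel_L2" and g: "g \<in> borel_L2"
  shows "mollify K (\<lambda>x. f x + g x) x = mollify K f x + mollify K g x"
  using mollify_integrable[OF K f] mollify_integrable[OF K g]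
  by (simp add: mollify_def scaleR_add_right)

text \<open>With g = |F - f| one has | |F|^2 - |f|^2 | <= g^2 + 2 |f| g pointwise, and a weighted
  arithmetic-geometric mean inequality splits the product. The result is an explicit bound in terms
  of the L^2 distance.\<close>

lemma L2_weighted_tendsto:
  fixes f :: "'a::euclidean_space \<Rightarrow> 'b::euclidean_space"
  assumes fn: "\<And>n. F n \<in> borel_L2" and f: "f \<in> borel_L2"
    and lim: "(\<lambda>n. \<integral>\<^sup>+x. ennreal ((norm (F n x - f x))\<^sup>2) \<partial>lborel) \<longlonglongrightarrow> 0"
    and m: "m \<in> borel_measurable borel" "\<And>x. \<bar>m x\<bar> \<le> M"
  shows "(\<lambda>n. \<integral>x. m x * (norm (F n x))\<^sup>2 \<partial>lborel) \<longlonglongrightarrow> (\<integral>x. m x * (norm (f x))\<^sup>2 \<partial>lborel)"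
proof -
  define d where "d n = (\<integral>x. (norm (F n x - f x))\<^sup>2 \<partial>lborel)" for n
  define A where "A = (\<integral>x. (norm (f x))\<^sup>2 \<partial>lborel)"
  \<comment> \<open>The natural parameter is the square root of \<open>d n\<close>; the added null
    sequence keeps it positive when \<open>d n\<close> is 0.\<close>
  define e where "e n = sqrt (d n) + inverse (real (Suc n))" for n
  have M: "0 \<le> M" using m(2)[of undefined] by linarith
  have id: "integrable lborel (\<lambda>x. (norm (F n x - f x))\<^sup>2)" for n
    by (rule borel_L2_integrable[OF borel_L2_diff[OF fn f]])
  have d0: "d n \<ge> 0" for n by (simp add: d_def)
  have e0: "e n > 0" for n using d0[of n] by (simp add: e_def add_nonneg_pos)
  have "(\<lambda>n. ennreal (d n)) \<longlonglongrightarrow> ennreal 0"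
    using lim nn_integral_eq_integral[OF id] by (simp add: d_def)
  then have d: "d \<longlonglongrightarrow> 0" using d0 by (subst (asm) tendsto_ennreal_iff) auto
  have sd: "(\<lambda>n. sqrt (d n)) \<longlonglongrightarrow> 0" using tendsto_real_sqrt[OF d] by simp
  have bound: "\<bar>(\<integral>x. m x * (norm (F n x))\<^sup>2 \<partial>lborel) - (\<integral>x. m x * (norm (f x))\<^sup>2 \<partial>lborel)\<bar>
     \<le> M * (d n + (sqrt (d n) + e n * A))" for n
  proof -
    note i1 = integrable_bounded_times_norm_sq[OF m fn[of n]]
    note i2 = integrable_bounded_times_norm_sq[OF m f]
    have pw: "\<bar>m x * (norm (F n x))\<^sup>2 - m x * (norm (f x))\<^sup>2\<bar> \<le>
      M * ((1 + 1 / e n) * (norm (F n x - f x))\<^sup>2 + e n * (norm (f x))\<^sup>2)" for x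
    proof -
      define g where "g = norm (F n x - f x)"
      have tri: "norm (F n x) \<le> norm (f x) + g" "norm (f x) \<le> norm (F n x) + g"
        unfolding g_def using norm_triangle_sub[of "F n x" "f x"] norm_triangle_sub[of "f x" "F n x"]
        by (simp_all add: norm_minus_commute)
      have "\<bar>(norm (F n x))\<^sup>2 - (norm (f x))\<^sup>2\<bar> \<le> g\<^sup>2 + 2 * norm (f x) * g"
      proof -
        have "\<bar>norm (F n x) - norm (f x)\<bar> \<le> g" "norm (F n x) + norm (f x) \<le> g + 2 * norm (f x)"
          using tri by auto
        then have "\<bar>norm (F n x) - norm (f x)\<bar> * (norm (F n x) + norm (f x)) \<le> g * (g + 2 * norm (f x))"
          by (intro mult_mono) (auto simp: g_def)
        moreover have "\<bar>(norm (F n x))\<^sup>2 - (norm (f x))\<^sup>2\<bar> = \<bar>norm (F n x) - norm (f x)\<bar> * (norm (F n x) + norm (f x))"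
          by (simp add: power2_eq_square square_diff_square_factored abs_mult)
        ultimately show ?thesis by (simp add: power2_eq_square algebra_simps)
      qed
      also have "2 * norm (f x) * g \<le> 1 / e n * g\<^sup>2 + e n * (norm (f x))\<^sup>2"
      proof -
        have "0 \<le> (g - e n * norm (f x))\<^sup>2 / e n" using e0[of n] by simp
        also have "\<dots> = 1 / e n * g\<^sup>2 + e n * (norm (f x))\<^sup>2 - 2 * norm (f x) * g"
          using e0[of n] by (simp add: power2_eq_square field_simps)
        finally show ?thesis by simp
      qed
      finally have "\<bar>(norm (F n x))\<^sup>2 - (norm (f x))\<^sup>2\<bar> \<le> (1 + 1 / e n) * g\<^sup>2 + e n * (norm (f x))\<^sup>2"
        by (simp add: algebra_simps)
      from mult_mono[OF m(2)[of x] this M abs_ge_zero] show ?thesis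
        by (simp add: g_def abs_mult[symmetric] right_diff_distrib)
    qed
    have "\<bar>(\<integral>x. m x * (norm (F n x))\<^sup>2 \<partial>lborel) - (\<integral>x. m x * (norm (f x))\<^sup>2 \<partial>lborel)\<bar>
      = \<bar>\<integral>x. m x * (norm (F n x))\<^sup>2 - m x * (norm (f x))\<^sup>2 \<partial>lborel\<bar>"
      using i1 i2 by simp
    also have "\<dots> \<le> (\<integral>x. \<bar>m x * (norm (F n x))\<^sup>2 - m x * (norm (f x))\<^sup>2\<bar> \<partial>lborel)"
      by (rule integral_abs_bound)
    also have "\<dots> \<le> (\<integral>x. M * ((1 + 1 / e n) * (norm (F n x - f x))\<^sup>2 + e n * (norm (f x))\<^sup>2) \<partial>lborel)"
      by (intro integral_mono pw integrable_abs Bochner_Integration.integrable_diff i1 i2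
        integrable_mult_right Bochner_Integration.integrable_add id borel_L2_integrable f)
    also have "\<dots> = M * ((1 + 1 / e n) * d n + e n * A)"
      using id[of n] borel_L2_integrable[OF f] by (simp add: d_def A_def)
    also have "\<dots> \<le> M * (d n + (sqrt (d n) + e n * A))"
    proof (rule mult_left_mono[OF _ M])
      have "d n \<le> sqrt (d n) * e n"
      proof -
        have "sqrt (d n) * sqrt (d n) \<le> sqrt (d n) * e n"
          using d0[of n] by (intro mult_left_mono) (auto simp: e_def)
        then show ?thesis using d0[of n] by simp
      qed
      then have "d n / e n \<le> sqrt (d n)" using e0[of n] by (simp add: divide_le_eq)
      then show "(1 + 1 / e n) * d n + e n * A \<le> d n + (sqrt (d n) + e n * A)"
        by (simp add: distrib_right)
    qed
    finally show ?thesis .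
  qed
  have "(\<lambda>n. M * (d n + (sqrt (d n) + (sqrt (d n) + inverse (real (Suc n))) * A))) \<longlonglongrightarrow> M * (0 + (0 + (0 + 0) * A))"
    by (intro tendsto_intros d sd LIMSEQ_inverse_real_of_nat)
  then have z: "(\<lambda>n. M * (d n + (sqrt (d n) + e n * A))) \<longlonglongrightarrow> 0" by (simp add: e_def)
  have "(\<lambda>n. (\<integral>x. m x * (norm (F n x))\<^sup>2 \<partial>lborel) - (\<integral>x. m x * (norm (f x))\<^sup>2 \<partial>lborel)) \<longlonglongrightarrow> 0"
    by (rule Lim_null_comparison[OF _ z]) (use bound in auto)
  then show ?thesis by (simp add: LIM_zero_iff)
qed

text \<open>Weak differentiability enters as the identity \<open>weak\<close> between
  mollifications, which keeps the argument among Borel functions. For fixed \<delta> all three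
  weights are bounded, so the inequality for mollified spinors passes to the L^2 limit.\<close>

lemma weak_dirac_coulomb_bound:
  fixes f :: "real^3 \<Rightarrow> complex^2" and g :: "3 \<Rightarrow> real^3 \<Rightarrow> complex^2"
  assumes ab: "a * b = \<nu>\<^sup>2" "a + b = 2" and pos: "0 < a" "0 < b" "0 < \<nu>" "0 < \<delta>"
    and f: "f \<in> borel_L2" and g: "\<And>k. g k \<in> borel_L2"
    and weak: "\<And>K k. K \<in> test_functions \<Longrightarrow>
      mollify (\<lambda>z. frechet_derivative K (at z) (axis k 1)) f = mollify K (g k)"
  shows "\<nu> * (\<integral>x. 1 / (norm x + \<delta>) * (norm (f x))\<^sup>2 \<partial>lborel)
    \<le> (\<integral>x. norm x / (a * norm x + \<nu>) * (norm (\<Sum>k\<in>UNIV. pauli k *v g k x))\<^sup>2 \<partial>lborel)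
      + b * (\<integral>x. (norm (f x))\<^sup>2 \<partial>lborel)"
proof -
  define D where "D x = (\<Sum>k\<in>UNIV. pauli k *v g k x)" for x
  have D_eq: "D = (\<lambda>x. pauli 1 *v g 1 x + pauli 2 *v g 2 x + pauli 3 *v g 3 x)"
    by (simp add: D_def[abs_def] sum_3)
  have DL: "(\<lambda>x. pauli k *v g k x) \<in> borel_L2" for k
    by (rule borel_L2_linear[OF g bounded_linear_pauli])
  have D: "D \<in> borel_L2" unfolding D_eq by (intro borel_L2_add DL)
  define \<psi> where "\<psi> n = (mollifier n :: real^3 \<Rightarrow> real)" for n
  have \<psi>: "\<psi> n \<in> test_functions" for n by (simp add: \<psi>_def mollifier_test)
  \<comment> \<open>Both derivatives fall on the kernel: the Hessian exists although f has only
    first weak derivatives, and its symmetry is inherited from the mollifier.\<close>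
  define q where "q n j k = mollify (\<lambda>z. frechet_derivative (\<lambda>y. frechet_derivative (\<psi> n) (at y) (axis k 1)) (at z) (axis j 1)) f"
    for n j k
  have C2: "C2_spinor (mollify (\<psi> n) f) (\<lambda>k. mollify (\<psi> n) (g k)) (q n)" for n
  proof
    show "has_dir_deriv (axis k 1) (mollify (\<psi> n) f) (mollify (\<psi> n) (g k))" for k
      using mollify_has_dir_deriv[OF \<psi> f, of "axis k 1" n] by (simp add: weak[OF \<psi>])
    show "has_dir_deriv (axis j 1) (mollify (\<psi> n) (g k)) (q n j k)" for j k
      unfolding q_def weak[OF \<psi>, symmetric]
      by (rule mollify_has_dir_deriv[OF test_function_deriv[OF \<psi>] f])
    show "q n j k = q n k j" for j k
      unfolding q_def by (simp add: test_function_deriv_commute[OF \<psi>, of n "axis k 1"])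
    show "q n j k \<in> borel_L2" for j k
      unfolding q_def by (intro mollify_L2 test_function_deriv \<psi> f)
  qed (intro mollify_L2 \<psi> f g)+
  have grad: "C2_spinor.pauli_grad (\<lambda>k. mollify (\<psi> n) (g k)) = mollify (\<psi> n) D" for n
    unfolding C2_spinor.pauli_grad_def[OF C2, abs_def] D_eq
    by (rule ext) (simp add: mollify_add[OF \<psi>] borel_L2_add DL mollify_linear[OF \<psi> g bounded_linear_pauli])
  have le: "\<nu> * (\<integral>x. 1 / (norm x + \<delta>) * (norm (mollify (\<psi> n) f x))\<^sup>2 \<partial>lborel)
    \<le> (\<integral>x. norm x / (a * norm x + \<nu>) * (norm (mollify (\<psi> n) D x))\<^sup>2 \<partial>lborel)
      + b * (\<integral>x. 1 * (norm (mollify (\<psi> n) f x))\<^sup>2 \<partial>lborel)" for n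
    using C2_spinor.dirac_coulomb_bound[OF C2 ab pos, of n] unfolding grad by simp
  have d: "0 < norm x + \<delta>" "0 < a * norm x + \<nu>" for x :: "real^3"
    using pos by (simp_all add: add_nonneg_pos)
  have lim: "(\<lambda>n. \<integral>x. m x * (norm (mollify (\<psi> n) F x))\<^sup>2 \<partial>lborel) \<longlonglongrightarrow> (\<integral>x. m x * (norm (F x))\<^sup>2 \<partial>lborel)"
    if "F \<in> borel_L2" "m \<in> borel_measurable borel" "\<And>x. \<bar>m x\<bar> \<le> M"
    for m M and F :: "real^3 \<Rightarrow> complex^2"
    using L2_weighted_tendsto[OF mollify_L2[OF \<psi> that(1)] that(1) _ that(2,3)] mollifier_L2_converges[OF that(1)]
    by (simp add: \<psi>_def)
  have 1: "(\<lambda>n. \<nu> * (\<integral>x. 1 / (norm x + \<delta>) * (norm (mollify (\<psi> n) f x))\<^sup>2 \<partial>lborel))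
      \<longlonglongrightarrow> \<nu> * (\<integral>x. 1 / (norm x + \<delta>) * (norm (f x))\<^sup>2 \<partial>lborel)"
    by (intro tendsto_mult_left lim[OF f, where M = "1 / \<delta>"]) (use pos d in \<open>auto simp: frac_le\<close>)
  have 2: "(\<lambda>n. \<integral>x. norm x / (a * norm x + \<nu>) * (norm (mollify (\<psi> n) D x))\<^sup>2 \<partial>lborel)
      \<longlonglongrightarrow> (\<integral>x. norm x / (a * norm x + \<nu>) * (norm (D x))\<^sup>2 \<partial>lborel)"
  proof (rule lim[OF D, where M = "1 / a"])
    show "\<bar>norm x / (a * norm x + \<nu>)\<bar> \<le> 1 / a" for x :: "real^3"
      using d(2)[of x] pos by (simp add: field_simps)
  qed measurable
  have 3: "(\<lambda>n. b * (\<integral>x. 1 * (norm (mollify (\<psi> n) f x))\<^sup>2 \<partial>lborel)) \<longlonglongrightarrow> b * (\<integral>x. 1 * (norm (f x))\<^sup>2 \<partial>lborel)"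
    by (intro tendsto_mult_left lim[OF f, where M = 1]) auto
  show ?thesis
    using LIMSEQ_le[OF 1 tendsto_add[OF 2 3]] le unfolding D_def by auto
qed

text \<open>The integrals take values in [0, \<infinity>], so the Coulomb integral is not presumed
  finite; the larger side is, since its weight is bounded and \<phi> is in H^1.\<close>

theorem corollary3:
  fixes \<nu> :: real and \<phi> :: "real^3 \<Rightarrow> complex^2"
  assumes "0 < \<nu>" and "\<nu> < 1" and "\<phi> \<in> H1_space"
  shows "(\<integral>\<^sup>+x. ennreal ((norm (sigma_grad \<phi> x))\<^sup>2 / (1 + sqrt (1 - \<nu>\<^sup>2) + \<nu> / norm x)
             + (1 - sqrt (1 - \<nu>\<^sup>2)) * (norm (\<phi> x))\<^sup>2) \<partial>lebesgue)
         \<ge> ennreal \<nu> * (\<integral>\<^sup>+x. ennreal ((norm (\<phi> x))\<^sup>2 / norm x) \<partial>lebesgue)"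
proof -
  define a where "a = 1 + sqrt (1 - \<nu>\<^sup>2)"
  define b where "b = 1 - sqrt (1 - \<nu>\<^sup>2)"
  have nu2: "0 < \<nu>\<^sup>2" "\<nu>\<^sup>2 < 1" using assms(1,2) by (auto simp: power_less_one_iff abs_square_less_1)
  have s: "0 < sqrt (1 - \<nu>\<^sup>2)" "sqrt (1 - \<nu>\<^sup>2) < 1" using nu2 by auto
  \<comment> \<open>These relations, with positivity, are all that the analysis uses of the square
    root.\<close>
  have ab: "a * b = \<nu>\<^sup>2" "a + b = 2"
    using nu2 by (simp_all add: a_def b_def algebra_simps)
  have pos: "0 < a" "0 < b" "0 < \<nu>" using s assms(1) unfolding a_def b_def by linarith+
  have \<phi>: "\<phi> \<in> L2_space" using assms(3) by (simp add: H1_space_def)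
  have w: "has_weak_partial k \<phi> (weak_partial k \<phi>)" for k
  proof -
    have "\<exists>g. has_weak_partial k \<phi> g" using assms(3) by (simp add: H1_space_def)
    then show ?thesis unfolding weak_partial_def by (rule someI_ex)
  qed
  obtain f where f: "f \<in> borel_L2" "AE x in lebesgue. \<phi> x = f x"
    using L2_space_borel_representative[OF \<phi>] by metis
  have "\<exists>g. g \<in> borel_L2 \<and> (AE x in lebesgue. weak_partial k \<phi> x = g x)" for k
    using L2_space_borel_representative[of "weak_partial k \<phi>"] w[of k]
    unfolding has_weak_partial_def by metis
  then obtain g where g: "\<And>k. g k \<in> borel_L2" "\<And>k. AE x in lebesgue. weak_partial k \<phi> x = g k x"
    by metis
  define D where "D x = (\<Sum>k\<in>UNIV. pauli k *v g k x)" for x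
  have D: "D \<in> borel_L2"
    unfolding D_def[abs_def] by (intro borel_L2_sum borel_L2_linear[OF g(1) bounded_linear_pauli])
  have [measurable]: "f \<in> borel_measurable borel" "D \<in> borel_measurable borel" using f D by auto
  define I where "I = (\<integral>x. norm x / (a * norm x + \<nu>) * (norm (D x))\<^sup>2 \<partial>lborel) + b * (\<integral>x. (norm (f x))\<^sup>2 \<partial>lborel)"
  have bound: "\<nu> * (\<integral>x. 1 / (norm x + \<delta>) * (norm (f x))\<^sup>2 \<partial>lborel) \<le> I" if "\<delta> > 0" for \<delta>
    unfolding I_def D_def
    by (rule weak_dirac_coulomb_bound[OF ab pos that f(1) g(1) mollify_weak_partial[OF _ w \<phi> f g]])
  have dp: "0 < a * norm x + \<nu>" for x :: "real^3" using pos by (simp add: add_nonneg_pos)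
  have rb: "\<bar>norm x / (a * norm x + \<nu>)\<bar> \<le> 1 / a" for x :: "real^3"
    using dp[of x] pos by (simp add: field_simps)
  have iD: "integrable lborel (\<lambda>x. norm x / (a * norm x + \<nu>) * (norm (D x))\<^sup>2)"
    by (rule integrable_bounded_times_norm_sq[OF _ rb D]) measurable
  have if': "integrable lborel (\<lambda>x. b * (norm (f x))\<^sup>2)"
    by (intro integrable_mult_right borel_L2_integrable f)
  have nonzero: "AE x in lborel. x \<noteq> (0 :: real^3)" by (rule AE_lborel_singleton)
  have f_ae: "AE x in lborel. \<phi> x = f x" using f(2) by (simp add: AE_completion_iff)
  have D_ae: "AE x in lborel. sigma_grad \<phi> x = D x"
  proof -
    have "AE x in lborel. \<forall>k\<in>UNIV. weak_partial k \<phi> x = g k x"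
      using g(2) by (intro AE_finite_allI) (auto simp: AE_completion_iff)
    then show ?thesis by eventually_elim (simp add: sigma_grad_def D_def)
  qed
  have "(\<integral>\<^sup>+x. ennreal ((norm (sigma_grad \<phi> x))\<^sup>2 / (1 + sqrt (1 - \<nu>\<^sup>2) + \<nu> / norm x)
             + (1 - sqrt (1 - \<nu>\<^sup>2)) * (norm (\<phi> x))\<^sup>2) \<partial>lebesgue)
    = (\<integral>\<^sup>+x. ennreal (norm x / (a * norm x + \<nu>) * (norm (D x))\<^sup>2 + b * (norm (f x))\<^sup>2) \<partial>lborel)"
    unfolding nn_integral_completion
  proof (rule nn_integral_cong_AE)
    show "AE x in lborel. ennreal ((norm (sigma_grad \<phi> x))\<^sup>2 / (1 + sqrt (1 - \<nu>\<^sup>2) + \<nu> / norm x)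
             + (1 - sqrt (1 - \<nu>\<^sup>2)) * (norm (\<phi> x))\<^sup>2)
        = ennreal (norm x / (a * norm x + \<nu>) * (norm (D x))\<^sup>2 + b * (norm (f x))\<^sup>2)"
      using nonzero f_ae D_ae
    proof eventually_elim
      fix x :: "real^3" assume x: "x \<noteq> 0" and eq: "\<phi> x = f x" "sigma_grad \<phi> x = D x"
      \<comment> \<open>The two forms of the weight disagree at the origin, where
        \<open>\<nu> / norm x\<close> is 0, hence the equality almost everywhere.\<close>
      have "a + \<nu> / norm x = (a * norm x + \<nu>) / norm x" using x by (simp add: field_simps)
      then show "ennreal ((norm (sigma_grad \<phi> x))\<^sup>2 / (1 + sqrt (1 - \<nu>\<^sup>2) + \<nu> / norm x)
             + (1 - sqrt (1 - \<nu>\<^sup>2)) * (norm (\<phi> x))\<^sup>2)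
        = ennreal (norm x / (a * norm x + \<nu>) * (norm (D x))\<^sup>2 + b * (norm (f x))\<^sup>2)"
        unfolding a_def[symmetric] b_def[symmetric] eq by (simp add: mult.commute)
    qed
  qed
  also have "\<dots> = ennreal (\<integral>x. norm x / (a * norm x + \<nu>) * (norm (D x))\<^sup>2 + b * (norm (f x))\<^sup>2 \<partial>lborel)"
    using dp pos by (intro nn_integral_eq_integral Bochner_Integration.integrable_add iD if')
      (auto intro!: add_nonneg_nonneg divide_nonneg_pos)
  also have "\<dots> = ennreal I"
    unfolding I_def Bochner_Integration.integral_add[OF iD if'] by simp
  finally have rhs: "(\<integral>\<^sup>+x. ennreal ((norm (sigma_grad \<phi> x))\<^sup>2 / (1 + sqrt (1 - \<nu>\<^sup>2) + \<nu> / norm x)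
             + (1 - sqrt (1 - \<nu>\<^sup>2)) * (norm (\<phi> x))\<^sup>2) \<partial>lebesgue) = ennreal I" .
  \<comment> \<open>The value 0 at the origin agrees with y / 0 = 0 in the limit integrand, so
    monotone convergence holds at every point.\<close>
  define G where "G n x = ennreal (if x = 0 then 0 else 1 / (norm x + inverse (real (Suc n))) * (norm (f x))\<^sup>2)"
    for n and x :: "real^3"
  have dn: "0 < norm x + inverse (real (Suc n))" for n and x :: "real^3" by (simp add: add_nonneg_pos)
  have "(\<lambda>n. \<integral>\<^sup>+x. G n x \<partial>lborel) \<longlonglongrightarrow> (\<integral>\<^sup>+x. ennreal ((norm (f x))\<^sup>2 / norm x) \<partial>lborel)"
  proof (rule nn_integral_LIMSEQ)
    show "incseq G"
    proof (intro incseq_SucI le_funI)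
      fix n and x :: "real^3"
      have "inverse (real (Suc (Suc n))) \<le> inverse (real (Suc n))" by (simp add: le_imp_inverse_le)
      then have "1 / (norm x + inverse (real (Suc n))) \<le> 1 / (norm x + inverse (real (Suc (Suc n))))"
        using dn[of x "Suc n"] by (intro divide_left_mono mult_pos_pos dn) auto
      from ennreal_leI[OF mult_right_mono[OF this zero_le_power2]]
      show "G n x \<le> G (Suc n) x" unfolding G_def by (cases "x = 0") (simp_all only: if_True if_False order_refl simp_thms)
    qed
    show "G n \<in> borel_measurable lborel" for n unfolding G_def[abs_def] by measurable
    show "(\<lambda>n. G n x) \<longlonglongrightarrow> ennreal ((norm (f x))\<^sup>2 / norm x)" for x
    proof (cases "x = 0")
      case False
      have "(\<lambda>n. 1 / (norm x + inverse (real (Suc n))) * (norm (f x))\<^sup>2) \<longlonglongrightarrow> 1 / (norm x + 0) * (norm (f x))\<^sup>2"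
        using False by (intro tendsto_intros LIMSEQ_inverse_real_of_nat) simp
      then show ?thesis using False unfolding G_def by (intro tendsto_ennrealI) simp
    qed (simp add: G_def)
  qed
  moreover have "(\<integral>\<^sup>+x. G n x \<partial>lborel) \<le> ennreal (I / \<nu>)" for n
  proof -
    let ?\<delta> = "inverse (real (Suc n))"
    have i: "integrable lborel (\<lambda>x. 1 / (norm x + ?\<delta>) * (norm (f x))\<^sup>2)"
      by (rule integrable_bounded_times_norm_sq[OF _ _ f(1), where C = "1 / ?\<delta>"])
         (use dn in \<open>auto simp del: of_nat_Suc intro!: frac_le\<close>)
    have "(\<integral>\<^sup>+x. G n x \<partial>lborel) \<le> (\<integral>\<^sup>+x. ennreal (1 / (norm x + ?\<delta>) * (norm (f x))\<^sup>2) \<partial>lborel)"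
      unfolding G_def by (intro nn_integral_mono ennreal_leI) (use dn in \<open>auto simp del: of_nat_Suc\<close>)
    also have "\<dots> = ennreal (\<integral>x. 1 / (norm x + ?\<delta>) * (norm (f x))\<^sup>2 \<partial>lborel)"
      by (intro nn_integral_eq_integral i AE_I2) (use dn in \<open>simp add: less_imp_le del: of_nat_Suc\<close>)
    also have "\<dots> \<le> ennreal (I / \<nu>)"
      using bound[of ?\<delta>] pos by (intro ennreal_leI) (simp add: field_simps del: of_nat_Suc)
    finally show ?thesis .
  qed
  \<comment> \<open>I / \<nu> does not depend on n; here the Coulomb integral turns out to be
    finite.\<close>
  ultimately have "(\<integral>\<^sup>+x. ennreal ((norm (f x))\<^sup>2 / norm x) \<partial>lborel) \<le> ennreal (I / \<nu>)"
    by (intro LIMSEQ_le_const2) auto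
  then have "ennreal \<nu> * (\<integral>\<^sup>+x. ennreal ((norm (f x))\<^sup>2 / norm x) \<partial>lborel) \<le> ennreal \<nu> * ennreal (I / \<nu>)"
    by (rule mult_left_mono) simp
  also have "\<dots> = ennreal I"
    using pos by (simp add: ennreal_mult'[symmetric])
  also have "(\<integral>\<^sup>+x. ennreal ((norm (f x))\<^sup>2 / norm x) \<partial>lborel) = (\<integral>\<^sup>+x. ennreal ((norm (\<phi> x))\<^sup>2 / norm x) \<partial>lebesgue)"
    unfolding nn_integral_completion by (rule nn_integral_cong_AE) (use f_ae in eventually_elim, simp)
  finally show ?thesis unfolding rhs .
qed

end
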